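(* Let $\mathfrak{K}$ be a coagulation kernel satisfying the kernel hypotheses (K1)–(K3) listed in the context, and let $\mathfrak{f}^{\mathrm{in}}\in X_{0,1}^+$. For each $\epsilon\in(0,1)$ let $f^{\epsilon}=(f_i^{\epsilon})_{i\ge1}$ be a solution on $[0,\infty)$ of the discrete RBK equation with coagulation coefficients $(a_{i,j}^{\epsilon})_{i,j\ge 1}$ given either by $$a_{i,j}^{\epsilon}=\frac1\epsilon\int_{\Lambda_i^\epsilon\times\Lambda_j^\epsilon}\mathfrak{K}(\varsigma,\varrho)\,d\varrho\,d\varsigma\qquad\text{or by}\qquad a_{i,j}^{\epsilon}=\epsilon\,\mathfrak{K}(\epsilon i,\epsilon j),$$ and with initial data $f_i^{0,\epsilon}=\frac1\epsilon\int_{\Lambda_i^\epsilon}\mathfrak{f}^{\mathrm{in}}(\varsigma)\,d\varsigma$, $i\ge1$, such that $$\sum_{i=1}^\infty i f_i^\epsilon(t)\le\sum_{i=1}^\infty i f_i^{0,\epsilon}\qquad\text{for all } t\ge0 .$$ Define $\mathfrak{f}_\epsilon(\varrho,t)=\sum_{i=1}^\infty f_i^\epsilon(t)\,\mathbf{1}_{\Lambda_i^\epsilon}(\varrho)$ for $\varrho>0$, $t\ge 0$. Then there exist a sequence $\epsilon_n\to0$ in $(0,1)$ and a weak solution $\mathfrak{f}$ on $[0,\infty)$ of the continuous RBK equation with initial datum $\mathfrak{f}^{\mathrm{in}}$ such that $$\mathfrak{f}_{\epsilon_n}\to\mathfrak{f}\quad\text{in } \mathcal{C}([0,T];w\text{-}L^1(0,\infty))\quad\text{for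 every } T\in(0,+\infty).$$
   Context: Kernel hypotheses on $\mathfrak{K}:[0,\infty)^2\to[0,\infty)$: (K1) $0\le\mathfrak{K}(\varrho,\varsigma)=\mathfrak{K}(\varsigma,\varrho)=r(\varsigma)r(\varrho)+\alpha(\varsigma,\varrho)$ for all $\varsigma,\varrho$, where $r,\alpha$ are non-negative; (K2) $r\in\mathcal{C}([0,\infty);[0,\infty))$, $\alpha\in\mathcal{C}([0,\infty)^2;[0,\infty))$, and for some real $A>0$, $0\le\alpha(\varsigma,\varrho)=\alpha(\varrho,\varsigma)\le A\,r(\varsigma)r(\varrho)$ for $(\varsigma,\varrho)\in[1,\infty)^2$; (K3) for each $R\ge1$, $\omega_R(\varrho)=\sup_{\varsigma\in[0,R]}\mathfrak{K}(\varsigma,\varrho)/\varrho\to0$ as $\varrho\to\infty$. Function space: $X_{0,1}=L^1(0,\infty;(1+\varsigma)d\varsigma)$ with norm $\|x\|_{0,1}=\int_0^\infty(1+\varsigma)|x(\varsigma)|\,d\varsigma$; $X_{0,1}^+=\{x\in X_{0,1}:x\ge0\}$. Cells: $\Lambda_i^\epsilon=[(i-1/2)\epsilon,(i+1/2)\epsilon)$ for $i\ge1$; $\mathbf{1}_{\Lambda_i^\epsilon}$ is the indicator function. Discrete RBK equation with symmetric coefficients $a_{i,j}\ge0$ and initial data $(f_i^0)$: for $i\ge1$, $$\frac{df_i}{dt}=\sum_{j=1}^\infty a_{i+j,j}f_{i+j}f_j-\sum_{j=1}^\infty a_{i,j}f_if_j,\qquad f_i(0)=f_i^0 .$$ A solution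 on $[0,\infty)$ is a family of continuous functions $f_i:[0,\infty)\to[0,\infty)$ such that $\sup_{t\ge0}\sum_i i f_i(t)<\infty$, $\int_0^t\sum_{j}a_{i,j}f_j(s)\,ds<\infty$ for all $i\ge 1$ and $t\ge0$, and for all $i\ge 1$, $t\ge 0$ the equation holds in the integrated form $f_i(t)=f_i^0+\int_0^t\big[\sum_j a_{i+j,j}f_{i+j}f_j-\sum_j a_{i,j}f_if_j\big](s)\,ds$. Continuous RBK equation: $\partial_t\mathfrak{f}(\varsigma,t)=\int_0^\infty\mathfrak{K}(\varsigma+\varrho,\varrho)\mathfrak{f}(\varsigma+\varrho,t)\mathfrak{f}(\varrho,t)\,d\varrho-\int_0^\infty\mathfrak{K}(\varsigma,\varrho)\mathfrak{f}(\varsigma,t)\mathfrak{f}(\varrho,t)\,d\varrho$, $\mathfrak{f}(\cdot,0)=\mathfrak{f}^{\mathrm{in}}$. For $T\in(0,\infty]$, a weak solution on $[0,T)$ is a function $0\le\mathfrak{f}\in\mathcal{C}([0,T);L^1(0,\infty))\cap L^\infty(0,T;X_{0,1})$ such that for every $t\in[0,T)$ and $\phi\in L^\infty(0,\infty)$, $$\int_0^\infty(\mathfrak{f}(\varsigma,t)-\mathfrak{f}^{\mathrm{in}}(\varsigma))\phi(\varsigma)\,d\varsigma=\int_0^t\int_0^\infty\int_0^\varsigma[\phi(\varsigma-\varrho)-\phi(\varsigma)-\phi(\varrho)]\,\mathfrak{K}(\varsigma,\varrho)\mathfrak{f}(\varsigma,s)\mathfrak{f}(\varrho,s)\,d\varrho\,d\varsigma\,ds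 .$$ $\mathcal{C}([0,T];w\text{-}L^1(0,\infty))$ denotes the functions from $[0,T]$ to $L^1(0,\infty)$ that are continuous for the weak topology; $g_n\to g$ in this space means $\sup_{t\in[0,T]}\left|\int_0^\infty(g_n-g)(\varsigma,t)\psi(\varsigma)\,d\varsigma\right|\to0$ for every $\psi\in L^\infty(0,\infty)$. *)

theory Defs
  imports "HOL-Analysis.Analysis"
begin

text \<open>
  Functions on the half-line are total functions on the reals of which only the values at
  positive (or non-negative) arguments are used. An element of an \<open>L\<^sup>p\<close> space is represented by
  any Borel function in its class, so that pointwise conditions on it are stated almost
  everywhere.
\<close>

definition L1 :: "(real \<Rightarrow> real) set" where
  "L1 = {x. set_integrable lborel {0<..} x}"

definition Linf :: "(real \<Rightarrow> real) set" where
  "Linf = {\<phi>. set_borel_measurable lborel {0<..} \<phi> \<and>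
              (\<exists>C. AE s in lborel. 0 < s \<longrightarrow> \<bar>\<phi> s\<bar> \<le> C)}"

definition X01 :: "(real \<Rightarrow> real) set" where
  "X01 = {x. set_integrable lborel {0<..} (\<lambda>s. (1 + s) * x s)}"

definition norm01 :: "(real \<Rightarrow> real) \<Rightarrow> real" where
  "norm01 x = (LINT s:{0<..}|lborel. (1 + s) * \<bar>x s\<bar>)"

definition X01_pos :: "(real \<Rightarrow> real) set" where
  "X01_pos = {x \<in> X01. AE s in lborel. 0 < s \<longrightarrow> 0 \<le> x s}"


definition kernel_hyps :: "(real \<Rightarrow> real \<Rightarrow> real) \<Rightarrow> bool" where
  "kernel_hyps K \<longleftrightarrow>
     (\<exists>r \<alpha> A.
        (\<forall>x\<ge>0. 0 \<le> r x) \<and> (\<forall>x\<ge>0. \<forall>y\<ge>0. 0 \<le> \<alpha> x y) \<and>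
        (\<forall>x\<ge>0. \<forall>y\<ge>0. 0 \<le> K y x \<and> K y x = K x y \<and> K x y = r x * r y + \<alpha> x y) \<and>
        continuous_on {0..} r \<and>
        continuous_on ({0..} \<times> {0..}) (\<lambda>(x, y). \<alpha> x y) \<and>
        (0::real) < A \<and>
        (\<forall>x\<ge>1. \<forall>y\<ge>1. \<alpha> x y = \<alpha> y x \<and> \<alpha> x y \<le> A * r x * r y)) \<and>
     (\<forall>R\<ge>1. ((\<lambda>y. SUP x\<in>{0..R}. K x y / y) \<longlongrightarrow> 0) at_top)"


text \<open>
  Sequences are indexed from 1; the value at index 0 is irrelevant, and a sum over
  \<open>j \<ge> 1\<close> is written as a sum over all \<open>j\<close> of the terms with index \<open>Suc j\<close>.
\<close>

definition gain :: "(nat \<Rightarrow> nat \<Rightarrow> real) \<Rightarrow> (nat \<Rightarrow> real \<Rightarrow> real) \<Rightarrow> nat \<Rightarrow> real \<Rightarrow> real" where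
  "gain a f i s = (\<Sum>j. a (i + Suc j) (Suc j) * f (i + Suc j) s * f (Suc j) s)"

definition loss :: "(nat \<Rightarrow> nat \<Rightarrow> real) \<Rightarrow> (nat \<Rightarrow> real \<Rightarrow> real) \<Rightarrow> nat \<Rightarrow> real \<Rightarrow> real" where
  "loss a f i s = (\<Sum>j. a i (Suc j) * f i s * f (Suc j) s)"

text \<open>
  The summability and integrability clauses express that the integrated equation is
  meaningful. They are no extra restriction for non-negative coefficients: the loss term is
  integrable by the preceding clause, so an equation with finite left-hand side forces the
  non-negative gain term to be finite almost everywhere and integrable too.
\<close>

definition discrete_solution ::
  "(nat \<Rightarrow> nat \<Rightarrow> real) \<Rightarrow> (nat \<Rightarrow> real) \<Rightarrow> (nat \<Rightarrow> real \<Rightarrow> real) \<Rightarrow> bool" where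
  "discrete_solution a f0 f \<longleftrightarrow>
     (\<forall>i\<ge>1. continuous_on {0..} (f i) \<and> (\<forall>t\<ge>0. 0 \<le> f i t)) \<and>
     (SUP t\<in>{0..}. \<Sum>i. ennreal (real (Suc i) * f (Suc i) t)) < \<infinity> \<and>
     (\<forall>i\<ge>1. \<forall>t\<ge>0. (\<integral>\<^sup>+s\<in>{0..t}. (\<Sum>j. ennreal (a i (Suc j) * f (Suc j) s)) \<partial>lborel) < \<infinity>) \<and>
     (\<forall>i\<ge>1. \<forall>t\<ge>0.
        (AE s in lborel. s \<in> {0..t} \<longrightarrow>
           summable (\<lambda>j. a (i + Suc j) (Suc j) * f (i + Suc j) s * f (Suc j) s)) \<and>
        set_integrable lborel {0..t} (\<lambda>s. gain a f i s - loss a f i s) \<and>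
        f i t = f0 i + (LINT s:{0..t}|lborel. gain a f i s - loss a f i s))"


text \<open>
  A time-dependent function \<open>f x t\<close> is read as the map sending \<open>t\<close> to the class of
  \<open>\<lambda>x. f x t\<close>; no joint measurability is needed.

  The clause on \<open>K x y * f x s * f y s\<close> expresses that the triple integral is meaningful. It is
  no extra restriction: for \<open>\<phi> = 1\<close> the integrand of the weak formulation is
  \<open>- K x y * f x s * f y s \<le> 0\<close>, and the left-hand side is finite. Measurability of the map
  from \<open>t\<close> into \<open>X01\<close> follows from its continuity into \<open>L1\<close>.
\<close>

definition weak_solution ::
  "(real \<Rightarrow> real \<Rightarrow> real) \<Rightarrow> (real \<Rightarrow> real) \<Rightarrow> ereal \<Rightarrow> (real \<Rightarrow> real \<Rightarrow> real) \<Rightarrow> bool" where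
  "weak_solution K fin T f \<longleftrightarrow>
     0 < T \<and>
     (\<forall>t. 0 \<le> t \<and> ereal t < T \<longrightarrow>
        (\<lambda>x. f x t) \<in> L1 \<and> (AE x in lborel. 0 < x \<longrightarrow> 0 \<le> f x t)) \<and>
     (\<forall>t0. 0 \<le> t0 \<and> ereal t0 < T \<longrightarrow>
        ((\<lambda>t. LINT x:{0<..}|lborel. \<bar>f x t - f x t0\<bar>) \<longlongrightarrow> 0)
          (at t0 within {t. 0 \<le> t \<and> ereal t < T})) \<and>
     (\<exists>C. AE t in lborel. 0 < t \<and> ereal t < T \<longrightarrow>
        (\<lambda>x. f x t) \<in> X01 \<and> norm01 (\<lambda>x. f x t) \<le> C) \<and>
     (\<forall>t. 0 \<le> t \<and> ereal t < T \<longrightarrow>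
        (AE s in lborel. s \<in> {0..t} \<longrightarrow>
           set_integrable lborel {(x, y). 0 < y \<and> y < x} (\<lambda>(x, y). K x y * f x s * f y s)) \<and>
        set_integrable lborel {0..t}
          (\<lambda>s. LINT x:{0<..}|lborel. LINT y:{0<..<x}|lborel. K x y * f x s * f y s)) \<and>
     (\<forall>t \<phi>. 0 \<le> t \<and> ereal t < T \<and> \<phi> \<in> Linf \<longrightarrow>
        (LINT x:{0<..}|lborel. (f x t - fin x) * \<phi> x) =
        (LINT s:{0..t}|lborel. LINT x:{0<..}|lborel. LINT y:{0<..<x}|lborel.
           (\<phi> (x - y) - \<phi> x - \<phi> y) * K x y * f x s * f y s))"


definition weakly_continuous_L1 :: "real \<Rightarrow> (real \<Rightarrow> real \<Rightarrow> real) \<Rightarrow> bool" where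
  "weakly_continuous_L1 T g \<longleftrightarrow>
     (\<forall>t\<in>{0..T}. (\<lambda>x. g x t) \<in> L1) \<and>
     (\<forall>\<psi>\<in>Linf. continuous_on {0..T} (\<lambda>t. LINT x:{0<..}|lborel. g x t * \<psi> x))"

definition converges_CwL1 ::
  "real \<Rightarrow> (nat \<Rightarrow> real \<Rightarrow> real \<Rightarrow> real) \<Rightarrow> (real \<Rightarrow> real \<Rightarrow> real) \<Rightarrow> bool" where
  "converges_CwL1 T g h \<longleftrightarrow>
     (\<forall>n. weakly_continuous_L1 T (g n)) \<and> weakly_continuous_L1 T h \<and>
     (\<forall>\<psi>\<in>Linf. (\<lambda>n. SUP t\<in>{0..T}. \<bar>LINT x:{0<..}|lborel. (g n x t - h x t) * \<psi> x\<bar>)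
        \<longlonglongrightarrow> 0)"


definition cell :: "real \<Rightarrow> nat \<Rightarrow> real set" where
  "cell \<epsilon> i = {(real i - 1/2) * \<epsilon> ..< (real i + 1/2) * \<epsilon>}"

definition averaged_coeff :: "(real \<Rightarrow> real \<Rightarrow> real) \<Rightarrow> real \<Rightarrow> nat \<Rightarrow> nat \<Rightarrow> real" where
  "averaged_coeff K \<epsilon> i j =
     1 / \<epsilon> * (LINT z:cell \<epsilon> i \<times> cell \<epsilon> j|lborel. K (fst z) (snd z))"

definition pointwise_coeff :: "(real \<Rightarrow> real \<Rightarrow> real) \<Rightarrow> real \<Rightarrow> nat \<Rightarrow> nat \<Rightarrow> real" where
  "pointwise_coeff K \<epsilon> i j = \<epsilon> * K (\<epsilon> * real i) (\<epsilon> * real j)"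

definition discrete_init :: "(real \<Rightarrow> real) \<Rightarrow> real \<Rightarrow> nat \<Rightarrow> real" where
  "discrete_init fin \<epsilon> i = 1 / \<epsilon> * (LINT x:cell \<epsilon> i|lborel. fin x)"

definition step_function :: "real \<Rightarrow> (nat \<Rightarrow> real \<Rightarrow> real) \<Rightarrow> real \<Rightarrow> real \<Rightarrow> real" where
  "step_function \<epsilon> f x t = (\<Sum>i. f (Suc i) t * indicator (cell \<epsilon> (Suc i)) x)"

end

theory Submission
  imports Defs "HOL-Complex_Analysis.Great_Picard"
begin

text \<open>
Why the theorem holds. The step function \<open>u\<close> built from a discrete solution solves, exactly, a
continuous equation in which the size of the partner is rounded to the grid before it is
subtracted (\<open>rate_eq\<close>, based on \<open>cell_index_shift\<close>). No averaging of test functions is needed to pass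
from one to the other, and everything that follows concerns this shifted equation, isolated in
the locale \<open>shifted_rbk\<close>.

Two facts drive the argument. Firstly, the hypotheses on the kernel amount to a growth
\<open>K x y = o((1 + x) * (1 + y))\<close> at infinity (\<open>kernel_sublinear\<close>). The first moment is bounded by that of
the initial datum, because mass does not increase by assumption and the number of particles does
not increase by the equation; so large sizes contribute little to the collision term, uniformly
in the step. Secondly, particles only shrink. Hence a multiple of the indicator of \<open>{0..R}\<close> that
grows exponentially in time is a supersolution, and the mass of \<open>u\<close> above it does not increase
(\<open>comparison\<close>). Since this mass is initially small for a large multiple and large \<open>R\<close>, the step
functions are equi-integrable, uniformly in the step and on bounded time intervals.

Equi-integrability gives weakly convergent subsequences at rational times, and the equation makes
\<open>\<integral> u t x * \<phi> x\<close> Lipschitz in time with a constant that depends only on the bound of \<open>\<phi>\<close>. So one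
subsequence converges at all times, locally uniformly (\<open>weakly_convergent_subsequence\<close>,
\<open>weak_convergence_uniform\<close>). In the quadratic collision term the tensor squares of the step
functions again converge weakly and are equi-integrable, and the kernels converge pointwise
(\<open>collision_limit\<close>). With the indicator of a ray as test function the rounded shift converges almost
everywhere, which yields the limit equation for rays; a monotone class argument extends it to
all bounded measurable test functions (\<open>weak_form_limit\<close>). Finally, symmetry of the kernel brings the
collision term to the form of the definition (\<open>limit_rate_triangle\<close>), and testing with a sign shows
that the limit is Lipschitz in time with values in \<open>L\<^sup>1\<close> (\<open>g_L1_lipschitz\<close>).
\<close>

section \<open>Bounded measurable test functions\<close>

text \<open>
A functional form of Dynkin's lemma: a linear property of bounded functions that survives bounded
pointwise limits only has to be checked on the indicators of a generating \<open>\<pi>\<close>-system. Dynkin's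
lemma gives all indicators, linearity all simple functions, and rounding to multiples of
\<open>1 / (k + 1)\<close> all bounded ones. It serves for weak convergence on the line (rays), for weak
convergence of tensor squares (rectangles) and for the weak formulation of the limit equation (rays).
\<close>

lemma bounded_measurable_induct [consumes 5, case_names base const lin lim]:
  fixes v :: "'a \<Rightarrow> real"
  assumes M: "sets M = sigma_sets UNIV G" "Int_stable G" "space M = UNIV"
    and v: "v \<in> borel_measurable M" "\<And>x. \<bar>v x\<bar> \<le> C"
    and base: "\<And>A. A \<in> G \<Longrightarrow> P (indicator A)"
    and const: "P (\<lambda>_. 1)"
    and lin: "\<And>f g c Cf Cg. f \<in> borel_measurable M \<Longrightarrow> g \<in> borel_measurable M \<Longrightarrow>
      (\<And>x. \<bar>f x\<bar> \<le> Cf) \<Longrightarrow> (\<And>x. \<bar>g x\<bar> \<le> Cg) \<Longrightarrow> P f \<Longrightarrow> P g \<Longrightarrow> P (\<lambda>x. f x + c * g x)"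
    and lim: "\<And>u w D. (\<And>k. u k \<in> borel_measurable M) \<Longrightarrow> w \<in> borel_measurable M \<Longrightarrow>
      (\<And>k x. \<bar>u k x\<bar> \<le> D) \<Longrightarrow> (\<And>x. \<bar>w x\<bar> \<le> D) \<Longrightarrow> (\<And>x. (\<lambda>k. u k x) \<longlonglongrightarrow> w x) \<Longrightarrow>
      (\<And>k. P (u k)) \<Longrightarrow> P w"
  shows "P v"
proof -
  define Q where "Q = (\<lambda>f. f \<in> borel_measurable M \<and> (\<exists>B. \<forall>x. \<bar>f x\<bar> \<le> B) \<and> P f)"
  have Qlin: "Q (\<lambda>x. f x + c * g x)" if "Q f" "Q g" for f g c
  proof -
    from that obtain B1 B2 where B: "\<forall>x. \<bar>f x\<bar> \<le> B1" "\<forall>x. \<bar>g x\<bar> \<le> B2" 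
      and [measurable]: "f \<in> borel_measurable M" "g \<in> borel_measurable M" and PP: "P f" "P g"
      unfolding Q_def by blast
    have "\<bar>f x + c * g x\<bar> \<le> B1 + \<bar>c\<bar> * B2" for x
    proof -
      have "\<bar>f x + c * g x\<bar> \<le> \<bar>f x\<bar> + \<bar>c\<bar> * \<bar>g x\<bar>" by (metis abs_mult abs_triangle_ineq)
      also have "\<dots> \<le> B1 + \<bar>c\<bar> * B2" using B by (intro add_mono mult_left_mono) auto
      finally show ?thesis .
    qed
    moreover have "P (\<lambda>x. f x + c * g x)" using lin[of f g B1 B2 c] B PP by auto
    ultimately show ?thesis unfolding Q_def by auto
  qed
  have Q1: "Q (\<lambda>_. 1)" unfolding Q_def using const by (auto intro: exI[of _ 1])
  have Q0: "Q (\<lambda>_. 0)" using Qlin[OF Q1 Q1, of "-1"] by simp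
  have GM: "G \<subseteq> sets M" unfolding M(1) by auto
  have G: "G \<subseteq> Pow UNIV" by simp
  have Qsum: "Q (\<lambda>x. \<Sum>i\<in>I. c i * h i x)" if "finite I" "\<And>i. i \<in> I \<Longrightarrow> Q (h i)" for I :: "'b set" and c h
    using that
  proof (induction I rule: finite_induct)
    case empty then show ?case using Q0 by simp
  next
    case (insert j J)
    then have "Q (\<lambda>x. (\<Sum>i\<in>J. c i * h i x) + c j * h j x)" by (intro Qlin) auto
    then show ?case using insert by (simp add: add.commute)
  qed
  have ind: "Q (indicator A)" if "A \<in> sets M" for A
    using M(2) G that[unfolded M(1)]
  proof (induction rule: sigma_sets_induct_disjoint)
    case (basic A)
    then show ?case using base GM unfolding Q_def by (auto intro!: exI[of _ 1] simp: indicator_def)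
  next
    case empty
    then show ?case using Q0 by simp
  next
    case (compl A)
    have "(\<lambda>x. 1 + -1 * indicator A x) = (indicator (UNIV - A) :: 'a \<Rightarrow> real)"
      by (auto simp: indicator_def)
    then show ?case using Qlin[OF Q1 compl(2), of "-1"] by simp
  next
    case (union A)
    have [measurable]: "A i \<in> sets M" for i using union(2) by (auto simp: M(1))
    define s where "s = (\<lambda>k x. \<Sum>i<k. indicator (A i) x :: real)"
    have s: "s k = indicator (\<Union>i<k. A i)" for k
    proof
      fix x
      have "disjoint_family_on A {..<k}" using union(1) by (rule disjoint_family_on_mono[rotated]) simp
      then show "s k x = indicator (\<Union>i<k. A i) x"
        unfolding s_def by (subst indicator_UN_disjoint) auto
    qed
    have Qs: "Q (s k)" for k
      using Qsum[of "{..<k}" "\<lambda>i. indicator (A i)" "\<lambda>_. 1"] union(3) by (simp add: s_def)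
    have "P (indicator (\<Union>i. A i))"
    proof (rule lim[of s _ 1])
      show "P (s k)" "s k \<in> borel_measurable M" for k using Qs[of k] by (auto simp: Q_def)
      show "(\<lambda>k. s k x) \<longlonglongrightarrow> indicator (\<Union>i. A i) x" for x
        unfolding s by (rule LIMSEQ_indicator_UN)
    qed (auto simp: s indicator_def)
    then show ?case unfolding Q_def by (auto intro!: exI[of _ 1] simp: indicator_def)
  qed
  define w where "w = (\<lambda>k x. of_int \<lfloor>real (Suc k) * v x\<rfloor> / real (Suc k))"
  have wv: "\<bar>w k x - v x\<bar> \<le> 1 / real (Suc k)" for k x
  proof -
    have "\<bar>of_int \<lfloor>real (Suc k) * v x\<rfloor> - real (Suc k) * v x\<bar> \<le> 1" by linarith
    moreover have "w k x - v x = (of_int \<lfloor>real (Suc k) * v x\<rfloor> - real (Suc k) * v x) / real (Suc k)"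
      unfolding w_def by (simp add: field_simps)
    ultimately show ?thesis by (simp add: divide_right_mono)
  qed
  have [measurable]: "v \<in> borel_measurable M" by fact
  show "P v"
  proof (rule lim[of w v "C+1"])
    show wm: "w k \<in> borel_measurable M" for k unfolding w_def by measurable
    show "\<bar>w k x\<bar> \<le> C + 1" for k x
    proof -
      have "1 / real (Suc k) \<le> 1" by simp
      then show ?thesis using wv[of k x] v(2)[of x] by linarith
    qed
    show "\<bar>v x\<bar> \<le> C + 1" for x using v(2)[of x] by linarith
    show "(\<lambda>k. w k x) \<longlonglongrightarrow> v x" for x
    proof (rule LIM_zero_cancel, rule Lim_null_comparison)
      show "\<forall>\<^sub>F k in sequentially. norm (w k x - v x) \<le> 1 / real (Suc k)" using wv by simp
      show "(\<lambda>k. 1 / real (Suc k)) \<longlonglongrightarrow> 0" by (rule LIMSEQ_Suc[OF lim_const_over_n, of 1])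
    qed
    show "P (w k)" for k
    proof -
      define N where "N = \<lceil>real (Suc k) * C\<rceil> + 1"
      have rng: "\<lfloor>real (Suc k) * v x\<rfloor> \<in> {-N..N}" for x
      proof -
        have "\<bar>real (Suc k) * v x\<bar> \<le> real (Suc k) * C"
          using v(2)[of x] by (simp add: abs_mult mult_left_mono del: of_nat_Suc)
        then show ?thesis unfolding N_def by (auto simp del: of_nat_Suc) linarith+
      qed
      have "w k = (\<lambda>x. \<Sum>j\<in>{-N..N}. (of_int j / real (Suc k)) * indicator {x. \<lfloor>real (Suc k) * v x\<rfloor> = j} x)"
      proof
        fix x
        have "(\<Sum>j\<in>{-N..N}. (of_int j / real (Suc k)) * indicator {x. \<lfloor>real (Suc k) * v x\<rfloor> = j} x)
          = (\<Sum>j\<in>{-N..N}. if j = \<lfloor>real (Suc k) * v x\<rfloor> then of_int j / real (Suc k) else 0)"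
          by (intro sum.cong) (auto simp: indicator_def)
        also have "\<dots> = w k x" using rng[of x] by (simp add: w_def del: of_nat_Suc)
        finally show "w k x = (\<Sum>j\<in>{-N..N}. (of_int j / real (Suc k)) * indicator {x. \<lfloor>real (Suc k) * v x\<rfloor> = j} x)" by simp
      qed
      moreover have "Q (\<lambda>x. \<Sum>j\<in>{-N..N}. (of_int j / real (Suc k)) * indicator {x. \<lfloor>real (Suc k) * v x\<rfloor> = j} x)"
      proof (rule Qsum, simp, rule ind)
        fix j
        have "{x \<in> space M. \<lfloor>real (Suc k) * v x\<rfloor> = j} \<in> sets M" by measurable
        then show "{x. \<lfloor>real (Suc k) * v x\<rfloor> = j} \<in> sets M" using M(3) by simp
      qed
      ultimately show ?thesis by (simp add: Q_def)
    qed
  qed fact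
qed

section \<open>Equi-integrability and weak limits\<close>

text \<open>
In this form the notion is exactly what the estimates below produce and consume: up to a small
error in \<open>L\<^sup>1\<close>, uniformly in the index, the functions lie below a constant multiple of the
indicator of one set of finite measure. Tightness and the absence of concentration are both
contained in it.
\<close>

definition equi_integrable :: "'a measure \<Rightarrow> ('i \<Rightarrow> 'a \<Rightarrow> real) \<Rightarrow> bool" where
  "equi_integrable M U \<longleftrightarrow>
     (\<forall>i. integrable M (U i) \<and> (\<forall>x. 0 \<le> U i x)) \<and>
     (\<forall>\<eta>>0. \<exists>B\<ge>0. \<exists>S\<in>sets M. emeasure M S < \<infinity> \<and>
        (\<forall>i. (\<integral>x. max 0 (U i x - B * indicator S x) \<partial>M) \<le> \<eta>))"

lemma integrable_bounded_mult:
  fixes U \<phi> :: "'a \<Rightarrow> real"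
  assumes "integrable M U" "\<phi> \<in> borel_measurable M" "\<And>x. \<bar>\<phi> x\<bar> \<le> C"
  shows "integrable M (\<lambda>x. U x * \<phi> x)"
proof (rule Bochner_Integration.integrable_bound[where f="\<lambda>x. C * U x"])
  show "AE x in M. norm (U x * \<phi> x) \<le> norm (C * U x)"
  proof (rule AE_I2)
    fix x
    have "\<bar>\<phi> x\<bar> \<le> \<bar>C\<bar>" using assms(3)[of x] by linarith
    then have "\<bar>\<phi> x\<bar> * \<bar>U x\<bar> \<le> \<bar>C\<bar> * \<bar>U x\<bar>" by (rule mult_right_mono) simp
    then show "norm (U x * \<phi> x) \<le> norm (C * U x)" by (simp add: abs_mult mult.commute)
  qed
qed (use assms in \<open>auto intro!: borel_measurable_times dest: borel_measurable_integrable\<close>)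

lemma integral_bounded_mult_le:
  fixes U \<phi> :: "'a \<Rightarrow> real"
  assumes "integrable M U" "\<phi> \<in> borel_measurable M" "\<And>x. \<bar>\<phi> x\<bar> \<le> C" "\<And>x. 0 \<le> U x"
  shows "\<bar>\<integral>x. U x * \<phi> x \<partial>M\<bar> \<le> C * (\<integral>x. U x \<partial>M)"
proof -
  have "\<bar>\<integral>x. U x * \<phi> x \<partial>M\<bar> \<le> (\<integral>x. \<bar>U x * \<phi> x\<bar> \<partial>M)" by (rule integral_abs_bound)
  also have "\<dots> \<le> (\<integral>x. C * U x \<partial>M)"
  proof (rule integral_mono)
    show "integrable M (\<lambda>x. \<bar>U x * \<phi> x\<bar>)" using integrable_bounded_mult[OF assms(1-3)] by simp
    show "\<bar>U x * \<phi> x\<bar> \<le> C * U x" for x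
      using assms(3)[of x] assms(4)[of x] mult_right_mono[of "\<bar>\<phi> x\<bar>" C "U x"] by (simp add: abs_mult mult.commute)
  qed (use assms in simp)
  finally show ?thesis using assms by simp
qed

lemma integrable_between:
  fixes f h :: "'a \<Rightarrow> real"
  assumes "integrable M h" "f \<in> borel_measurable M" "\<And>x. 0 \<le> f x" "\<And>x. f x \<le> h x"
  shows "integrable M f"
proof (rule Bochner_Integration.integrable_bound[OF assms(1,2)])
  show "AE x in M. norm (f x) \<le> norm (h x)"
    by (intro AE_I2) (metis assms(3,4) abs_of_nonneg order_trans real_norm_def)
qed

lemma integrable_Icc_const: "integrable lborel (\<lambda>s::real. indicator {a..b} s * (c::real))"
  by (intro integrable_mult_left integrable_real_indicator) (auto simp: emeasure_lborel_Icc_eq)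

lemma integral_mult_linear:
  fixes V f h :: "'a \<Rightarrow> real"
  assumes V: "integrable M V" and f: "f \<in> borel_measurable M" "\<And>x. \<bar>f x\<bar> \<le> Cf"
    and h: "h \<in> borel_measurable M" "\<And>x. \<bar>h x\<bar> \<le> Ch"
  shows "(\<integral>x. V x * (f x + c * h x) \<partial>M) = (\<integral>x. V x * f x \<partial>M) + c * (\<integral>x. V x * h x \<partial>M)"
proof -
  have i: "integrable M (\<lambda>x. V x * f x)" "integrable M (\<lambda>x. V x * h x)"
    using assms by (auto intro!: integrable_bounded_mult)
  have "(\<integral>x. V x * (f x + c * h x) \<partial>M) = (\<integral>x. V x * f x + c * (V x * h x) \<partial>M)"
    by (simp add: algebra_simps)
  then show ?thesis using i by simp
qed

lemma integral_mult_bounded_convergence: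
  fixes V w :: "'a \<Rightarrow> real" and p :: "nat \<Rightarrow> 'a \<Rightarrow> real"
  assumes V: "integrable M V" and p: "\<And>k. p k \<in> borel_measurable M" "\<And>k x. \<bar>p k x\<bar> \<le> D"
    and w: "w \<in> borel_measurable M" and lim: "AE x in M. (\<lambda>k. V x * p k x) \<longlonglongrightarrow> V x * w x"
  shows "(\<lambda>k. \<integral>x. V x * p k x \<partial>M) \<longlonglongrightarrow> (\<integral>x. V x * w x \<partial>M)"
proof (rule integral_dominated_convergence[OF _ _ _ lim])
  have Vm: "V \<in> borel_measurable M" using V by auto
  show "(\<lambda>x. V x * w x) \<in> borel_measurable M" using Vm w by (rule borel_measurable_times)
  show "(\<lambda>x. V x * p k x) \<in> borel_measurable M" for k using Vm p(1) by (rule borel_measurable_times)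
  show "integrable M (\<lambda>x. \<bar>V x\<bar> * D)" using V by simp
  show "AE x in M. norm (V x * p k x) \<le> \<bar>V x\<bar> * D" for k
    by (intro AE_I2) (simp add: abs_mult mult_left_mono p(2))
qed

text \<open>
The excess of \<open>U i\<close> over \<open>B * indicator S\<close> contributes at most \<open>2 * C\<close> times its integral, and
\<open>B * indicator S\<close> is a single integrable function to which dominated convergence applies. Neither
bound depends on the index, whence the uniformity.
\<close>

lemma equi_integrable_bounded_convergence:
  fixes U :: "'i \<Rightarrow> 'a \<Rightarrow> real"
  assumes EI: "equi_integrable M U"
    and [measurable]: "\<And>k. \<phi> k \<in> borel_measurable M" "\<psi> \<in> borel_measurable M"
    and bd: "\<And>k x. \<bar>\<phi> k x\<bar> \<le> C" "\<And>x. \<bar>\<psi> x\<bar> \<le> C"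
    and conv: "AE x in M. (\<lambda>k. \<phi> k x) \<longlonglongrightarrow> \<psi> x" and eta: "\<eta> > 0"
  shows "\<exists>k0::nat. \<forall>k\<ge>k0. \<forall>i. \<bar>(\<integral>x. U i x * \<phi> k x \<partial>M) - (\<integral>x. U i x * \<psi> x \<partial>M)\<bar> \<le> \<eta>"
proof -
  have C0: "0 \<le> C" using bd(2)[of undefined] by linarith
  have U: "integrable M (U i)" "0 \<le> U i x" for i x using EI by (auto simp: equi_integrable_def)
  have [measurable]: "U i \<in> borel_measurable M" for i using U(1) by auto
  \<comment> \<open>the summand \<open>4\<close> keeps the quotient meaningful for \<open>C = 0\<close>\<close>
  define e where "e = \<eta> / (4 * C + 4)"
  have e: "e > 0" "2 * C * e \<le> \<eta> / 2" using eta C0 by (auto simp: e_def field_simps)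
  obtain B S where B: "B \<ge> 0" and S[measurable]: "S \<in> sets M" and fin: "emeasure M S < \<infinity>"
    and exc: "\<And>i. (\<integral>x. max 0 (U i x - B * indicator S x) \<partial>M) \<le> e"
    using EI e(1) unfolding equi_integrable_def by meson
  have "(\<lambda>k. \<integral>x. B * indicator S x * \<bar>\<phi> k x - \<psi> x\<bar> \<partial>M) \<longlonglongrightarrow> (\<integral>x. 0 \<partial>M)"
  proof (rule integral_dominated_convergence[where w="\<lambda>x. B * indicator S x * (2 * C)"])
    show "integrable M (\<lambda>x. B * indicator S x * (2 * C))"
      using S fin by (intro integrable_mult_left integrable_mult_right integrable_real_indicator)
    show "AE x in M. (\<lambda>k. B * indicator S x * \<bar>\<phi> k x - \<psi> x\<bar>) \<longlonglongrightarrow> 0"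
      using conv
    proof eventually_elim
      case (elim x)
      have "(\<lambda>k. B * indicator S x * \<bar>\<phi> k x - \<psi> x\<bar>) \<longlonglongrightarrow> B * indicator S x * \<bar>\<psi> x - \<psi> x\<bar>"
        by (intro tendsto_intros elim)
      then show ?case by simp
    qed
    show "AE x in M. norm (B * indicator S x * \<bar>\<phi> k x - \<psi> x\<bar>) \<le> B * indicator S x * (2 * C)" for k
    proof (rule AE_I2)
      fix x
      have "\<bar>\<phi> k x - \<psi> x\<bar> \<le> 2 * C" using bd(1)[of k x] bd(2)[of x] by linarith
      then show "norm (B * indicator S x * \<bar>\<phi> k x - \<psi> x\<bar>) \<le> B * indicator S x * (2 * C)"
        using B by (auto simp: indicator_def intro!: mult_left_mono)
    qed
  qed measurable
  then have "(\<lambda>k. \<integral>x. B * indicator S x * \<bar>\<phi> k x - \<psi> x\<bar> \<partial>M) \<longlonglongrightarrow> 0" by simp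
  then have "\<forall>\<^sub>F k in sequentially. (\<integral>x. B * indicator S x * \<bar>\<phi> k x - \<psi> x\<bar> \<partial>M) < \<eta> / 2"
    using eta by (intro order_tendstoD(2)) auto
  then obtain k0 where k0: "\<And>k. k \<ge> k0 \<Longrightarrow> (\<integral>x. B * indicator S x * \<bar>\<phi> k x - \<psi> x\<bar> \<partial>M) < \<eta> / 2"
    by (auto simp: eventually_sequentially)
  show ?thesis
  proof (intro exI[of _ k0] allI impI)
    fix k i assume k: "k \<ge> k0"
    have i1: "integrable M (\<lambda>x. U i x * \<phi> k x)" "integrable M (\<lambda>x. U i x * \<psi> x)"
      using U bd by (auto intro!: integrable_bounded_mult)
    have i2: "integrable M (\<lambda>x. max 0 (U i x - B * indicator S x))"
      using U S fin by (intro integrable_max Bochner_Integration.integrable_diff integrable_mult_right integrable_real_indicator) auto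
    have i3: "integrable M (\<lambda>x. B * indicator S x * \<bar>\<phi> k x - \<psi> x\<bar>)"
    proof (rule integrable_bounded_mult[where C="2*C"])
      show "integrable M (\<lambda>x. B * indicator S x)" using S fin by (intro integrable_mult_right integrable_real_indicator)
      show "\<bar>\<bar>\<phi> k x - \<psi> x\<bar>\<bar> \<le> 2 * C" for x using bd(1)[of k x] bd(2)[of x] by linarith
    qed measurable
    have "\<bar>(\<integral>x. U i x * \<phi> k x \<partial>M) - (\<integral>x. U i x * \<psi> x \<partial>M)\<bar> = \<bar>\<integral>x. U i x * (\<phi> k x - \<psi> x) \<partial>M\<bar>"
      using i1 by (simp add: right_diff_distrib)
    also have "\<dots> \<le> (\<integral>x. \<bar>U i x * (\<phi> k x - \<psi> x)\<bar> \<partial>M)" by (rule integral_abs_bound)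
    also have "\<dots> \<le> (\<integral>x. B * indicator S x * \<bar>\<phi> k x - \<psi> x\<bar> + 2 * C * max 0 (U i x - B * indicator S x) \<partial>M)"
    proof (rule integral_mono)
      show "integrable M (\<lambda>x. \<bar>U i x * (\<phi> k x - \<psi> x)\<bar>)"
        using i1 by (simp add: right_diff_distrib)
      show "integrable M (\<lambda>x. B * indicator S x * \<bar>\<phi> k x - \<psi> x\<bar> + 2 * C * max 0 (U i x - B * indicator S x))"
        using i2 i3 by simp
      fix x
      define D where "D = \<bar>\<phi> k x - \<psi> x\<bar>"
      have D: "0 \<le> D" "D \<le> 2 * C" using bd(1)[of k x] bd(2)[of x] by (auto simp: D_def)
      have "U i x * D \<le> (B * indicator S x + max 0 (U i x - B * indicator S x)) * D"
        using D by (intro mult_right_mono) auto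
      also have "\<dots> \<le> B * indicator S x * D + max 0 (U i x - B * indicator S x) * (2*C)"
        using D by (auto simp: distrib_right intro!: mult_left_mono)
      finally show "\<bar>U i x * (\<phi> k x - \<psi> x)\<bar> \<le> B * indicator S x * \<bar>\<phi> k x - \<psi> x\<bar> + 2 * C * max 0 (U i x - B * indicator S x)"
        using U(2)[of i x] by (simp add: abs_mult D_def mult.commute)
    qed
    also have "\<dots> = (\<integral>x. B * indicator S x * \<bar>\<phi> k x - \<psi> x\<bar> \<partial>M) + 2 * C * (\<integral>x. max 0 (U i x - B * indicator S x) \<partial>M)"
      using i2 i3 by simp
    also have "\<dots> \<le> \<eta> / 2 + 2 * C * e"
      using k0[OF k] exc[of i] C0 by (intro add_mono mult_left_mono) auto
    also have "\<dots> \<le> \<eta>" using e by simp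
    finally show "\<bar>(\<integral>x. U i x * \<phi> k x \<partial>M) - (\<integral>x. U i x * \<psi> x \<partial>M)\<bar> \<le> \<eta>" .
  qed
qed

text \<open>
Thanks to the uniformity in the index the test function may move together with the weakly
converging function; this is how a product of a weakly and a pointwise convergent sequence
passes to the limit.
\<close>

lemma equi_integrable_bounded_convergence_diagonal:
  fixes U :: "nat \<Rightarrow> 'a \<Rightarrow> real"
  assumes "equi_integrable M U"
    and "\<And>k. \<phi> k \<in> borel_measurable M" "\<psi> \<in> borel_measurable M"
    and "\<And>k x. \<bar>\<phi> k x\<bar> \<le> C" "\<And>x. \<bar>\<psi> x\<bar> \<le> C"
    and "AE x in M. (\<lambda>k. \<phi> k x) \<longlonglongrightarrow> \<psi> x"
  shows "(\<lambda>n. (\<integral>x. U n x * \<phi> n x \<partial>M) - (\<integral>x. U n x * \<psi> x \<partial>M)) \<longlonglongrightarrow> 0"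
proof (rule LIMSEQ_I)
  fix r :: real assume "r > 0"
  then obtain k0 where "\<forall>k\<ge>k0. \<forall>i. \<bar>(\<integral>x. U i x * \<phi> k x \<partial>M) - (\<integral>x. U i x * \<psi> x \<partial>M)\<bar> \<le> r / 2"
    using equi_integrable_bounded_convergence[OF assms, of "r/2"] by auto
  then have k0: "\<bar>(\<integral>x. U n x * \<phi> n x \<partial>M) - (\<integral>x. U n x * \<psi> x \<partial>M)\<bar> \<le> r / 2" if "n \<ge> k0" for n
    using that by blast
  have "norm ((\<integral>x. U n x * \<phi> n x \<partial>M) - (\<integral>x. U n x * \<psi> x \<partial>M) - 0) < r" if "n \<ge> k0" for n
    using \<open>r > 0\<close> k0[OF that] by simp
  then show "\<exists>no. \<forall>n\<ge>no. norm ((\<integral>x. U n x * \<phi> n x \<partial>M) - (\<integral>x. U n x * \<psi> x \<partial>M) - 0) < r" by blast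
qed

lemma convergent_bounded_limit:
  fixes U :: "nat \<Rightarrow> 'a \<Rightarrow> real"
  assumes "equi_integrable M U"
    and "\<And>k. \<phi> k \<in> borel_measurable M" "\<psi> \<in> borel_measurable M"
    and "\<And>k x. \<bar>\<phi> k x\<bar> \<le> C" "\<And>x. \<bar>\<psi> x\<bar> \<le> C"
    and "AE x in M. (\<lambda>k. \<phi> k x) \<longlonglongrightarrow> \<psi> x"
    and conv: "\<And>k. convergent (\<lambda>n. \<integral>x. U n x * \<phi> k x \<partial>M)"
  shows "convergent (\<lambda>n. \<integral>x. U n x * \<psi> x \<partial>M)"
  unfolding Cauchy_convergent_iff[symmetric]
proof (rule metric_CauchyI)
  fix e :: real assume "e > 0"
  then obtain k where k: "\<And>i. \<bar>(\<integral>x. U i x * \<phi> k x \<partial>M) - (\<integral>x. U i x * \<psi> x \<partial>M)\<bar> \<le> e / 4"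
    using equi_integrable_bounded_convergence[OF assms(1-6), of "e/4"] by auto
  obtain N where N: "\<And>m n. m \<ge> N \<Longrightarrow> n \<ge> N \<Longrightarrow>
      dist (\<integral>x. U m x * \<phi> k x \<partial>M) (\<integral>x. U n x * \<phi> k x \<partial>M) < e / 4"
    using metric_CauchyD[OF conv[of k, folded Cauchy_convergent_iff], of "e/4"] \<open>e > 0\<close> by auto
  show "\<exists>N. \<forall>m\<ge>N. \<forall>n\<ge>N. dist (\<integral>x. U m x * \<psi> x \<partial>M) (\<integral>x. U n x * \<psi> x \<partial>M) < e"
  proof (intro exI[of _ N] allI impI)
    fix m n assume "m \<ge> N" "n \<ge> N"
    then show "dist (\<integral>x. U m x * \<psi> x \<partial>M) (\<integral>x. U n x * \<psi> x \<partial>M) < e"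
      using N[of m n] k[of m] k[of n] \<open>e > 0\<close> unfolding dist_real_def abs_less_iff abs_le_iff by linarith
  qed
qed

lemma weak_convergence_from_generator:
  fixes U :: "nat \<Rightarrow> 'a \<Rightarrow> real"
  assumes EI: "equi_integrable M U" and u: "integrable M u" and u0: "\<And>x. 0 \<le> u x"
    and gen: "sets M = sigma_sets UNIV G" "Int_stable G" "space M = UNIV"
    and base0: "\<And>A. A \<in> G \<Longrightarrow> (\<lambda>n. \<integral>x. U n x * indicator A x \<partial>M) \<longlonglongrightarrow> (\<integral>x. u x * indicator A x \<partial>M)"
    and const0: "(\<lambda>n. \<integral>x. U n x \<partial>M) \<longlonglongrightarrow> (\<integral>x. u x \<partial>M)"
    and phi: "\<phi> \<in> borel_measurable M" "\<And>x. \<bar>\<phi> x\<bar> \<le> C"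
  shows "(\<lambda>n. \<integral>x. U n x * \<phi> x \<partial>M) \<longlonglongrightarrow> (\<integral>x. u x * \<phi> x \<partial>M)"
proof -
  have U: "integrable M (U i)" for i using EI by (auto simp: equi_integrable_def)
  show "(\<lambda>n. \<integral>z. U n z * \<phi> z \<partial>M) \<longlonglongrightarrow> (\<integral>z. u z * \<phi> z \<partial>M)"
    using gen phi
  proof (induction \<phi> rule: bounded_measurable_induct)
    case (base A)
    then show ?case by (rule base0)
  next
    case const
    show ?case using const0 by simp
  next
    case (lin f g c Cf Cg)
    have "(\<lambda>n. (\<integral>x. U n x * f x \<partial>M) + c * (\<integral>x. U n x * g x \<partial>M)) \<longlonglongrightarrow> (\<integral>x. u x * f x \<partial>M) + c * (\<integral>x. u x * g x \<partial>M)"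
      by (intro tendsto_intros lin)
    then show ?case
      unfolding integral_mult_linear[OF U lin(1,3,2,4)] integral_mult_linear[OF u lin(1,3,2,4)] .
  next
    case (lim p w D)
    have c: "(\<lambda>k. \<integral>x. u x * p k x \<partial>M) \<longlonglongrightarrow> (\<integral>x. u x * w x \<partial>M)"
      by (rule integral_mult_bounded_convergence[OF u lim(1,3,2)]) (intro AE_I2 tendsto_mult_left lim)
    show ?case
    proof (rule LIMSEQ_I)
      fix r :: real assume r: "r > 0"
      then have r4: "r / 4 > 0" by simp
      have ae: "AE x in M. (\<lambda>k. p k x) \<longlonglongrightarrow> w x" using lim(5) by simp
      obtain k0 where k0: "\<And>k i. k \<ge> k0 \<Longrightarrow> \<bar>(\<integral>x. U i x * p k x \<partial>M) - (\<integral>x. U i x * w x \<partial>M)\<bar> \<le> r / 4"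
        using equi_integrable_bounded_convergence[OF EI lim(1-4) ae r4] by auto
      obtain k1 where k1: "\<And>k. k \<ge> k1 \<Longrightarrow> norm ((\<integral>x. u x * p k x \<partial>M) - (\<integral>x. u x * w x \<partial>M)) < r / 4"
        using LIMSEQ_D[OF c, of "r/4"] r by auto
      define k where "k = max k0 k1"
      obtain n0 where n0: "\<And>n. n \<ge> n0 \<Longrightarrow> norm ((\<integral>x. U n x * p k x \<partial>M) - (\<integral>x. u x * p k x \<partial>M)) < r / 4"
        using LIMSEQ_D[OF lim(6)[of k], of "r/4"] r by auto
      have "norm ((\<integral>x. U n x * w x \<partial>M) - (\<integral>x. u x * w x \<partial>M)) < r" if "n \<ge> n0" for n
        using n0[OF that] k0[of k n] k1[of k] r unfolding real_norm_def k_def abs_less_iff abs_le_iff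
        by simp
      then show "\<exists>n0. \<forall>n\<ge>n0. norm ((\<integral>x. U n x * w x \<partial>M) - (\<integral>x. u x * w x \<partial>M)) < r" by blast
    qed
  qed
qed

text \<open>
The useful half of the Dunford-Pettis theorem. The limits of \<open>\<integral>\<^sub>A U n\<close> form a finitely additive
set function; equi-integrability makes it continuous at the empty set, hence a measure, and it
charges no null set. Its Radon-Nikodym density is the weak limit.
\<close>

lemma weak_limit_density:
  fixes U :: "nat \<Rightarrow> 'a \<Rightarrow> real"
  assumes EI: "equi_integrable M U" and sf: "sigma_finite_measure M" and sp: "space M = UNIV"
    and conv: "\<And>A. A \<in> sets M \<Longrightarrow> convergent (\<lambda>n. \<integral>x. U n x * indicator A x \<partial>M)"
  shows "\<exists>u. integrable M u \<and> (\<forall>x. 0 \<le> u x) \<and>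
    (\<forall>\<phi>\<in>borel_measurable M. \<forall>C. (\<forall>x. \<bar>\<phi> x\<bar> \<le> C) \<longrightarrow>
       (\<lambda>n. \<integral>x. U n x * \<phi> x \<partial>M) \<longlonglongrightarrow> (\<integral>x. u x * \<phi> x \<partial>M))"
proof -
  interpret sigma_finite_measure M by fact
  have U: "integrable M (U i)" "0 \<le> U i x" for i x using EI by (auto simp: equi_integrable_def)
  have iU: "integrable M (\<lambda>x. U i x * indicator A x)" if "A \<in> sets M" for i A
    by (rule integrable_bounded_mult[OF U(1), where C=1]) (use that in \<open>auto simp: indicator_def\<close>)
  define \<mu> where "\<mu> = (\<lambda>A. lim (\<lambda>n. \<integral>x. U n x * indicator A x \<partial>M))"
  have mu: "(\<lambda>n. \<integral>x. U n x * indicator A x \<partial>M) \<longlonglongrightarrow> \<mu> A" if "A \<in> sets M" for A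
    unfolding \<mu>_def using conv[OF that] by (simp add: convergent_LIMSEQ_iff)
  have mu0: "0 \<le> \<mu> A" if "A \<in> sets M" for A
    using mu[OF that] U(2) by (intro LIMSEQ_le_const[OF mu[OF that]]) (auto intro!: exI[of _ 0] integral_nonneg_AE)
  have add: "\<mu> (A \<union> B) = \<mu> A + \<mu> B" if "A \<in> sets M" "B \<in> sets M" "A \<inter> B = {}" for A B
  proof (rule LIMSEQ_unique[OF mu])
    have "(\<integral>x. U n x * indicator (A \<union> B) x \<partial>M) = (\<integral>x. U n x * indicator A x \<partial>M) + (\<integral>x. U n x * indicator B x \<partial>M)" for n
    proof -
      have "U n x * indicator (A \<union> B) x = U n x * indicator A x + U n x * indicator B x" for x
        using that(3) by (auto simp: indicator_def)
      then show ?thesis using iU that by simp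
    qed
    then show "(\<lambda>n. \<integral>x. U n x * indicator (A \<union> B) x \<partial>M) \<longlonglongrightarrow> \<mu> A + \<mu> B"
      using tendsto_add[OF mu[OF that(1)] mu[OF that(2)]] by simp
  qed (use that in auto)
  define \<nu> where "\<nu> = measure_of UNIV (sets M) (\<lambda>A. ennreal (\<mu> A))"
  have emp: "\<mu> {} = 0" by (simp add: \<mu>_def)
  have ca: "countably_additive (sets M) (\<lambda>A. ennreal (\<mu> A))"
  proof (rule sets.empty_continuous_imp_countably_additive)
    show "positive (sets M) (\<lambda>A. ennreal (\<mu> A))" by (simp add: positive_def emp)
    show "additive (sets M) (\<lambda>A. ennreal (\<mu> A))" by (simp add: additive_def add mu0)
    fix A :: "nat \<Rightarrow> 'a set" assume A: "range A \<subseteq> sets M" "decseq A" "(\<Inter>i. A i) = {}"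
    have Am[measurable]: "A i \<in> sets M" for i using A by auto
    have "(\<lambda>i. \<mu> (A i)) \<longlonglongrightarrow> 0"
    proof (rule LIMSEQ_I)
      fix r :: real assume r: "r > 0"
      have "AE x in M. (\<lambda>k. indicator (A k) x :: real) \<longlonglongrightarrow> 0"
      proof (rule AE_I2)
        fix x
        show "(\<lambda>k. indicator (A k) x :: real) \<longlonglongrightarrow> 0"
        proof -
          have "(\<lambda>k. indicator (A k) x :: real) \<longlonglongrightarrow> indicator (\<Inter>i. A i) x"
            by (rule LIMSEQ_indicator_decseq[OF A(2)])
          then show ?thesis using A(3) by simp
        qed
      qed
      then have "\<exists>k0. \<forall>k\<ge>k0. \<forall>i. \<bar>(\<integral>x. U i x * indicator (A k) x \<partial>M) - (\<integral>x. U i x * 0 \<partial>M)\<bar> \<le> r / 2"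
        by (intro equi_integrable_bounded_convergence[OF EI, where C=1]) (use r in \<open>auto simp: indicator_def\<close>)
      then obtain k0 where k0: "\<And>k i. k \<ge> k0 \<Longrightarrow> \<bar>\<integral>x. U i x * indicator (A k) x \<partial>M\<bar> \<le> r / 2" by auto
      have "\<mu> (A k) \<le> r / 2" if "k \<ge> k0" for k
      proof (rule LIMSEQ_le_const2[OF mu[OF Am]], intro exI[of _ 0] allI impI)
        fix n show "(\<integral>x. U n x * indicator (A k) x \<partial>M) \<le> r / 2"
          using k0[OF that, of n] by (rule abs_le_D1)
      qed
      then have mk: "\<mu> (A k) \<le> r / 2" if "k \<ge> k0" for k using that by blast
      have "norm (\<mu> (A k) - 0) < r" if "k \<ge> k0" for k
        using r mu0[OF Am, of k] mk[OF that] by simp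
      then show "\<exists>no. \<forall>n\<ge>no. norm (\<mu> (A n) - 0) < r" by blast
    qed
    then show "(\<lambda>i. ennreal (\<mu> (A i))) \<longlonglongrightarrow> 0" using tendsto_ennrealI by fastforce
  qed simp
  have sets_nu[simp]: "sets \<nu> = sets M" and space_nu: "space \<nu> = UNIV"
    unfolding \<nu>_def using sp sets.sigma_sets_eq[of M] by (auto simp: sets_measure_of)
  have em: "emeasure \<nu> A = ennreal (\<mu> A)" if "A \<in> sets M" for A
    by (rule emeasure_measure_of[OF \<nu>_def])
      (use ca that sets_nu in \<open>auto simp: positive_def emp\<close>)
  have "absolutely_continuous M \<nu>"
    unfolding absolutely_continuous_def
  proof
    fix A assume A: "A \<in> null_sets M"
    then have "(\<integral>x. U n x * indicator A x \<partial>M) = 0" for n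
      by (intro integral_eq_zero_AE) (use AE_not_in[OF A] in \<open>eventually_elim, auto\<close>)
    then have "\<mu> A = 0" by (simp add: \<mu>_def)
    then show "A \<in> null_sets \<nu>" using A em[of A] by (auto simp: null_sets_def)
  qed
  from Radon_Nikodym[OF this] obtain h where h[measurable]: "h \<in> borel_measurable M" and dens: "density M h = \<nu>" by auto
  have hA: "(\<integral>\<^sup>+x. h x * indicator A x \<partial>M) = ennreal (\<mu> A)" if "A \<in> sets M" for A
    using em[OF that] that unfolding dens[symmetric] by (simp add: emeasure_density)
  have UM: "UNIV \<in> sets M" using sp sets.top by metis
  have hfin: "AE x in M. h x \<noteq> \<infinity>"
    using hA[OF UM] by (intro nn_integral_noteq_infinite) auto
  define u where "u = (\<lambda>x. enn2real (h x))"
  have [measurable]: "u \<in> borel_measurable M" unfolding u_def by measurable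
  have hu: "AE x in M. ennreal (u x) = h x" using hfin by eventually_elim (auto simp: u_def less_top)
  have uA': "(\<integral>\<^sup>+x. ennreal (u x * indicator A x) \<partial>M) = ennreal (\<mu> A)" if "A \<in> sets M" for A
    unfolding hA[OF that, symmetric]
    by (rule nn_integral_cong_AE, use hu in eventually_elim) (auto simp: indicator_def)
  have u0: "0 \<le> u x" for x by (simp add: u_def)
  have "integrable M u"
    by (rule integrableI_nonneg) (use uA'[OF UM] u0 in auto)
  moreover have uA: "(\<integral>x. u x * indicator A x \<partial>M) = \<mu> A" if "A \<in> sets M" for A
    using uA'[OF that] mu0[OF that] u0 that by (subst integral_eq_nn_integral) auto
  moreover have "(\<lambda>n. \<integral>x. U n x * \<phi> x \<partial>M) \<longlonglongrightarrow> (\<integral>x. u x * \<phi> x \<partial>M)"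
    if "\<phi> \<in> borel_measurable M" "\<And>x. \<bar>\<phi> x\<bar> \<le> C" for \<phi> C
  proof -
    have gen: "sets M = sigma_sets UNIV (sets M)" "Int_stable (sets M)"
      using sets.sigma_sets_eq[of M] sp by (auto simp: Int_stable_def)
    have ui: "integrable M u" by fact
    show ?thesis
      by (rule weak_convergence_from_generator[OF EI ui u0 gen sp _ _ that])
        (use mu uA mu[OF UM] uA[OF UM] in auto)
  qed
  ultimately show ?thesis using u0 by (intro exI[of _ u]) blast
qed

section \<open>Tensor squares\<close>

abbreviation plane :: "(real \<times> real) measure" where
  "plane \<equiv> lborel \<Otimes>\<^sub>M lborel"

lemma tensor_integrable:
  fixes f g :: "real \<Rightarrow> real"
  assumes f: "integrable lborel f" and g: "integrable lborel g"
  shows "integrable plane (\<lambda>z. f (fst z) * g (snd z))"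
    "(\<integral>z. f (fst z) * g (snd z) \<partial>plane) = (\<integral>x. f x \<partial>lborel) * (\<integral>x. g x \<partial>lborel)"
proof -
  have [measurable]: "f \<in> borel_measurable borel" "g \<in> borel_measurable borel" using f g by auto
  show i: "integrable plane (\<lambda>z. f (fst z) * g (snd z))"
    by (rule lborel_pair.Fubini_integrable) (use f g in \<open>auto simp: abs_mult\<close>)
  show "(\<integral>z. f (fst z) * g (snd z) \<partial>plane) = (\<integral>x. f x \<partial>lborel) * (\<integral>x. g x \<partial>lborel)"
    by (subst lborel_pair.integral_fst'[OF i, symmetric]) simp
qed

text \<open>
If \<open>p\<close> and \<open>q\<close> are the values of the bound \<open>B * indicator S\<close> at the two points, then
\<open>(a * b - p * q)\<^sup>+ \<le> (a - p)\<^sup>+ * b + a * (b - q)\<^sup>+\<close>. So the excess of the tensor square is controlled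
by the product of the excess of one factor and the mass of the other.
\<close>

lemma equi_integrable_tensor:
  fixes U :: "'i \<Rightarrow> real \<Rightarrow> real"
  assumes EI: "equi_integrable lborel U" and N: "\<And>i. (\<integral>x. U i x \<partial>lborel) \<le> N"
  shows "equi_integrable plane (\<lambda>i z. U i (fst z) * U i (snd z))"
  unfolding equi_integrable_def
proof (intro conjI allI impI)
  have U: "integrable lborel (U i)" "0 \<le> U i x" for i x using EI by (auto simp: equi_integrable_def)
  show "integrable plane (\<lambda>z. U i (fst z) * U i (snd z))" for i by (intro tensor_integrable U)
  show "0 \<le> U i (fst z) * U i (snd z)" for i z using U by simp
  have U0: "0 \<le> (\<integral>x. U i x \<partial>lborel)" for i using U(2) by (intro integral_nonneg_AE) simp
  have N0: "0 \<le> N" using N[of undefined] U0[of undefined] by linarith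
  fix \<eta> :: real assume "\<eta> > 0"
  define e where "e = \<eta> / (2 * N + 2)"
  have e: "e > 0" "2 * N * e \<le> \<eta>" using \<open>\<eta> > 0\<close> N0 by (auto simp: e_def field_simps)
  obtain B S where B: "B \<ge> 0" and S[measurable]: "S \<in> sets lborel" and fin: "emeasure lborel S < \<infinity>"
    and exc: "\<And>i. (\<integral>x. max 0 (U i x - B * indicator S x) \<partial>lborel) \<le> e"
    using EI e(1) unfolding equi_integrable_def by meson
  show "\<exists>B\<ge>0. \<exists>S\<in>sets plane. emeasure plane S < \<infinity> \<and>
    (\<forall>i. (\<integral>z. max 0 (U i (fst z) * U i (snd z) - B * indicator S z) \<partial>plane) \<le> \<eta>)"
  proof (intro exI[of _ "B\<^sup>2"] conjI bexI[of _ "S \<times> S"] allI)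
    show "emeasure plane (S \<times> S) < \<infinity>"
      using fin S by (simp add: lborel.emeasure_pair_measure_Times ennreal_mult_less_top)
    fix i
    define h where "h = (\<lambda>x. max 0 (U i x - B * indicator S x))"
    have h: "integrable lborel h" unfolding h_def
      using U S fin by (intro integrable_max Bochner_Integration.integrable_diff integrable_mult_right integrable_real_indicator) auto
    have i12: "integrable plane (\<lambda>z. h (fst z) * U i (snd z))"
       "integrable plane (\<lambda>z. U i (fst z) * h (snd z))" by (intro tensor_integrable h U)+
    have "(\<integral>z. max 0 (U i (fst z) * U i (snd z) - B\<^sup>2 * indicator (S \<times> S) z) \<partial>plane)
      \<le> (\<integral>z. h (fst z) * U i (snd z) + U i (fst z) * h (snd z) \<partial>plane)"
    proof (rule integral_mono)
      show "integrable plane (\<lambda>z. max 0 (U i (fst z) * U i (snd z) - B\<^sup>2 * indicator (S \<times> S) z))"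
        using fin S by (intro integrable_max Bochner_Integration.integrable_diff tensor_integrable U integrable_mult_right integrable_real_indicator)
          (auto simp: lborel.emeasure_pair_measure_Times ennreal_mult_less_top)
      show "integrable plane (\<lambda>z. h (fst z) * U i (snd z) + U i (fst z) * h (snd z))"
        using i12 by simp
      fix z :: "real \<times> real"
      define a b where ab: "a = U i (fst z)" "b = U i (snd z)"
      define p q where pq: "p = B * indicator S (fst z)" "q = B * indicator S (snd z)"
      have nn: "0 \<le> a" "0 \<le> b" "0 \<le> p" "0 \<le> q" using U B by (auto simp: ab pq)
      have "B\<^sup>2 * indicator (S \<times> S) z = p * q" by (cases z) (auto simp: pq indicator_def power2_eq_square)
      moreover have "max 0 (a * b - p * q) \<le> max 0 (a - p) * b + a * max 0 (b - q)"
      proof (cases "a \<le> p")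
        case True
        have "a * b - p * q \<le> a * b - a * q" using True nn by (simp add: mult_right_mono)
        also have "\<dots> = a * (b - q)" by (simp add: algebra_simps)
        also have "\<dots> \<le> a * max 0 (b - q)" using nn by (intro mult_left_mono) auto
        finally show ?thesis using True nn by simp
      next
        case False
        have "a * b - p * q = (a - p) * b + p * (b - q)" by (simp add: algebra_simps)
        also have "\<dots> \<le> (a - p) * b + p * max 0 (b - q)" using nn by (intro add_left_mono mult_left_mono) auto
        also have "\<dots> \<le> (a - p) * b + a * max 0 (b - q)" using nn False by (intro add_left_mono mult_right_mono) auto
        finally show ?thesis using False nn by simp
      qed
      ultimately show "max 0 (U i (fst z) * U i (snd z) - B\<^sup>2 * indicator (S \<times> S) z) \<le> h (fst z) * U i (snd z) + U i (fst z) * h (snd z)"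
        by (simp add: h_def ab pq)
    qed
    also have "\<dots> = 2 * (\<integral>x. U i x \<partial>lborel) * (\<integral>x. h x \<partial>lborel)"
      unfolding Bochner_Integration.integral_add[OF i12]
        tensor_integrable(2)[OF h U(1)[of i]] tensor_integrable(2)[OF U(1)[of i] h] by simp
    also have "\<dots> \<le> 2 * N * e"
    proof (intro mult_mono)
      show "(\<integral>x. h x \<partial>lborel) \<le> e" using exc[of i] by (simp add: h_def)
      show "0 \<le> (\<integral>x. h x \<partial>lborel)" by (intro integral_nonneg_AE) (simp add: h_def)
    qed (use N[of i] N0 U0[of i] in simp_all)
    finally show "(\<integral>z. max 0 (U i (fst z) * U i (snd z) - B\<^sup>2 * indicator (S \<times> S) z) \<partial>plane) \<le> \<eta>"
      using e by simp
  qed (use S in auto)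
qed

text \<open>
On a rectangle the integral factorises, and rectangles generate the product \<open>\<sigma>\<close>-algebra. This is
what makes the quadratic collision term weakly continuous.
\<close>

lemma tensor_weak_convergence:
  fixes U :: "nat \<Rightarrow> real \<Rightarrow> real"
  assumes EI: "equi_integrable lborel U" and N: "\<And>i. (\<integral>x. U i x \<partial>lborel) \<le> N"
    and u: "integrable lborel u" "\<And>x. 0 \<le> u x"
    and conv: "\<And>\<phi> C. \<phi> \<in> borel_measurable borel \<Longrightarrow> (\<And>x. \<bar>\<phi> x\<bar> \<le> C) \<Longrightarrow>
      (\<lambda>n. \<integral>x. U n x * \<phi> x \<partial>lborel) \<longlonglongrightarrow> (\<integral>x. u x * \<phi> x \<partial>lborel)"
    and \<Psi>: "\<Psi> \<in> borel_measurable plane" "\<And>z. \<bar>\<Psi> z\<bar> \<le> D"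
  shows "(\<lambda>n. \<integral>z. U n (fst z) * U n (snd z) * \<Psi> z \<partial>plane) \<longlonglongrightarrow>
     (\<integral>z. u (fst z) * u (snd z) * \<Psi> z \<partial>plane)"
proof -
    let ?G = "{a \<times> b | a b. a \<in> sets (lborel :: real measure) \<and> b \<in> sets (lborel :: real measure)}"
  define UU where "UU = (\<lambda>n z. U n (fst z) * U n (snd z))"
  define uu where "uu = (\<lambda>z. u (fst z) * u (snd z))"
  have EI2: "equi_integrable plane UU" unfolding UU_def by (rule equi_integrable_tensor[OF EI N])
  have U: "integrable lborel (U i)" "0 \<le> U i x" for i x using EI by (auto simp: equi_integrable_def)
  have uui: "integrable plane uu" unfolding uu_def by (rule tensor_integrable[OF u(1) u(1)])
  have uu0: "0 \<le> uu z" for z by (simp add: uu_def u)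
  have rect: "(\<lambda>n. \<integral>z. UU n z * indicator (a \<times> b) z \<partial>plane) \<longlonglongrightarrow> (\<integral>z. uu z * indicator (a \<times> b) z \<partial>plane)"
    if [measurable]: "a \<in> sets borel" "b \<in> sets borel" for a b
  proof -
    have eq: "(\<integral>z. (v (fst z) * v (snd z)) * indicator (a \<times> b) z \<partial>plane) = (\<integral>x. v x * indicator a x \<partial>lborel) * (\<integral>x. v x * indicator b x \<partial>lborel)"
      if "integrable lborel v" for v :: "real \<Rightarrow> real"
    proof -
      have i: "integrable lborel (\<lambda>x. v x * indicator a x)" "integrable lborel (\<lambda>x. v x * indicator b x)"
        using that by (auto intro!: integrable_bounded_mult[where C=1] simp: indicator_def)
      show ?thesis unfolding tensor_integrable(2)[OF i, symmetric]
        by (intro Bochner_Integration.integral_cong) (auto simp: indicator_def)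
    qed
    show ?thesis unfolding UU_def uu_def eq[OF u(1)] eq[OF U(1)]
      by (intro tendsto_mult conv[where C=1]) (auto simp: indicator_def)
  qed
  have gen: "sets plane = sigma_sets UNIV ?G" "Int_stable ?G" "space plane = UNIV"
    using sets_pair_measure[of "lborel :: real measure" "lborel :: real measure"] Int_stable_pair_measure_generator
    by (auto simp: space_pair_measure)
  have "(\<lambda>n. \<integral>z. UU n z * \<Psi> z \<partial>plane) \<longlonglongrightarrow> (\<integral>z. uu z * \<Psi> z \<partial>plane)"
  proof (rule weak_convergence_from_generator[OF EI2 uui uu0 gen _ _ \<Psi>])
    show "(\<lambda>n. \<integral>z. UU n z * indicator A z \<partial>plane) \<longlonglongrightarrow> (\<integral>z. uu z * indicator A z \<partial>plane)" if "A \<in> ?G" for A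
      using that rect by auto
    show "(\<lambda>n. \<integral>z. UU n z \<partial>plane) \<longlonglongrightarrow> (\<integral>z. uu z \<partial>plane)"
      using rect[of UNIV UNIV] by simp
  qed
  then show ?thesis by (simp add: UU_def uu_def)
qed

section \<open>Shears of the plane and positive parts\<close>

text \<open>
Every horizontal line is merely translated, so the claim is translation invariance on the line
combined with Fubini's theorem.
\<close>

lemma distr_shear:
  fixes \<tau> :: "real \<Rightarrow> real"
  assumes [measurable]: "\<tau> \<in> borel_measurable borel"
  shows "distr plane plane (\<lambda>z. (fst z + \<tau> (snd z), snd z)) = plane"
    (is "distr _ _ ?T = _")
proof (rule measure_eqI)
  have T: "?T \<in> measurable plane plane" by measurable
  fix A assume "A \<in> sets (distr plane plane ?T)"
  then have A: "A \<in> sets plane" by (simp only: sets_distr)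
  have TA: "?T -` A \<in> sets plane" using measurable_sets[OF T A] by (simp add: space_pair_measure)
  have "emeasure (distr plane plane ?T) A = emeasure plane (?T -` A)"
    using emeasure_distr[OF T A] by (simp add: space_pair_measure)
  also have "\<dots> = (\<integral>\<^sup>+y. emeasure lborel ((\<lambda>x. (x, y)) -` (?T -` A)) \<partial>lborel)"
    by (rule lborel_pair.emeasure_pair_measure_alt2[OF TA])
  also have "\<dots> = (\<integral>\<^sup>+y. emeasure lborel ((\<lambda>x. (x, y)) -` A) \<partial>lborel)"
  proof (rule nn_integral_cong)
    fix y
    have m: "(\<lambda>x. (x, y)) -` A \<in> sets borel" using sets_Pair2[OF A, of y] by simp
    have "(\<lambda>x. (x, y)) -` (?T -` A) = (+) (\<tau> y) -` ((\<lambda>x. (x, y)) -` A)" by (auto simp: add.commute)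
    also have "emeasure lborel \<dots> = emeasure (distr lborel borel ((+) (\<tau> y))) ((\<lambda>x. (x, y)) -` A)"
      using m by (subst emeasure_distr) auto
    also have "\<dots> = emeasure lborel ((\<lambda>x. (x, y)) -` A)" by (simp add: lborel_distr_plus)
    finally show "emeasure lborel ((\<lambda>x. (x, y)) -` (?T -` A)) = emeasure lborel ((\<lambda>x. (x, y)) -` A)" .
  qed
  also have "\<dots> = emeasure plane A" by (rule lborel_pair.emeasure_pair_measure_alt2[OF A, symmetric])
  finally show "emeasure (distr plane plane ?T) A = emeasure plane A" .
qed simp

lemma integral_shear:
  fixes F :: "real \<times> real \<Rightarrow> real"
  assumes \<tau>[measurable]: "\<tau> \<in> borel_measurable borel" and F: "integrable plane F"
  shows "integrable plane (\<lambda>z. F (fst z + \<tau> (snd z), snd z))"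
    "(\<integral>z. F (fst z + \<tau> (snd z), snd z) \<partial>plane) = (\<integral>z. F z \<partial>plane)"
proof -
  let ?T = "\<lambda>z. (fst z + \<tau> (snd z), snd z)"
  have T: "?T \<in> measurable plane plane" by measurable
  show "integrable plane (\<lambda>z. F (?T z))"
    by (rule integrable_distr[OF T]) (simp add: distr_shear[OF \<tau>] F)
  show "(\<integral>z. F (?T z) \<partial>plane) = (\<integral>z. F z \<partial>plane)"
    using integral_distr[OF T, of F] F by (simp add: distr_shear[OF \<tau>] borel_measurable_integrable)
qed

text \<open>
The chain rule for the positive part of a continuously differentiable function. The functions
\<open>(sqrt (w\<^sup>2 + \<delta>\<^sup>2) + w) / 2\<close> are smooth and convex and tend to the positive part as \<open>\<delta> \<rightarrow> 0\<close>, while their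
derivatives tend to \<open>(1 + sgn w) / 2\<close> boundedly; the value \<open>1 / 2\<close> where \<open>w = 0\<close> is an artefact of
this approximation and harmless later, because only membership in the subdifferential matters.
\<close>

lemma positive_part_integral:
  fixes w g :: "real \<Rightarrow> real"
  assumes t: "0 \<le> t" and g: "continuous_on {0..t} g"
    and w: "\<And>s. s \<in> {0..t} \<Longrightarrow> (w has_real_derivative g s) (at s within {0..t})"
  shows "max 0 (w t) = max 0 (w 0) + (\<integral>s. indicator {0..t} s * ((1 + sgn (w s)) / 2 * g s) \<partial>lborel)"
proof -
  define \<delta> where "\<delta> = (\<lambda>k::nat. 1 / real (Suc k))"
  have d0: "\<delta> \<longlonglongrightarrow> 0" unfolding \<delta>_def by (rule LIMSEQ_Suc[OF lim_const_over_n, of 1])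
  have dpos: "\<delta> k > 0" for k by (simp add: \<delta>_def)
  define \<Phi> where "\<Phi> = (\<lambda>k v::real. (sqrt (v\<^sup>2 + (\<delta> k)\<^sup>2) + v) / 2)"
  define D where "D = (\<lambda>k v::real. (1 + v / sqrt (v\<^sup>2 + (\<delta> k)\<^sup>2)) / 2)"
  have pos: "0 < v\<^sup>2 + (\<delta> k)\<^sup>2" for v k using dpos[of k] by (simp add: sum_power2_gt_zero_iff)
  have \<Phi>D: "(\<Phi> k has_real_derivative D k v) (at v)" for k v
  proof -
    have a: "((\<lambda>v. v\<^sup>2 + (\<delta> k)\<^sup>2) has_real_derivative 2 * v) (at v)" by (auto intro!: derivative_eq_intros)
    have "((\<lambda>v. (sqrt (v\<^sup>2 + (\<delta> k)\<^sup>2) + v) / 2) has_real_derivative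
        (inverse (sqrt (v\<^sup>2 + (\<delta> k)\<^sup>2)) / 2 * (2 * v) + 1) / 2) (at v)"
      by (intro DERIV_cdivide DERIV_add DERIV_chain2[OF DERIV_real_sqrt[OF pos] a] DERIV_ident)
    moreover have "(inverse r / 2 * (2 * v) + 1) / 2 = (1 + v / r) / 2" for r :: real
      unfolding divide_inverse by simp
    ultimately show ?thesis unfolding \<Phi>_def D_def by (simp only:)
  qed
  have wc: "continuous_on {0..t} w" using w by (rule DERIV_continuous_on)
  have Dc: "continuous_on UNIV (D k)" for k
  proof -
    have "sqrt (v\<^sup>2 + (\<delta> k)\<^sup>2) \<noteq> 0" for v using pos[of v k] by (metis less_irrefl real_sqrt_eq_zero_cancel_iff)
    then show ?thesis unfolding D_def by (intro continuous_intros) auto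
  qed
  have D1: "\<bar>D k v\<bar> \<le> 1" for k v
  proof -
    have "\<bar>v\<bar> \<le> sqrt (v\<^sup>2 + (\<delta> k)\<^sup>2)" by (rule real_le_rsqrt) simp
    then have "\<bar>v / sqrt (v\<^sup>2 + (\<delta> k)\<^sup>2)\<bar> \<le> 1"
      unfolding abs_divide by (intro divide_le_eq_1[THEN iffD2]) linarith
    moreover have "\<bar>(1 + q) / 2\<bar> \<le> 1" if "\<bar>q\<bar> \<le> 1" for q :: real
      using that by (simp add: abs_le_iff)
    ultimately show ?thesis unfolding D_def by blast
  qed
  have FTC: "(\<integral>s. indicator {0..t} s * (D k (w s) * g s) \<partial>lborel) = \<Phi> k (w t) - \<Phi> k (w 0)" for k
  proof -
    have "(\<integral>s. indicator {0..t} s *\<^sub>R (D k (w s) * g s) \<partial>lborel) = \<Phi> k (w t) - \<Phi> k (w 0)"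
    proof (rule integral_FTC_atLeastAtMost[OF t])
      fix s assume "0 \<le> s" "s \<le> t"
      then show "((\<lambda>s. \<Phi> k (w s)) has_vector_derivative D k (w s) * g s) (at s within {0..t})"
        unfolding has_real_derivative_iff_has_vector_derivative[symmetric]
        by (intro DERIV_chain2[OF \<Phi>D] w) auto
    next
      show "continuous_on {0..t} (\<lambda>s. D k (w s) * g s)"
        by (intro continuous_on_mult g continuous_on_compose2[OF Dc wc]) auto
    qed
    then show ?thesis by simp
  qed
  have gi: "integrable lborel (\<lambda>s. indicator {0..t} s * \<bar>g s\<bar>)"
    using borel_integrable_atLeastAtMost'[of 0 t "\<lambda>s. \<bar>g s\<bar>"] g by (simp add: set_integrable_def continuous_on_rabs)
  have wm: "(\<lambda>s. indicator {0..t} s * w s) \<in> borel_measurable borel"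
    using borel_measurable_continuous_on_indicator[of "{0..t}" w] wc by simp
  have gm: "(\<lambda>s. indicator {0..t} s * g s) \<in> borel_measurable borel"
    using borel_measurable_continuous_on_indicator[of "{0..t}" g] g by simp
  have "(\<lambda>k. \<integral>s. indicator {0..t} s * (D k (w s) * g s) \<partial>lborel) \<longlonglongrightarrow>
      (\<integral>s. indicator {0..t} s * ((1 + sgn (w s)) / 2 * g s) \<partial>lborel)"
  proof (rule integral_dominated_convergence[OF _ _ gi])
    have "(\<lambda>s. indicator {0..t} s * ((1 + sgn (w s)) / 2 * g s)) =
       (\<lambda>s. (1 + sgn (indicator {0..t} s * w s)) / 2 * (indicator {0..t} s * g s))"
      by (auto simp: indicator_def)
    also have "\<dots> \<in> borel_measurable borel" using wm gm by measurable
    finally show "(\<lambda>s. indicator {0..t} s * ((1 + sgn (w s)) / 2 * g s)) \<in> borel_measurable lborel" by simp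
    show "(\<lambda>s. indicator {0..t} s * (D k (w s) * g s)) \<in> borel_measurable lborel" for k
    proof -
      have "continuous_on {0..t} (\<lambda>s. D k (w s) * g s)"
        by (intro continuous_on_mult g continuous_on_compose2[OF Dc wc]) auto
      then show ?thesis using borel_measurable_continuous_on_indicator[of "{0..t}" "\<lambda>s. D k (w s) * g s"] by simp
    qed
    have lim: "(\<lambda>k. D k v) \<longlonglongrightarrow> (1 + sgn v) / 2" for v
    proof (cases "v = 0")
      case True then show ?thesis by (simp add: D_def)
    next
      case False
      have "(\<lambda>k. D k v) \<longlonglongrightarrow> (1 + v / sqrt (v\<^sup>2 + 0\<^sup>2)) / 2"
        unfolding D_def using False by (intro tendsto_intros d0) auto
      then show ?thesis using False by (simp add: real_sgn_eq)
    qed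
    show "AE s in lborel. (\<lambda>k. indicator {0..t} s * (D k (w s) * g s)) \<longlonglongrightarrow> indicator {0..t} s * ((1 + sgn (w s)) / 2 * g s)"
      by (intro AE_I2 tendsto_intros lim)
    show "AE s in lborel. norm (indicator {0..t} s * (D k (w s) * g s)) \<le> indicator {0..t} s * \<bar>g s\<bar>" for k
    proof (rule AE_I2)
      fix s
      have "\<bar>D k (w s)\<bar> * \<bar>g s\<bar> \<le> 1 * \<bar>g s\<bar>" by (intro mult_right_mono D1) simp
      then show "norm (indicator {0..t} s * (D k (w s) * g s)) \<le> indicator {0..t} s * \<bar>g s\<bar>"
        by (auto simp: indicator_def abs_mult)
    qed
  qed
  moreover have "(\<lambda>k. \<Phi> k (w t) - \<Phi> k (w 0)) \<longlonglongrightarrow> max 0 (w t) - max 0 (w 0)"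
  proof -
    have "(\<lambda>k. \<Phi> k v) \<longlonglongrightarrow> max 0 v" for v
    proof -
      have "(\<lambda>k. \<Phi> k v) \<longlonglongrightarrow> (sqrt (v\<^sup>2 + 0\<^sup>2) + v) / 2"
        unfolding \<Phi>_def by (intro tendsto_intros d0) simp_all
      then show ?thesis by (simp add: max_def abs_if split: if_splits)
    qed
    then show ?thesis by (intro tendsto_diff)
  qed
  ultimately have "(\<integral>s. indicator {0..t} s * ((1 + sgn (w s)) / 2 * g s) \<partial>lborel) = max 0 (w t) - max 0 (w 0)"
    unfolding FTC by (rule LIMSEQ_unique)
  then show ?thesis by linarith
qed

section \<open>The coagulation equation with a rounded shift\<close>

text \<open>
The right-hand side of the continuous equation with one change: in a collision with a particle of
size \<open>y\<close> the surviving particle loses \<open>\<tau> y\<close> instead of \<open>y\<close>. It has to keep at least the size \<open>d\<close>.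
If \<open>\<tau>\<close> rounds to the grid of step \<open>\<epsilon>\<close> and \<open>d = \<epsilon> / 2\<close>, this is the discrete equation.
\<close>

definition shifted_rate ::
  "(real \<Rightarrow> real \<Rightarrow> real) \<Rightarrow> (real \<Rightarrow> real) \<Rightarrow> real \<Rightarrow> (real \<Rightarrow> real) \<Rightarrow> real \<Rightarrow> real" where
  "shifted_rate \<kappa> \<tau> d v x =
     indicator {d..} x * (\<integral>y. \<kappa> (x + \<tau> y) y * v (x + \<tau> y) * v y \<partial>lborel)
     - v x * (\<integral>y. \<kappa> x y * v y \<partial>lborel)"

text \<open>
What a test function gains in one collision of a pair \<open>z\<close> of particles, written for ordered pairs:
each particle of the quadrant is lost once, and survives with the reduced size if that is large
enough.
\<close>

definition shifted_test :: "(real \<Rightarrow> real) \<Rightarrow> real \<Rightarrow> (real \<Rightarrow> real) \<Rightarrow> real \<times> real \<Rightarrow> real" where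
  "shifted_test \<tau> d p z = indicator {d..} (fst z - \<tau> (snd z)) * p (fst z - \<tau> (snd z)) - p (fst z)"

locale shifted_rbk =
  fixes \<kappa> :: "real \<Rightarrow> real \<Rightarrow> real" and \<tau> :: "real \<Rightarrow> real" and d C B :: real
    and u :: "real \<Rightarrow> real \<Rightarrow> real"
  assumes kernel_measurable: "(\<lambda>z. \<kappa> (fst z) (snd z)) \<in> borel_measurable (borel \<Otimes>\<^sub>M borel)"
    and kernel_nonneg: "\<And>x y. 0 \<le> \<kappa> x y"
    and kernel_le: "\<And>x y. 0 < x \<Longrightarrow> 0 < y \<Longrightarrow> \<kappa> x y \<le> C * (1 + x) * (1 + y)"
    and shift_measurable [measurable]: "\<tau> \<in> borel_measurable borel"
    and shift_nonneg: "\<And>y. 0 \<le> \<tau> y"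
    and d_pos: "0 < d"
    and u_measurable: "(\<lambda>z. u (fst z) (snd z)) \<in> borel_measurable (borel \<Otimes>\<^sub>M borel)"
    and u_nonneg: "\<And>t x. 0 \<le> u t x"
    and u_support: "\<And>t x. x < d \<Longrightarrow> u t x = 0"
    and moment_integrable: "\<And>t. integrable lborel (\<lambda>x. (1 + x) * u t x)"
    and moment_le: "\<And>t. (\<integral>x. (1 + x) * u t x \<partial>lborel) \<le> B"
    and evolution: "\<And>t x. 0 \<le> t \<Longrightarrow>
      u t x = u 0 x + (\<integral>s. indicator {0..t} s * shifted_rate \<kappa> \<tau> d (u s) x \<partial>lborel)"
    and rate_continuous: "\<And>x. continuous_on {0..} (\<lambda>s. shifted_rate \<kappa> \<tau> d (u s) x)"
begin

abbreviation "rate s x \<equiv> shifted_rate \<kappa> \<tau> d (u s) x"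

lemma kernel_measurable' [measurable (raw)]:
  "f \<in> borel_measurable N \<Longrightarrow> g \<in> borel_measurable N \<Longrightarrow> (\<lambda>z. \<kappa> (f z) (g z)) \<in> borel_measurable N"
  using measurable_compose[OF measurable_Pair kernel_measurable, of f N g] by simp

lemma u_measurable' [measurable (raw)]:
  "f \<in> borel_measurable N \<Longrightarrow> g \<in> borel_measurable N \<Longrightarrow> (\<lambda>z. u (f z) (g z)) \<in> borel_measurable N"
  using measurable_compose[OF measurable_Pair u_measurable, of f N g] by simp

lemma C_nonneg: "0 \<le> C"
  using kernel_le[of 1 1] kernel_nonneg[of 1 1] by simp

text \<open>
The weight \<open>1 + x\<close> may be negative, but not where \<open>u\<close> is positive.
\<close>

lemma weighted_nonneg: "0 \<le> (1 + x) * u t x"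
  using u_nonneg[of t x] u_support[of x t] d_pos by (cases "x < d") auto

lemma B_nonneg: "0 \<le> B"
proof -
  have "0 \<le> (\<integral>x. (1 + x) * u 0 x \<partial>lborel)" by (intro integral_nonneg_AE AE_I2 weighted_nonneg)
  then show ?thesis using moment_le[of 0] by (rule order_trans)
qed

lemma u_le_weighted: "u t x \<le> (1 + x) * u t x"
  using u_nonneg[of t x] u_support[of x t] d_pos by (cases "x < d") (auto simp: distrib_right)

lemma u_integrable: "integrable lborel (u t)"
  by (rule integrable_between[OF moment_integrable _ u_nonneg u_le_weighted]) simp

lemma u_integral_le: "(\<integral>x. u t x \<partial>lborel) \<le> B"
  using integral_mono[OF u_integrable moment_integrable u_le_weighted] moment_le order_trans by blast

definition collisions :: "real \<Rightarrow> real \<times> real \<Rightarrow> real" where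
  "collisions s z = \<kappa> (fst z) (snd z) * u s (fst z) * u s (snd z)"

lemma collisions_measurable [measurable]: "collisions s \<in> borel_measurable (borel \<Otimes>\<^sub>M borel)"
  unfolding collisions_def by measurable

lemma collisions_nonneg: "0 \<le> collisions s z"
  by (simp add: collisions_def kernel_nonneg u_nonneg)

text \<open>
The growth bound on the kernel is only available at positive sizes, which suffices because \<open>u\<close>
vanishes to the left of \<open>d\<close>.
\<close>

lemma collisions_le: "collisions s z \<le> C * (((1 + fst z) * u s (fst z)) * ((1 + snd z) * u s (snd z)))"
proof (cases "fst z < d \<or> snd z < d")
  case True then show ?thesis by (auto simp: collisions_def u_support)
next
  case False
  then have "\<kappa> (fst z) (snd z) \<le> C * (1 + fst z) * (1 + snd z)" using d_pos by (intro kernel_le) auto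
  then have "\<kappa> (fst z) (snd z) * (u s (fst z) * u s (snd z)) \<le> C * (1 + fst z) * (1 + snd z) * (u s (fst z) * u s (snd z))"
    by (intro mult_right_mono) (simp_all add: u_nonneg)
  then show ?thesis by (simp add: collisions_def mult_ac)
qed

lemma collisions_integrable: "integrable plane (collisions s)"
  and collisions_integral_le: "(\<integral>z. collisions s z \<partial>plane) \<le> C * B\<^sup>2"
proof -
  let ?V = "\<lambda>z. C * (((1 + fst z) * u s (fst z)) * ((1 + snd z) * u s (snd z)))"
  have V: "integrable plane ?V"
    by (intro integrable_mult_right tensor_integrable(1)[of "\<lambda>x. (1 + x) * u s x" "\<lambda>x. (1 + x) * u s x"] moment_integrable)
  show i: "integrable plane (collisions s)"
    by (rule integrable_between[OF V _ collisions_nonneg collisions_le]) simp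
  have "(\<integral>z. collisions s z \<partial>plane) \<le> (\<integral>z. ?V z \<partial>plane)"
    by (intro integral_mono i V collisions_le)
  also have "\<dots> = C * ((\<integral>x. (1 + x) * u s x \<partial>lborel) * (\<integral>x. (1 + x) * u s x \<partial>lborel))"
    using tensor_integrable(2)[OF moment_integrable moment_integrable] by simp
  also have "\<dots> \<le> C * (B * B)"
    by (intro mult_left_mono mult_mono moment_le C_nonneg B_nonneg integral_nonneg_AE AE_I2 weighted_nonneg)
  finally show "(\<integral>z. collisions s z \<partial>plane) \<le> C * B\<^sup>2" by (simp add: power2_eq_square)
qed

lemma shifted_test_measurable [measurable]:
  assumes [measurable]: "p \<in> borel_measurable borel"
  shows "shifted_test \<tau> d p \<in> borel_measurable (borel \<Otimes>\<^sub>M borel)"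
  unfolding shifted_test_def by measurable

lemma shifted_test_bounded:
  assumes "\<And>x. \<bar>p x\<bar> \<le> D"
  shows "\<bar>shifted_test \<tau> d p z\<bar> \<le> 2 * D"
proof -
  have "\<bar>indicator {d..} a * p a\<bar> \<le> D" for a using assms[of a] by (auto simp: indicator_def)
  then have "\<bar>indicator {d..} (fst z - \<tau> (snd z)) * p (fst z - \<tau> (snd z))\<bar> \<le> D" .
  then show ?thesis using assms[of "fst z"] unfolding shifted_test_def by linarith
qed

text \<open>
The gain term is integrated along the shear \<open>(x, y) \<mapsto> (x + \<tau> y, y)\<close>, which preserves area. Undoing
the shear moves the test function to \<open>x - \<tau> y\<close> and leaves the collision density unchanged.
\<close>

lemma rate_weak:
  assumes [measurable]: "p \<in> borel_measurable borel" and p: "\<And>x. \<bar>p x\<bar> \<le> D"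
  shows "integrable lborel (\<lambda>x. p x * rate s x)"
    and "(\<integral>x. p x * rate s x \<partial>lborel) = (\<integral>z. collisions s z * shifted_test \<tau> d p z \<partial>plane)"
proof -
    define F where "F = (\<lambda>z. collisions s z * (indicator {d..} (fst z - \<tau> (snd z)) * p (fst z - \<tau> (snd z))))"
  define L where "L = (\<lambda>z. collisions s z * p (fst z))"
  have F: "integrable plane F" unfolding F_def
  proof (rule integrable_bounded_mult[OF collisions_integrable, where C=D])
    show "\<bar>indicator {d..} (fst z - \<tau> (snd z)) * p (fst z - \<tau> (snd z))\<bar> \<le> D" for z
      using p[of "fst z - \<tau> (snd z)"] by (auto simp: indicator_def)
  qed measurable
  have L: "integrable plane L" unfolding L_def
    by (rule integrable_bounded_mult[OF collisions_integrable, where C=D]) (use p in auto)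
  have FT: "integrable plane (\<lambda>z. F (fst z + \<tau> (snd z), snd z))" by (rule integral_shear(1)[OF shift_measurable F])
  have g: "(\<integral>y. F (fst (x,y) + \<tau> (snd (x,y)), snd (x,y)) \<partial>lborel) =
     p x * (indicator {d..} x * (\<integral>y. \<kappa> (x + \<tau> y) y * u s (x + \<tau> y) * u s y \<partial>lborel))" for x
  proof -
    have "(\<integral>y. F (fst (x,y) + \<tau> (snd (x,y)), snd (x,y)) \<partial>lborel) =
      (\<integral>y. (p x * indicator {d..} x) * (\<kappa> (x + \<tau> y) y * u s (x + \<tau> y) * u s y) \<partial>lborel)"
      by (simp add: F_def collisions_def mult_ac)
    also have "\<dots> = (p x * indicator {d..} x) * (\<integral>y. \<kappa> (x + \<tau> y) y * u s (x + \<tau> y) * u s y \<partial>lborel)"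
      by (rule integral_mult_right_zero)
    finally show ?thesis by (simp only: mult.assoc)
  qed
  have l: "(\<integral>y. L (x, y) \<partial>lborel) = p x * (u s x * (\<integral>y. \<kappa> x y * u s y \<partial>lborel))" for x
  proof -
    have "(\<integral>y. L (x, y) \<partial>lborel) = (\<integral>y. (p x * u s x) * (\<kappa> x y * u s y) \<partial>lborel)"
      by (simp add: L_def collisions_def mult_ac)
    also have "\<dots> = (p x * u s x) * (\<integral>y. \<kappa> x y * u s y \<partial>lborel)" by (rule integral_mult_right_zero)
    finally show ?thesis by (simp only: mult.assoc)
  qed
  have r: "p x * rate s x = (\<integral>y. F (fst (x,y) + \<tau> (snd (x,y)), snd (x,y)) \<partial>lborel) - (\<integral>y. L (x, y) \<partial>lborel)" for x
    unfolding g l shifted_rate_def by (simp add: right_diff_distrib)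
  show "integrable lborel (\<lambda>x. p x * rate s x)"
    unfolding r by (intro Bochner_Integration.integrable_diff lborel_pair.integrable_fst'[OF FT] lborel_pair.integrable_fst'[OF L])
  have "(\<integral>x. p x * rate s x \<partial>lborel) = (\<integral>z. F (fst z + \<tau> (snd z), snd z) \<partial>plane) - (\<integral>z. L z \<partial>plane)"
    unfolding r
    by (subst Bochner_Integration.integral_diff[OF lborel_pair.integrable_fst'[OF FT] lborel_pair.integrable_fst'[OF L]])
      (simp only: lborel_pair.integral_fst'[OF FT] lborel_pair.integral_fst'[OF L])
  also have "\<dots> = (\<integral>z. F z - L z \<partial>plane)"
    unfolding integral_shear(2)[OF shift_measurable F] using F L by simp
  also have "\<dots> = (\<integral>z. collisions s z * shifted_test \<tau> d p z \<partial>plane)"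
    by (simp add: F_def L_def shifted_test_def right_diff_distrib)
  finally show "(\<integral>x. p x * rate s x \<partial>lborel) = (\<integral>z. collisions s z * shifted_test \<tau> d p z \<partial>plane)" .
qed

lemma rate_weak_bound:
  assumes "p \<in> borel_measurable borel" "\<And>x. \<bar>p x\<bar> \<le> D"
  shows "\<bar>\<integral>z. collisions s z * shifted_test \<tau> d p z \<partial>plane\<bar> \<le> 2 * D * (C * B\<^sup>2)"
proof -
  have "\<bar>\<integral>z. collisions s z * shifted_test \<tau> d p z \<partial>plane\<bar> \<le> 2 * D * (\<integral>z. collisions s z \<partial>plane)"
    using assms shifted_test_bounded[OF assms(2)]
    by (intro integral_bounded_mult_le collisions_integrable collisions_nonneg) simp_all
  also have "\<dots> \<le> 2 * D * (C * B\<^sup>2)"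
    using assms(2)[of 0] by (intro mult_left_mono collisions_integral_le) auto
  finally show ?thesis .
qed

lemma rate_measurable [measurable (raw)]:
  assumes [measurable]: "f \<in> borel_measurable N" "g \<in> borel_measurable N"
  shows "(\<lambda>z. rate (f z) (g z)) \<in> borel_measurable N"
proof -
  have "(\<lambda>z. rate (fst z) (snd z)) \<in> borel_measurable (borel \<Otimes>\<^sub>M borel)"
    unfolding shifted_rate_def by measurable
  from measurable_compose[OF measurable_Pair[OF assms] this] show ?thesis by simp
qed

text \<open>
The sign of the rate is itself an admissible test function.
\<close>

lemma rate_abs_integral:
  "integrable lborel (\<lambda>x. rate s x)" "(\<integral>x. \<bar>rate s x\<bar> \<partial>lborel) \<le> 2 * (C * B\<^sup>2)"
proof -
  have m: "(\<lambda>x. sgn (rate s x)) \<in> borel_measurable borel" by measurable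
  have b: "\<bar>sgn (rate s x)\<bar> \<le> 1" for x by (simp add: sgn_if)
  show "integrable lborel (\<lambda>x. rate s x)" using rate_weak(1)[of "\<lambda>_. 1" 1 s] by simp
  have "(\<integral>x. \<bar>rate s x\<bar> \<partial>lborel) = (\<integral>x. sgn (rate s x) * rate s x \<partial>lborel)" by (simp add: abs_sgn mult.commute)
  also have "\<dots> = (\<integral>z. collisions s z * shifted_test \<tau> d (\<lambda>x. sgn (rate s x)) z \<partial>plane)"
    by (rule rate_weak(2)[OF m b])
  also have "\<dots> \<le> 2 * 1 * (C * B\<^sup>2)" using rate_weak_bound[OF m b, of s] by (simp add: abs_le_iff)
  finally show "(\<integral>x. \<bar>rate s x\<bar> \<partial>lborel) \<le> 2 * (C * B\<^sup>2)" by simp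
qed

text \<open>
This justifies exchanging the time and the size integral for test functions that also depend on
time.
\<close>

lemma rate_spacetime_integrable:
  assumes q[measurable]: "(\<lambda>z. q (fst z) (snd z)) \<in> borel_measurable (borel \<Otimes>\<^sub>M borel)"
    and D: "\<And>s x. \<bar>q s x\<bar> \<le> D"
  shows "integrable plane (\<lambda>z. indicator {0..t} (fst z) * (q (fst z) (snd z) * rate (fst z) (snd z)))"
proof (rule lborel_pair.Fubini_integrable)
  have [measurable (raw)]: "f \<in> borel_measurable N \<Longrightarrow> g \<in> borel_measurable N \<Longrightarrow> (\<lambda>z. q (f z) (g z)) \<in> borel_measurable N"
    for f g and N :: "'n measure"
    using measurable_compose[OF measurable_Pair q, of f N g] by simp
  have D0: "0 \<le> D" using D[of 0 0] by linarith
  show "(\<lambda>z. indicator {0..t} (fst z) * (q (fst z) (snd z) * rate (fst z) (snd z))) \<in> borel_measurable plane"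
    by measurable
  have qr: "integrable lborel (\<lambda>x. q s x * rate s x)" for s
    by (rule rate_weak(1)[where D=D]) (use D in \<open>auto intro: measurable_compose[OF _ q, of "\<lambda>x. (s, x)", simplified]\<close>)
  show "AE s in lborel. integrable lborel (\<lambda>x. indicator {0..t} (fst (s, x)) * (q (fst (s, x)) (snd (s, x)) * rate (fst (s, x)) (snd (s, x))))"
    using qr by simp
  show "integrable lborel (\<lambda>s. \<integral>x. norm (indicator {0..t} (fst (s, x)) * (q (fst (s, x)) (snd (s, x)) * rate (fst (s, x)) (snd (s, x)))) \<partial>lborel)"
  proof (rule Bochner_Integration.integrable_bound[where f="\<lambda>s. indicator {0..t} s * (D * (2 * (C * B\<^sup>2)))"])
    show "integrable lborel (\<lambda>s. indicator {0..t} s * (D * (2 * (C * B\<^sup>2))))"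
      by (rule integrable_Icc_const)
    show "(\<lambda>s. \<integral>x. norm (indicator {0..t} (fst (s, x)) * (q (fst (s, x)) (snd (s, x)) * rate (fst (s, x)) (snd (s, x)))) \<partial>lborel) \<in> borel_measurable lborel"
      by measurable
    show "AE s in lborel. norm (\<integral>x. norm (indicator {0..t} (fst (s, x)) * (q (fst (s, x)) (snd (s, x)) * rate (fst (s, x)) (snd (s, x)))) \<partial>lborel)
        \<le> norm (indicator {0..t} s * (D * (2 * (C * B\<^sup>2))))"
    proof (rule AE_I2)
      fix s
      have "(\<integral>x. \<bar>q s x * rate s x\<bar> \<partial>lborel) \<le> (\<integral>x. D * \<bar>rate s x\<bar> \<partial>lborel)"
      proof (rule integral_mono)
        show "\<bar>q s x * rate s x\<bar> \<le> D * \<bar>rate s x\<bar>" for x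
          unfolding abs_mult by (intro mult_right_mono D) simp
      qed (use qr rate_abs_integral(1) in auto)
      also have "\<dots> \<le> D * (2 * (C * B\<^sup>2))"
        using mult_left_mono[OF rate_abs_integral(2)[of s] D0] by simp
      finally have *: "(\<integral>x. \<bar>q s x * rate s x\<bar> \<partial>lborel) \<le> D * (2 * (C * B\<^sup>2))" .
      have **: "0 \<le> (\<integral>x. \<bar>q s x * rate s x\<bar> \<partial>lborel)" by (intro integral_nonneg_AE) simp
      show "norm (\<integral>x. norm (indicator {0..t} (fst (s, x)) * (q (fst (s, x)) (snd (s, x)) * rate (fst (s, x)) (snd (s, x)))) \<partial>lborel)
        \<le> norm (indicator {0..t} s * (D * (2 * (C * B\<^sup>2))))"
      proof (cases "s \<in> {0..t}")
        case True
        have "\<bar>\<integral>x. \<bar>q s x * rate s x\<bar> \<partial>lborel\<bar> \<le> \<bar>D * (2 * (C * B\<^sup>2))\<bar>"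
          using * ** by linarith
        then show ?thesis using True by simp
      qed simp
    qed
  qed
qed

lemma weak_form:
  assumes "0 \<le> t" and [measurable]: "\<phi> \<in> borel_measurable borel" and D: "\<And>x. \<bar>\<phi> x\<bar> \<le> D"
  shows "(\<integral>x. u t x * \<phi> x \<partial>lborel) = (\<integral>x. u 0 x * \<phi> x \<partial>lborel) +
    (\<integral>s. indicator {0..t} s * (\<integral>z. collisions s z * shifted_test \<tau> d \<phi> z \<partial>plane) \<partial>lborel)"
proof -
  have i: "integrable plane (\<lambda>z. indicator {0..t} (fst z) * (\<phi> (snd z) * rate (fst z) (snd z)))"
    by (rule rate_spacetime_integrable[where q="\<lambda>s x. \<phi> x"]) (use D in auto)
  then have i': "integrable plane (\<lambda>(s, x). indicator {0..t} s * (\<phi> x * rate s x))" by (simp add: case_prod_unfold)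
  have "u t x * \<phi> x = u 0 x * \<phi> x + (\<integral>s. indicator {0..t} s * (\<phi> x * rate s x) \<partial>lborel)" for x
  proof -
    have "(\<integral>s. indicator {0..t} s * (\<phi> x * rate s x) \<partial>lborel) = (\<integral>s. (indicator {0..t} s * rate s x) * \<phi> x \<partial>lborel)"
      by (simp add: mult_ac)
    also have "\<dots> = (\<integral>s. indicator {0..t} s * rate s x \<partial>lborel) * \<phi> x" by simp
    finally show ?thesis using evolution[OF \<open>0 \<le> t\<close>, of x] by (simp add: distrib_right)
  qed
  then have "(\<integral>x. u t x * \<phi> x \<partial>lborel) = (\<integral>x. u 0 x * \<phi> x + (\<integral>s. indicator {0..t} s * (\<phi> x * rate s x) \<partial>lborel) \<partial>lborel)" by simp
  also have "\<dots> = (\<integral>x. u 0 x * \<phi> x \<partial>lborel) + (\<integral>x. (\<integral>s. indicator {0..t} s * (\<phi> x * rate s x) \<partial>lborel) \<partial>lborel)"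
    by (intro Bochner_Integration.integral_add integrable_bounded_mult[OF u_integrable] lborel_pair.integrable_snd[OF i']) (use D in auto)
  also have "(\<integral>x. (\<integral>s. indicator {0..t} s * (\<phi> x * rate s x) \<partial>lborel) \<partial>lborel) = (\<integral>s. (\<integral>x. indicator {0..t} s * (\<phi> x * rate s x) \<partial>lborel) \<partial>lborel)"
    by (rule lborel_pair.Fubini_integral[OF i'])
  also have "(\<lambda>s. \<integral>x. indicator {0..t} s * (\<phi> x * rate s x) \<partial>lborel) =
     (\<lambda>s. indicator {0..t} s * (\<integral>z. collisions s z * shifted_test \<tau> d \<phi> z \<partial>plane))"
    using rate_weak(2)[of \<phi> D] D by simp
  finally show ?thesis .
qed

lemma rate_weak_measurable:
  assumes [measurable]: "p \<in> borel_measurable borel" and p: "\<And>x. \<bar>p x\<bar> \<le> D"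
  shows "(\<lambda>s. \<integral>z. collisions s z * shifted_test \<tau> d p z \<partial>plane) \<in> borel_measurable borel"
proof -
  have "(\<lambda>s. \<integral>z. collisions s z * shifted_test \<tau> d p z \<partial>plane) = (\<lambda>s. \<integral>x. p x * rate s x \<partial>lborel)"
    using rate_weak(2)[of p D] p by simp
  also have "\<dots> \<in> borel_measurable borel" by measurable
  finally show ?thesis .
qed

lemma weak_lipschitz:
  assumes "0 \<le> s" "s \<le> t" and [measurable]: "\<phi> \<in> borel_measurable borel" and D: "\<And>x. \<bar>\<phi> x\<bar> \<le> D"
  shows "\<bar>(\<integral>x. u t x * \<phi> x \<partial>lborel) - (\<integral>x. u s x * \<phi> x \<partial>lborel)\<bar> \<le> 2 * D * (C * B\<^sup>2) * (t - s)"
proof -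
  define b where "b = (\<lambda>\<sigma>. \<integral>z. collisions \<sigma> z * shifted_test \<tau> d \<phi> z \<partial>plane)"
  have b: "\<bar>b \<sigma>\<bar> \<le> 2 * D * (C * B\<^sup>2)" for \<sigma> unfolding b_def by (rule rate_weak_bound) (use D in auto)
  have [measurable]: "b \<in> borel_measurable borel" unfolding b_def by (rule rate_weak_measurable) (use D in auto)
  have bi: "integrable lborel (\<lambda>\<sigma>. indicator {0..r} \<sigma> * b \<sigma>)" for r
    by (rule integrable_bounded_mult[where C="2 * D * (C * B\<^sup>2)"])
      (use b in \<open>auto simp: emeasure_lborel_Icc_eq\<close>)
  have "(\<integral>x. u t x * \<phi> x \<partial>lborel) - (\<integral>x. u s x * \<phi> x \<partial>lborel)
    = (\<integral>\<sigma>. indicator {0..t} \<sigma> * b \<sigma> \<partial>lborel) - (\<integral>\<sigma>. indicator {0..s} \<sigma> * b \<sigma> \<partial>lborel)"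
    using weak_form[of t \<phi> D] weak_form[of s \<phi> D] assms by (simp add: b_def)
  also have "\<dots> = (\<integral>\<sigma>. indicator {0..t} \<sigma> * b \<sigma> - indicator {0..s} \<sigma> * b \<sigma> \<partial>lborel)"
    by (rule Bochner_Integration.integral_diff[OF bi bi, symmetric])
  also have "\<dots> = (\<integral>\<sigma>. indicator {s<..t} \<sigma> * b \<sigma> \<partial>lborel)"
    using assms by (intro Bochner_Integration.integral_cong) (auto simp: indicator_def)
  also have "\<bar>\<dots>\<bar> \<le> 2 * D * (C * B\<^sup>2) * (\<integral>\<sigma>. indicator {s<..t} \<sigma> \<partial>lborel)"
    by (rule integral_bounded_mult_le) (use b assms in auto)
  also have "(\<integral>\<sigma>. indicator {s<..t} \<sigma> \<partial>lborel) = t - s" using assms by simp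
  finally show ?thesis .
qed

text \<open>
The key estimate. For kernels bounded by \<open>k\<close> on the relevant sizes and total number at most \<open>N\<close>,
the function \<open>m = A * exp (k * N * s)\<close> on \<open>{0..R}\<close>, continued by zero, is a supersolution of the
linear equation that \<open>u\<close> solves when one factor \<open>u\<close> is regarded as given: a particle only
becomes smaller in a collision, so all gain of \<open>m\<close> inside \<open>{0..R}\<close> comes from \<open>{0..R}\<close>, at a rate of
at most \<open>k * N\<close> times \<open>m\<close>. The linear equation describes particles that jump and die, hence does
not increase the mass of the positive part of \<open>w = u - m\<close>. What arrives from sizes beyond \<open>R\<close>,
where the kernel is large, thus never exceeds in mass what was there initially; a Gronwall
argument for the integral of \<open>u\<close> over small sets would not give this.
\<close>

lemma comparison:
  assumes t: "0 \<le> t" and A: "0 \<le> A" and k: "0 \<le> k"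
    and kb: "\<And>x y. 0 < x \<Longrightarrow> x \<le> R \<Longrightarrow> 0 < y \<Longrightarrow> \<tau> y \<le> x \<Longrightarrow> \<kappa> x y \<le> k"
    and N: "\<And>s. (\<integral>x. u s x \<partial>lborel) \<le> N"
  shows "(\<integral>x. max 0 (u t x - A * exp (k * N * t) * indicator {0..R} x) \<partial>lborel)
     \<le> (\<integral>x. max 0 (u 0 x - A * indicator {0..R} x) \<partial>lborel)"
proof -
  define c where "c = k * N"
  define m where "m = (\<lambda>s x. A * exp (c * s) * indicator {0..R} x)"
  define w where "w = (\<lambda>s x. u s x - m s x)"
  define p where "p = (\<lambda>s x. (1 + sgn (w s x)) / 2)"
  have m0: "0 \<le> m s x" for s x using A by (simp add: m_def)
  have p01: "0 \<le> p s x" "p s x \<le> 1" for s x by (auto simp: p_def sgn_if)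
  have pb: "\<bar>p s x\<bar> \<le> 1" for s x using p01[of s x] by simp
  have pw: "p s x = 1" if "w s x > 0" for s x using that by (simp add: p_def)
  have pw': "p s x = 0" if "w s x < 0" for s x using that by (simp add: p_def)
  have [measurable (raw)]: "(\<lambda>z. m (f z) (g z)) \<in> borel_measurable M"
    if [measurable]: "f \<in> borel_measurable M" "g \<in> borel_measurable M" for f g and M :: "'n measure"
    unfolding m_def by measurable
  have [measurable (raw)]: "(\<lambda>z. p (f z) (g z)) \<in> borel_measurable M"
    if [measurable]: "f \<in> borel_measurable M" "g \<in> borel_measurable M" for f g and M :: "'n measure"
    unfolding p_def w_def by measurable
  have m_int: "integrable lborel (m s)" for s
    unfolding m_def by (intro integrable_mult_right integrable_real_indicator) (auto simp: emeasure_lborel_Icc_eq)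
  have pm_int: "integrable lborel (\<lambda>x. m s x * p s x)" for s
    by (rule integrable_bounded_mult[OF m_int _ pb]) measurable
  have w_int: "integrable lborel (\<lambda>x. max 0 (w s x))" for s
    unfolding w_def by (intro integrable_max Bochner_Integration.integrable_diff u_integrable m_int) simp
  have pt: "max 0 (w t x) = max 0 (w 0 x) + (\<integral>s. indicator {0..t} s * (p s x * rate s x) \<partial>lborel)
      - (\<integral>s. indicator {0..t} s * (c * (m s x * p s x)) \<partial>lborel)" for x
  proof -
    have rc: "continuous_on {0..t} (\<lambda>s. rate s x)" by (rule continuous_on_subset[OF rate_continuous]) auto
    have mc: "continuous_on {0..t} (\<lambda>s. c * m s x)" unfolding m_def by (intro continuous_intros)
    have du: "((\<lambda>s. u s x) has_real_derivative rate s x) (at s within {0..t})" if s: "s \<in> {0..t}" for s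
    proof -
      have eq: "u r x = u 0 x + integral {0..r} (\<lambda>s. rate s x)" if "r \<in> {0..t}" for r
      proof -
        have "set_integrable lborel {0..r} (\<lambda>s. rate s x)"
          by (rule borel_integrable_atLeastAtMost', rule continuous_on_subset[OF rate_continuous]) auto
        from set_borel_integral_eq_integral(2)[OF this] show ?thesis
          using evolution[of r x] that by (simp add: set_lebesgue_integral_def)
      qed
      have "((\<lambda>r. u 0 x + integral {0..r} (\<lambda>s. rate s x)) has_real_derivative 0 + rate s x) (at s within {0..t})"
        by (intro DERIV_add DERIV_const integral_has_real_derivative[OF rc s])
      then have D: "((\<lambda>r. u 0 x + integral {0..r} (\<lambda>s. rate s x)) has_real_derivative rate s x) (at s within {0..t})" by simp
      show ?thesis
        by (rule has_field_derivative_transform_within[OF D zero_less_one s]) (rule eq[symmetric])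
    qed
    have dm: "((\<lambda>s. m s x) has_real_derivative c * m s x) (at s within {0..t})" for s
      unfolding m_def by (auto intro!: derivative_eq_intros)
    have "max 0 (w t x) = max 0 (w 0 x) + (\<integral>s. indicator {0..t} s * ((1 + sgn (w s x)) / 2 * (rate s x - c * m s x)) \<partial>lborel)"
      by (rule positive_part_integral[OF t])
        (auto simp: w_def intro!: continuous_on_diff rc mc DERIV_diff du dm)
    also have "(\<integral>s. indicator {0..t} s * ((1 + sgn (w s x)) / 2 * (rate s x - c * m s x)) \<partial>lborel)
        = (\<integral>s. indicator {0..t} s * (p s x * rate s x) - indicator {0..t} s * (c * (m s x * p s x)) \<partial>lborel)"
      by (intro Bochner_Integration.integral_cong) (simp_all add: p_def algebra_simps)
    also have "\<dots> = (\<integral>s. indicator {0..t} s * (p s x * rate s x) \<partial>lborel) - (\<integral>s. indicator {0..t} s * (c * (m s x * p s x)) \<partial>lborel)"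
    proof (rule Bochner_Integration.integral_diff)
      have i1: "integrable lborel (\<lambda>s. indicator {0..t} s * rate s x)"
        using borel_integrable_atLeastAtMost'[OF rc] by (simp add: set_integrable_def)
      have i2: "integrable lborel (\<lambda>s. indicator {0..t} s * (c * m s x))"
        using borel_integrable_atLeastAtMost'[OF mc] by (simp add: set_integrable_def)
      show "integrable lborel (\<lambda>s. indicator {0..t} s * (p s x * rate s x))"
        using integrable_bounded_mult[OF i1, of "\<lambda>s. p s x" 1] pb by (simp add: mult_ac)
      show "integrable lborel (\<lambda>s. indicator {0..t} s * (c * (m s x * p s x)))"
        using integrable_bounded_mult[OF i2, of "\<lambda>s. p s x" 1] pb by (simp add: mult_ac)
    qed
    finally show ?thesis by simp
  qed
  \<comment> \<open>the supersolution property of \<open>m\<close>, tested with \<open>p\<close>\<close>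
  have key: "(\<integral>x. p s x * rate s x \<partial>lborel) \<le> c * (\<integral>x. m s x * p s x \<partial>lborel)" for s
  proof -
        define F where "F = (\<lambda>z. (m s (fst z) * p s (fst z)) * u s (snd z) * indicator {d..} (fst z))"
    have mpu: "integrable plane (\<lambda>z. (m s (fst z) * p s (fst z)) * u s (snd z))"
      by (rule tensor_integrable(1)[OF pm_int u_integrable])
    have F: "integrable plane F"
      unfolding F_def by (rule integrable_bounded_mult[OF mpu, where C=1]) (auto simp: indicator_def)
    have sm: "(\<lambda>y. - \<tau> y) \<in> borel_measurable borel" by measurable
    have bound: "collisions s z * shifted_test \<tau> d (p s) z \<le> k * F (fst z + - \<tau> (snd z), snd z)" for z
    proof -
      obtain x y where z: "z = (x, y)" by (cases z)
      define i where "i = (indicator {d..} (x - \<tau> y) :: real)"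
      define q where "q = i * p s (x - \<tau> y)"
      have i: "i = 0 \<or> i = 1" by (auto simp: i_def indicator_def)
      have q: "0 \<le> q" "q \<le> 1" using i p01[of s "x - \<tau> y"] by (auto simp: q_def)
      have ku: "0 \<le> \<kappa> x y * u s y" by (simp add: kernel_nonneg u_nonneg)
      \<comment> \<open>\<open>p\<close> takes its largest value \<open>1\<close> where \<open>w > 0\<close> and its smallest value \<open>0\<close> where \<open>w < 0\<close>\<close>
      have wq: "w s x * (q - p s x) \<le> 0"
      proof (cases "w s x > 0")
        case True then show ?thesis using q pw[OF True] by (simp add: mult_le_0_iff)
      next
        case False
        then consider "w s x = 0" | "w s x < 0" by linarith
        then show ?thesis
        proof cases
          case 2 then show ?thesis using q pw'[OF 2] by (simp add: mult_le_0_iff)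
        qed simp
      qed
      have mq: "\<kappa> x y * u s y * (m s x * q) \<le> k * (u s y * (m s (x - \<tau> y) * q))"
      proof (cases "u s y = 0 \<or> i = 0 \<or> m s x = 0")
        case True
        then show ?thesis using q(1) m0[of s] u_nonneg[of s y] k by (auto simp: q_def)
      next
        case False
        then have y: "y \<ge> d" using u_support[of y s] by force
        have x: "x - \<tau> y \<ge> d" using False by (auto simp: i_def indicator_def split: if_splits)
        have xR: "0 \<le> x" "x \<le> R" using False by (auto simp: m_def indicator_def split: if_splits)
        have "x - \<tau> y \<in> {0..R}" using x xR d_pos shift_nonneg[of y] by auto
        \<comment> \<open>the smaller particle is still in \<open>{0..R}\<close>, where \<open>m\<close> is constant in size\<close>
        then have mm: "m s (x - \<tau> y) = m s x" using xR by (simp add: m_def)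
        have "\<kappa> x y \<le> k" using x y xR d_pos shift_nonneg[of y] by (intro kb) linarith+
        then have "\<kappa> x y * (u s y * (m s x * q)) \<le> k * (u s y * (m s x * q))"
          by (intro mult_right_mono mult_nonneg_nonneg u_nonneg m0 q)
        then show ?thesis by (simp add: mm mult_ac)
      qed
      have "collisions s z * shifted_test \<tau> d (p s) z = \<kappa> x y * u s y * (u s x * (q - p s x))"
        by (simp add: z collisions_def shifted_test_def q_def i_def mult_ac)
      also have "\<dots> \<le> \<kappa> x y * u s y * (m s x * q)"
      proof (rule mult_left_mono[OF _ ku])
        have "u s x * (q - p s x) = w s x * (q - p s x) + m s x * q - m s x * p s x"
          by (simp add: w_def algebra_simps)
        then show "u s x * (q - p s x) \<le> m s x * q"
          using wq mult_nonneg_nonneg[OF m0[of s x] p01(1)[of s x]] by linarith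
      qed
      also have "\<dots> \<le> k * (u s y * (m s (x - \<tau> y) * q))" by (rule mq)
      also have "\<dots> = k * F (fst z + - \<tau> (snd z), snd z)" by (simp add: z F_def q_def i_def mult_ac)
      finally show ?thesis .
    qed
    have pms: "(\<lambda>x. p s x) \<in> borel_measurable borel" by measurable
    have "(\<integral>x. p s x * rate s x \<partial>lborel) = (\<integral>z. collisions s z * shifted_test \<tau> d (p s) z \<partial>plane)"
      by (rule rate_weak(2)[OF pms pb])
    also have "\<dots> \<le> (\<integral>z. k * F (fst z + - \<tau> (snd z), snd z) \<partial>plane)"
    proof (rule integral_mono[OF _ _ bound])
      show "integrable plane (\<lambda>z. collisions s z * shifted_test \<tau> d (p s) z)"
        by (rule integrable_bounded_mult[OF collisions_integrable _ shifted_test_bounded[OF pb]])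
          (use pms in simp)
      show "integrable plane (\<lambda>z. k * F (fst z + - \<tau> (snd z), snd z))"
        by (intro integrable_mult_right integral_shear(1)[OF sm F])
    qed
    also have "\<dots> = k * (\<integral>z. F z \<partial>plane)" using integral_shear(2)[OF sm F] by simp
    also have "\<dots> \<le> k * (\<integral>z. (m s (fst z) * p s (fst z)) * u s (snd z) \<partial>plane)"
    proof (intro mult_left_mono[OF _ k] integral_mono[OF F mpu])
      fix z show "F z \<le> (m s (fst z) * p s (fst z)) * u s (snd z)"
        using m0[of s "fst z"] p01(1)[of s "fst z"] u_nonneg[of s "snd z"] by (simp add: F_def indicator_def)
    qed
    also have "\<dots> = k * ((\<integral>x. m s x * p s x \<partial>lborel) * (\<integral>x. u s x \<partial>lborel))"
      using tensor_integrable(2)[OF pm_int u_integrable] by simp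
    also have "\<dots> \<le> k * ((\<integral>x. m s x * p s x \<partial>lborel) * N)"
      by (intro mult_left_mono N k integral_nonneg_AE AE_I2 mult_nonneg_nonneg m0 p01)
    also have "\<dots> = c * (\<integral>x. m s x * p s x \<partial>lborel)" by (simp add: c_def mult_ac)
    finally show ?thesis .
  qed
  have i1: "integrable plane (\<lambda>(s, x). indicator {0..t} s * (p s x * rate s x))"
    using rate_spacetime_integrable[of p 1 t] pb by (simp add: case_prod_unfold)
  have i2: "integrable plane (\<lambda>(s, x). indicator {0..t} s * (c * (m s x * p s x)))"
  proof -
    have a: "integrable lborel (\<lambda>s. indicator {0..t} s * (c * A * exp (c * s)))"
      using borel_integrable_atLeastAtMost'[of 0 t "\<lambda>s. c * A * exp (c * s)"]
      by (simp add: set_integrable_def continuous_intros)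
    have b: "integrable lborel (indicator {0..R} :: real \<Rightarrow> real)"
      by (rule integrable_real_indicator) (auto simp: emeasure_lborel_Icc_eq)
    have "integrable plane (\<lambda>z. (indicator {0..t} (fst z) * (c * A * exp (c * fst z)) * indicator {0..R} (snd z)) * p (fst z) (snd z))"
      by (rule integrable_bounded_mult[OF tensor_integrable(1)[OF a b] _ pb]) measurable
    then show ?thesis by (simp add: m_def case_prod_unfold mult_ac)
  qed
  have "(\<integral>x. max 0 (w t x) \<partial>lborel) = (\<integral>x. max 0 (w 0 x) \<partial>lborel)
     + (\<integral>x. (\<integral>s. indicator {0..t} s * (p s x * rate s x) \<partial>lborel) \<partial>lborel)
     - (\<integral>x. (\<integral>s. indicator {0..t} s * (c * (m s x * p s x)) \<partial>lborel) \<partial>lborel)"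
    unfolding pt using w_int lborel_pair.integrable_snd[OF i1] lborel_pair.integrable_snd[OF i2] by simp
  moreover have "(\<integral>x. (\<integral>s. indicator {0..t} s * (p s x * rate s x) \<partial>lborel) \<partial>lborel) =
     (\<integral>s. (\<integral>x. indicator {0..t} s * (p s x * rate s x) \<partial>lborel) \<partial>lborel)"
    by (rule lborel_pair.Fubini_integral[OF i1])
  moreover have "(\<integral>x. (\<integral>s. indicator {0..t} s * (c * (m s x * p s x)) \<partial>lborel) \<partial>lborel) =
     (\<integral>s. (\<integral>x. indicator {0..t} s * (c * (m s x * p s x)) \<partial>lborel) \<partial>lborel)"
    by (rule lborel_pair.Fubini_integral[OF i2])
  moreover have "(\<integral>s. (\<integral>x. indicator {0..t} s * (p s x * rate s x) \<partial>lborel) \<partial>lborel) \<le>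
     (\<integral>s. (\<integral>x. indicator {0..t} s * (c * (m s x * p s x)) \<partial>lborel) \<partial>lborel)"
  proof (rule integral_mono[OF lborel_pair.integrable_fst[OF i1] lborel_pair.integrable_fst[OF i2]])
    fix s show "(\<integral>x. indicator {0..t} s * (p s x * rate s x) \<partial>lborel) \<le> (\<integral>x. indicator {0..t} s * (c * (m s x * p s x)) \<partial>lborel)"
      using key[of s] by (auto simp: indicator_def)
  qed
  ultimately have "(\<integral>x. max 0 (w t x) \<partial>lborel) \<le> (\<integral>x. max 0 (w 0 x) \<partial>lborel)" by linarith
  then show ?thesis by (simp add: w_def m_def c_def)
qed

text \<open>
Comparison with the supersolution zero.
\<close>

lemma number_nonincreasing:
  assumes "0 \<le> t"
  shows "(\<integral>x. u t x \<partial>lborel) \<le> (\<integral>x. u 0 x \<partial>lborel)"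
proof -
  have "max 0 (u s x) = u s x" for s x using u_nonneg[of s x] by simp
  then show ?thesis using comparison[of t 0 0 0 B] assms u_integral_le by simp
qed

end

section \<open>Growth of the kernel\<close>

lemma kernel_hypsE:
  assumes "kernel_hyps K"
  obtains r \<alpha> A where "\<forall>x\<ge>0. 0 \<le> r x" "\<forall>x\<ge>0. \<forall>y\<ge>0. 0 \<le> \<alpha> x y"
    "\<forall>x\<ge>0. \<forall>y\<ge>0. 0 \<le> K y x \<and> K y x = K x y \<and> K x y = r x * r y + \<alpha> x y"
    "continuous_on {0..} r" "continuous_on ({0..} \<times> {0..}) (\<lambda>(x, y). \<alpha> x y)" "(0::real) < A"
    "\<forall>x\<ge>1. \<forall>y\<ge>1. \<alpha> x y = \<alpha> y x \<and> \<alpha> x y \<le> A * r x * r y"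
    "\<forall>R\<ge>1. ((\<lambda>y. SUP x\<in>{0..R}. K x y / y) \<longlongrightarrow> 0) at_top"
proof -
  show thesis using assms unfolding kernel_hyps_def by (elim exE conjE) (rule that; assumption)
qed

lemma kernel_hyps_regular:
  assumes "kernel_hyps K"
  shows "\<And>x y. 0 \<le> x \<Longrightarrow> 0 \<le> y \<Longrightarrow> 0 \<le> K x y"
    and "\<And>x y. 0 \<le> x \<Longrightarrow> 0 \<le> y \<Longrightarrow> K x y = K y x"
    and "continuous_on ({0..} \<times> {0..}) (\<lambda>z. K (fst z) (snd z))"
proof -
  from assms obtain r \<alpha> A where
    K: "\<forall>x\<ge>0. \<forall>y\<ge>0. 0 \<le> K y x \<and> K y x = K x y \<and> K x y = r x * r y + \<alpha> x y"
    and r: "continuous_on {0..} r" and a: "continuous_on ({0..} \<times> {0..}) (\<lambda>(x, y). \<alpha> x y)"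
    by (rule kernel_hypsE)
  show "\<And>x y. 0 \<le> x \<Longrightarrow> 0 \<le> y \<Longrightarrow> 0 \<le> K x y" and "\<And>x y. 0 \<le> x \<Longrightarrow> 0 \<le> y \<Longrightarrow> K x y = K y x"
    using K by blast+
  have r1: "continuous_on ({0..} \<times> {0..}) (\<lambda>z. r (fst z))"
    by (rule continuous_on_compose2[OF r continuous_on_fst[OF continuous_on_id]]) auto
  have r2: "continuous_on ({0..} \<times> {0..}) (\<lambda>z. r (snd z))"
    by (rule continuous_on_compose2[OF r continuous_on_snd[OF continuous_on_id]]) auto
  have "continuous_on ({0..} \<times> {0..}) (\<lambda>z. r (fst z) * r (snd z) + \<alpha> (fst z) (snd z))"
    using a by (intro continuous_on_add continuous_on_mult r1 r2) (simp add: case_prod_unfold)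
  then show "continuous_on ({0..} \<times> {0..}) (\<lambda>z. K (fst z) (snd z))"
  proof (rule continuous_on_eq)
    fix z :: "real \<times> real" assume "z \<in> {0..} \<times> {0..}"
    then have "0 \<le> fst z" "0 \<le> snd z" by auto
    then show "r (fst z) * r (snd z) + \<alpha> (fst z) (snd z) = K (fst z) (snd z)"
      using K[rule_format, of "fst z" "snd z"] by simp
  qed
qed

lemma kernel_bounded_on_square:
  assumes "kernel_hyps K" "0 \<le> R"
  shows "\<exists>k\<ge>0. \<forall>x\<in>{0..R}. \<forall>y\<in>{0..R}. K x y \<le> k"
proof -
  have "compact ((\<lambda>z. K (fst z) (snd z)) ` ({0..R} \<times> {0..R}))"
    by (intro compact_continuous_image continuous_on_subset[OF kernel_hyps_regular(3)[OF assms(1)]] compact_Times) auto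
  then have "bdd_above ((\<lambda>z. K (fst z) (snd z)) ` ({0..R} \<times> {0..R}))"
    by (intro bounded_imp_bdd_above compact_imp_bounded)
  then obtain k where k: "\<And>z. z \<in> {0..R} \<times> {0..R} \<Longrightarrow> K (fst z) (snd z) \<le> k"
    unfolding bdd_above_def by blast
  show ?thesis
  proof (intro exI[of _ "max 0 k"] conjI ballI)
    fix x y assume "x \<in> {0..R}" "y \<in> {0..R}"
    then show "K x y \<le> max 0 k" using k[of "(x, y)"] by simp
  qed simp
qed

text \<open>
The kernel is \<open>o((1 + x) * (1 + y))\<close> at infinity, so that all tails of the collision term are
controlled by the first moment. When one size is bounded, this is the limit hypothesis on the
suprema. Fixing one size there also gives \<open>r y = o(y)\<close>, and when both sizes are large the kernel is
at most \<open>(1 + A) * r x * r y\<close>.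
\<close>

lemma kernel_sublinear:
  assumes K: "kernel_hyps K" and \<eta>: "0 < \<eta>"
  shows "\<exists>R\<ge>1. \<forall>x\<ge>0. \<forall>y\<ge>0. R \<le> x \<or> R \<le> y \<longrightarrow> K x y \<le> \<eta> * (1 + x) * (1 + y)"
proof -
  note reg = kernel_hyps_regular[OF K]
  from K obtain r \<alpha> A where r0': "\<forall>x\<ge>0. 0 \<le> r x" and a0': "\<forall>x\<ge>0. \<forall>y\<ge>0. 0 \<le> \<alpha> x y"
    and Kr': "\<forall>x\<ge>0. \<forall>y\<ge>0. 0 \<le> K y x \<and> K y x = K x y \<and> K x y = r x * r y + \<alpha> x y"
    and A: "0 < A" and aA': "\<forall>x\<ge>1. \<forall>y\<ge>1. \<alpha> x y = \<alpha> y x \<and> \<alpha> x y \<le> A * r x * r y"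
    and om': "\<forall>R\<ge>1. ((\<lambda>y. SUP x\<in>{0..R}. K x y / y) \<longlongrightarrow> 0) at_top"
    by (rule kernel_hypsE)
  have r0: "0 \<le> r x" if "0 \<le> x" for x using r0' that by simp
  have a0: "0 \<le> \<alpha> x y" if "0 \<le> x" "0 \<le> y" for x y using a0' that by simp
  have Kr: "K x y = r x * r y + \<alpha> x y" if "0 \<le> x" "0 \<le> y" for x y using Kr' that by blast
  have aA: "\<alpha> x y \<le> A * r x * r y" if "1 \<le> x" "1 \<le> y" for x y using aA' that by blast
  have om: "((\<lambda>y. SUP x\<in>{0..R}. K x y / y) \<longlongrightarrow> 0) at_top" if "1 \<le> R" for R using om' that by blast
  have tail: "\<exists>Y\<ge>1. \<forall>y\<ge>Y. \<forall>x\<in>{0..R}. K x y \<le> e * y" if "1 \<le> R" "0 < e" for R e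
  proof -
    have "\<forall>\<^sub>F y in at_top. (SUP x\<in>{0..R}. K x y / y) < e"
      using order_tendstoD(2)[OF om[OF that(1)] that(2)] .
    then obtain Y where Y: "\<And>y. Y \<le> y \<Longrightarrow> (SUP x\<in>{0..R}. K x y / y) < e"
      unfolding eventually_at_top_linorder by blast
    have "K x y \<le> e * y" if y: "max 1 Y \<le> y" and x: "x \<in> {0..R}" for x y
    proof -
      obtain k where k: "\<And>z w. z \<in> {0..max R y} \<Longrightarrow> w \<in> {0..max R y} \<Longrightarrow> K z w \<le> k"
      proof -
        have "0 \<le> max R y" using y by linarith
        then show thesis using kernel_bounded_on_square[OF K, of "max R y"] that by blast
      qed
      have y0: "0 < y" using y by simp
      have "K z y / y \<le> k / y" if "z \<in> {0..R}" for z
        using k[of z y] that y0 by (intro divide_right_mono) auto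
      then have "bdd_above ((\<lambda>x. K x y / y) ` {0..R})" by (intro bdd_aboveI2)
      then have "K x y / y \<le> (SUP x\<in>{0..R}. K x y / y)" by (rule cSUP_upper[OF x])
      also have "\<dots> < e" using y by (intro Y) simp
      finally show ?thesis using y0 by (simp add: divide_less_eq)
    qed
    then show ?thesis by (intro exI[of _ "max 1 Y"]) auto
  qed
  \<comment> \<open>the slope for which the product bound \<open>(1 + A) * r x * r y\<close> is at most \<open>\<eta> * x * y\<close>\<close>
  define \<delta> where "\<delta> = sqrt (\<eta> / (1 + A))"
  have d: "0 < \<delta>" "(1 + A) * \<delta>\<^sup>2 = \<eta>" using \<eta> A by (auto simp: \<delta>_def)
  \<comment> \<open>if \<open>r\<close> vanishes identically there is nothing to show; otherwise one size is fixed where \<open>r\<close> is positive\<close>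
  have "\<exists>R1\<ge>1. \<forall>y\<ge>R1. r y \<le> \<delta> * y"
  proof (cases "\<exists>x0\<ge>0. r x0 > 0")
    case True
    then obtain x0 where x0: "0 \<le> x0" "r x0 > 0" by blast
    obtain Y where Y: "1 \<le> Y" "\<And>y x. Y \<le> y \<Longrightarrow> x \<in> {0..max 1 x0} \<Longrightarrow> K x y \<le> (\<delta> * r x0) * y"
      using tail[of "max 1 x0" "\<delta> * r x0"] d x0 by auto
    have "r y \<le> \<delta> * y" if y: "Y \<le> y" for y
    proof -
      have "r x0 * r y \<le> K x0 y" using Kr[of x0 y] a0[of x0 y] x0 y Y by simp
      also have "\<dots> \<le> (\<delta> * r x0) * y" using x0 by (intro Y y) simp
      finally have "r x0 * r y \<le> r x0 * (\<delta> * y)" by (simp add: mult_ac)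
      then show ?thesis using x0 by simp
    qed
    then show ?thesis using Y by blast
  next
    case False
    have "r y \<le> \<delta> * y" if "1 \<le> y" for y
    proof -
      have "r y \<le> 0" using False that by (auto simp: not_less)
      also have "0 \<le> \<delta> * y" using d that by simp
      finally show ?thesis .
    qed
    then show ?thesis by blast
  qed
  then obtain R1 where R1: "1 \<le> R1" "\<And>y. R1 \<le> y \<Longrightarrow> r y \<le> \<delta> * y" by blast
  obtain Y where Y: "1 \<le> Y" "\<And>y x. Y \<le> y \<Longrightarrow> x \<in> {0..R1} \<Longrightarrow> K x y \<le> \<eta> * y"
    using tail[OF R1(1) \<eta>] by blast
  have main: "K x y \<le> \<eta> * (1 + x) * (1 + y)" if x: "0 \<le> x" and y: "max R1 Y \<le> y" for x y
  proof (cases "x \<le> R1")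
    case True
    then have "K x y \<le> \<eta> * 1 * y" using Y(2)[of y x] x y by simp
    also have "\<dots> \<le> \<eta> * (1 + x) * (1 + y)" using \<eta> x y R1 by (intro mult_mono) auto
    finally show ?thesis .
  next
    case False
    have "K x y \<le> (1 + A) * (r x * r y)"
      using Kr[of x y] aA[of x y] False y R1 by (simp add: algebra_simps)
    also have "\<dots> \<le> (1 + A) * ((\<delta> * x) * (\<delta> * y))"
      using False y R1 A d by (intro mult_left_mono mult_mono R1(2) r0) auto
    also have "\<dots> = ((1 + A) * \<delta>\<^sup>2) * x * y" by (simp add: power2_eq_square mult_ac)
    also have "\<dots> \<le> \<eta> * (1 + x) * (1 + y)" unfolding d using \<eta> x y R1 by (intro mult_mono) auto
    finally show ?thesis .
  qed
  show ?thesis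
  proof (intro exI[of _ "max R1 Y"] conjI allI impI)
    show "1 \<le> max R1 Y" using R1 by simp
    fix x y :: real assume "0 \<le> x" "0 \<le> y" "max R1 Y \<le> x \<or> max R1 Y \<le> y"
    then show "K x y \<le> \<eta> * (1 + x) * (1 + y)"
      using main[of x y] main[of y x] reg(2)[of x y] by (auto simp: mult_ac)
  qed
qed

text \<open>
Far out this is the preceding lemma, and the remaining square is compact.
\<close>

lemma kernel_linear_growth:
  assumes "kernel_hyps K"
  shows "\<exists>C\<ge>0. \<forall>x\<ge>0. \<forall>y\<ge>0. K x y \<le> C * (1 + x) * (1 + y)"
proof -
  obtain R where R: "1 \<le> R" "\<And>x y. 0 \<le> x \<Longrightarrow> 0 \<le> y \<Longrightarrow> R \<le> x \<or> R \<le> y \<Longrightarrow> K x y \<le> 1 * (1 + x) * (1 + y)"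
    using kernel_sublinear[OF assms, of 1] by auto
  obtain k where k: "0 \<le> k" "\<And>x y. x \<in> {0..R} \<Longrightarrow> y \<in> {0..R} \<Longrightarrow> K x y \<le> k"
    using kernel_bounded_on_square[OF assms, of R] R by auto
  have "K x y \<le> (1 + k) * (1 + x) * (1 + y)" if "0 \<le> x" "0 \<le> y" for x y
  proof (cases "R \<le> x \<or> R \<le> y")
    case True
    then have "K x y \<le> 1 * (1 + x) * (1 + y)" using R that by blast
    also have "\<dots> \<le> (1 + k) * (1 + x) * (1 + y)" using k that by (intro mult_right_mono) auto
    finally show ?thesis .
  next
    case False
    then have "K x y \<le> k * 1 * 1" using k(2)[of x y] that by simp
    also have "\<dots> \<le> (1 + k) * (1 + x) * (1 + y)" using k that by (intro mult_mono) auto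
    finally show ?thesis .
  qed
  then show ?thesis using k(1) by (intro exI[of _ "1 + k"]) auto
qed

section \<open>Functions that are constant on cells\<close>

definition cell_index :: "real \<Rightarrow> real \<Rightarrow> nat" where
  "cell_index \<epsilon> x = nat \<lfloor>x / \<epsilon> + 1/2\<rfloor>"

text \<open>
The piecewise constant function with value \<open>c i\<close> on the \<open>i\<close>-th cell. Index \<open>0\<close> collects all points
to the left of the first cell, where the function is zero.
\<close>

definition by_cell :: "real \<Rightarrow> (nat \<Rightarrow> real) \<Rightarrow> real \<Rightarrow> real" where
  "by_cell \<epsilon> c x = (if cell_index \<epsilon> x = 0 then 0 else c (cell_index \<epsilon> x))"

lemma cell_index_measurable [measurable]: "cell_index \<epsilon> \<in> measurable borel (count_space UNIV)"
  unfolding cell_index_def by measurable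

lemma cell_index_eq_iff:
  assumes "0 < \<epsilon>" "1 \<le> i"
  shows "cell_index \<epsilon> x = i \<longleftrightarrow> x \<in> cell \<epsilon> i"
proof -
  have "cell_index \<epsilon> x = i \<longleftrightarrow> \<lfloor>x / \<epsilon> + 1/2\<rfloor> = int i" using assms(2) unfolding cell_index_def by linarith
  also have "\<dots> \<longleftrightarrow> real i \<le> x / \<epsilon> + 1/2 \<and> x / \<epsilon> + 1/2 < real i + 1" by (simp add: floor_eq_iff)
  also have "\<dots> \<longleftrightarrow> real i - 1/2 \<le> x / \<epsilon> \<and> x / \<epsilon> < real i + 1/2" by linarith
  also have "\<dots> \<longleftrightarrow> x \<in> cell \<epsilon> i" using assms(1) by (simp add: cell_def le_divide_eq divide_less_eq)
  finally show ?thesis .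
qed

lemma cell_index_eq_0_iff: "0 < \<epsilon> \<Longrightarrow> cell_index \<epsilon> x = 0 \<longleftrightarrow> x < \<epsilon> / 2"
proof -
  assume e: "0 < \<epsilon>"
  have "cell_index \<epsilon> x = 0 \<longleftrightarrow> x / \<epsilon> + 1/2 < 1" unfolding cell_index_def by linarith
  also have "\<dots> \<longleftrightarrow> x / \<epsilon> < 1/2" by linarith
  also have "\<dots> \<longleftrightarrow> x < \<epsilon> / 2" using e by (simp add: divide_less_eq)
  finally show ?thesis .
qed

text \<open>
Translation by a multiple of the step permutes the cells. This is why the discrete equation is
exactly a shifted continuous equation once the shift is rounded to the grid.
\<close>

lemma cell_index_shift:
  assumes "0 < \<epsilon>" "\<epsilon> / 2 \<le> x"
  shows "cell_index \<epsilon> (x + \<epsilon> * real j) = cell_index \<epsilon> x + j"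
proof -
  have "(x + \<epsilon> * real j) / \<epsilon> + 1/2 = (x / \<epsilon> + 1/2) + of_int (int j)" using assms by (simp add: field_simps)
  then have "\<lfloor>(x + \<epsilon> * real j) / \<epsilon> + 1/2\<rfloor> = \<lfloor>x / \<epsilon> + 1/2\<rfloor> + int j" by (simp only: floor_add_int)
  moreover have "0 \<le> \<lfloor>x / \<epsilon> + 1/2\<rfloor>" using assms by simp
  ultimately show ?thesis unfolding cell_index_def by (simp add: nat_add_distrib)
qed

lemma cell_index_node: "0 < \<epsilon> \<Longrightarrow> cell_index \<epsilon> (\<epsilon> * real i) = i"
proof -
  assume "0 < \<epsilon>"
  then have "\<epsilon> * real i / \<epsilon> = real i" by simp
  moreover have "\<lfloor>real i + 1/2\<rfloor> = int i" by linarith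
  ultimately show ?thesis unfolding cell_index_def by simp
qed

lemma cell_node_close:
  assumes "0 < \<epsilon>" "\<epsilon> / 2 \<le> x"
  shows "\<bar>\<epsilon> * real (cell_index \<epsilon> x) - x\<bar> \<le> \<epsilon> / 2"
proof -
  have i: "1 \<le> cell_index \<epsilon> x" using cell_index_eq_0_iff[OF assms(1), of x] assms(2) by linarith
  have "x \<in> cell \<epsilon> (cell_index \<epsilon> x)" using cell_index_eq_iff[OF assms(1) i] by blast
  then show ?thesis unfolding cell_def abs_le_iff by (auto simp: algebra_simps)
qed

lemma cell_diameter:
  assumes "0 < \<epsilon>" "x \<in> cell \<epsilon> i" "z \<in> cell \<epsilon> i"
  shows "\<bar>x - z\<bar> \<le> \<epsilon>"
  using assms unfolding cell_def abs_le_iff by (auto simp: algebra_simps)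

lemma by_cell_measurable [measurable]: "by_cell \<epsilon> c \<in> borel_measurable borel"
  unfolding by_cell_def by measurable

lemma step_function_by_cell:
  assumes "0 < \<epsilon>"
  shows "step_function \<epsilon> f x t = by_cell \<epsilon> (\<lambda>i. f i t) x"
proof (cases "cell_index \<epsilon> x")
  case 0
  have "x \<notin> cell \<epsilon> (Suc i)" for i using cell_index_eq_iff[OF assms, of "Suc i" x] 0 by simp
  then show ?thesis unfolding step_function_def by_cell_def using 0 by simp
next
  case (Suc i)
  have "x \<in> cell \<epsilon> (Suc k) \<longleftrightarrow> k = i" for k using cell_index_eq_iff[OF assms, of "Suc k" x] Suc by auto
  then have "step_function \<epsilon> f x t = (\<Sum>k. if k = i then f (Suc k) t else 0)"
    unfolding step_function_def by (intro suminf_cong) (auto simp: indicator_def)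
  also have "\<dots> = f (Suc i) t" using suminf_finite[of "{i}" "\<lambda>k. if k = i then f (Suc k) t else 0"] by simp
  finally show ?thesis using Suc by (simp add: by_cell_def)
qed

lemma by_cell_integral:
  assumes e: "0 < \<epsilon>" and c: "\<And>j. 1 \<le> j \<Longrightarrow> 0 \<le> c j" and sm: "summable (\<lambda>j. c (Suc j))"
  shows "integrable lborel (by_cell \<epsilon> c)" "(\<integral>x. by_cell \<epsilon> c x \<partial>lborel) = \<epsilon> * (\<Sum>j. c (Suc j))"
proof -
  have nn: "0 \<le> by_cell \<epsilon> c x" for x using c by (simp add: by_cell_def)
  have cellm[measurable]: "cell \<epsilon> i \<in> sets borel" for i unfolding cell_def by simp
  have em: "emeasure lborel (cell \<epsilon> i) = ennreal \<epsilon>" for i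
    using e unfolding cell_def by (simp add: algebra_simps)
  have "ennreal (by_cell \<epsilon> c x) = (\<Sum>j. ennreal (c (Suc j)) * indicator (cell \<epsilon> (Suc j)) x)" for x
  proof (cases "cell_index \<epsilon> x")
    case 0
    have "x \<notin> cell \<epsilon> (Suc i)" for i using cell_index_eq_iff[OF e, of "Suc i" x] 0 by simp
    then show ?thesis using 0 by (simp add: by_cell_def)
  next
    case (Suc i)
    have "x \<in> cell \<epsilon> (Suc k) \<longleftrightarrow> k = i" for k using cell_index_eq_iff[OF e, of "Suc k" x] Suc by auto
    then have "(\<Sum>j. ennreal (c (Suc j)) * indicator (cell \<epsilon> (Suc j)) x) = (\<Sum>k. if k = i then ennreal (c (Suc k)) else 0)"
      by (intro suminf_cong) (auto simp: indicator_def)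
    also have "\<dots> = ennreal (c (Suc i))" using suminf_finite[of "{i}" "\<lambda>k. if k = i then ennreal (c (Suc k)) else 0"] by simp
    finally show ?thesis using Suc by (simp add: by_cell_def)
  qed
  then have "(\<integral>\<^sup>+x. ennreal (by_cell \<epsilon> c x) \<partial>lborel) = (\<integral>\<^sup>+x. (\<Sum>j. ennreal (c (Suc j)) * indicator (cell \<epsilon> (Suc j)) x) \<partial>lborel)" by simp
  also have "\<dots> = (\<Sum>j. \<integral>\<^sup>+x. ennreal (c (Suc j)) * indicator (cell \<epsilon> (Suc j)) x \<partial>lborel)"
    by (rule nn_integral_suminf) measurable
  also have "\<dots> = (\<Sum>j. ennreal (\<epsilon> * c (Suc j)))"
    using e c by (intro suminf_cong) (simp add: nn_integral_cmult em ennreal_mult' mult.commute)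
  also have "\<dots> = ennreal (\<Sum>j. \<epsilon> * c (Suc j))"
    using e c sm by (intro suminf_ennreal2 summable_mult mult_nonneg_nonneg) auto
  finally have nnint: "(\<integral>\<^sup>+x. ennreal (by_cell \<epsilon> c x) \<partial>lborel) = ennreal (\<epsilon> * (\<Sum>j. c (Suc j)))"
    using suminf_mult[OF sm] by simp
  show "integrable lborel (by_cell \<epsilon> c)"
    by (rule integrableI_nonneg) (use nn nnint in auto)
  have "0 \<le> \<epsilon> * (\<Sum>j. c (Suc j))" using e c sm by (intro mult_nonneg_nonneg suminf_nonneg) auto
  then show "(\<integral>x. by_cell \<epsilon> c x \<partial>lborel) = \<epsilon> * (\<Sum>j. c (Suc j))"
    using nnint nn by (subst integral_eq_nn_integral) auto
qed

section \<open>The piecewise constant kernels\<close>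

text \<open>
Dividing by the step compensates the factor that the sum over \<open>j\<close> acquires when it is written as an
integral over the cells.
\<close>

definition cell_kernel :: "real \<Rightarrow> (nat \<Rightarrow> nat \<Rightarrow> real) \<Rightarrow> real \<Rightarrow> real \<Rightarrow> real" where
  "cell_kernel \<epsilon> a x y = by_cell \<epsilon> (\<lambda>i. by_cell \<epsilon> (\<lambda>j. a i j / \<epsilon>) y) x"

text \<open>
The midpoint of the cell of \<open>x\<close>, the rounded size.
\<close>

definition node :: "real \<Rightarrow> real \<Rightarrow> real" where
  "node \<epsilon> x = \<epsilon> * real (cell_index \<epsilon> x)"

lemma node_measurable [measurable]: "node \<epsilon> \<in> borel_measurable borel"
  unfolding node_def by measurable

text \<open>
For negative times the initial value is repeated, which makes the function measurable on the whole
plane.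
\<close>

definition cell_solution :: "real \<Rightarrow> (nat \<Rightarrow> real \<Rightarrow> real) \<Rightarrow> real \<Rightarrow> real \<Rightarrow> real" where
  "cell_solution \<epsilon> f t = by_cell \<epsilon> (\<lambda>i. f i (max 0 t))"

definition coefficient_of :: "(real \<Rightarrow> real \<Rightarrow> real) \<Rightarrow> real \<Rightarrow> (nat \<Rightarrow> nat \<Rightarrow> real) \<Rightarrow> bool" where
  "coefficient_of K \<epsilon> a \<longleftrightarrow>
     (\<forall>i\<ge>1. \<forall>j\<ge>1. a i j = averaged_coeff K \<epsilon> i j) \<or> (\<forall>i\<ge>1. \<forall>j\<ge>1. a i j = pointwise_coeff K \<epsilon> i j)"

text \<open>
Both choices of the coefficients are, up to the factor \<open>\<epsilon>\<close>, a mean of the kernel over a pair of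
cells: the integral mean, or the value at the pair of midpoints. All properties of the
piecewise constant kernel follow from this common feature.
\<close>

lemma coefficient_between:
  assumes K: "kernel_hyps K" and e: "0 < \<epsilon>" and a: "coefficient_of K \<epsilon> a" and ij: "1 \<le> i" "1 \<le> j"
    and b: "\<And>x y. x \<in> cell \<epsilon> i \<Longrightarrow> y \<in> cell \<epsilon> j \<Longrightarrow> l \<le> K x y \<and> K x y \<le> h"
  shows "l \<le> a i j / \<epsilon>" "a i j / \<epsilon> \<le> h"
proof -
  have node: "\<epsilon> * real i \<in> cell \<epsilon> i" "\<epsilon> * real j \<in> cell \<epsilon> j" using e by (auto simp: cell_def algebra_simps)
  have P: "l \<le> pointwise_coeff K \<epsilon> i j / \<epsilon> \<and> pointwise_coeff K \<epsilon> i j / \<epsilon> \<le> h"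
    using b[OF node] e by (simp add: pointwise_coeff_def)
  have Q: "l \<le> averaged_coeff K \<epsilon> i j / \<epsilon> \<and> averaged_coeff K \<epsilon> i j / \<epsilon> \<le> h"
  proof -
    let ?Z = "cell \<epsilon> i \<times> cell \<epsilon> j"
    have cm[measurable]: "cell \<epsilon> i \<in> sets borel" for i unfolding cell_def by simp
    have pos: "cell \<epsilon> i \<subseteq> {0..}" if "1 \<le> i" for i
    proof
      fix x assume "x \<in> cell \<epsilon> i"
      then have "(real i - 1/2) * \<epsilon> \<le> x" by (simp add: cell_def)
      moreover have "0 \<le> (real i - 1/2) * \<epsilon>" using that e by simp
      ultimately show "x \<in> {0..}" by simp
    qed
    have Zs: "?Z \<in> sets borel" unfolding borel_prod[symmetric] by measurable
    have Zs': "?Z \<in> sets lborel" using Zs by simp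
    have em1: "emeasure lborel (cell \<epsilon> i) = ennreal \<epsilon>" for i
      using e unfolding cell_def by (simp add: algebra_simps)
    have em: "emeasure lborel ?Z = ennreal (\<epsilon> * \<epsilon>)"
      unfolding lborel_prod[symmetric]
      by (subst lborel.emeasure_pair_measure_Times) (use e in \<open>auto simp: em1 ennreal_mult\<close>)
    have fin: "emeasure lborel ?Z < \<infinity>" by (simp add: em)
    have mZ: "measure lborel ?Z = \<epsilon> * \<epsilon>" using em e by (simp add: measure_def)
    have iZ: "integrable lborel (indicator ?Z :: real \<times> real \<Rightarrow> real)" using Zs' fin by (rule integrable_real_indicator)
    have Km: "(\<lambda>z. indicator ?Z z *\<^sub>R K (fst z) (snd z)) \<in> borel_measurable borel"
      by (rule borel_measurable_continuous_on_indicator[OF Zs continuous_on_subset[OF kernel_hyps_regular(3)[OF K]]])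
        (use pos ij in auto)
    have i: "integrable lborel (\<lambda>z. indicator ?Z z * K (fst z) (snd z))"
    proof (rule Bochner_Integration.integrable_bound[OF integrable_mult_left[OF iZ, of "\<bar>l\<bar> + \<bar>h\<bar>"]])
      show "AE z in lborel. norm (indicator ?Z z * K (fst z) (snd z)) \<le> norm (indicator ?Z z * (\<bar>l\<bar> + \<bar>h\<bar>))"
      proof (rule AE_I2)
        fix z show "norm (indicator ?Z z * K (fst z) (snd z)) \<le> norm (indicator ?Z z * (\<bar>l\<bar> + \<bar>h\<bar>))"
        proof (cases "z \<in> ?Z")
          case True
          then have "l \<le> K (fst z) (snd z) \<and> K (fst z) (snd z) \<le> h" by (intro b) auto
          then have "\<bar>K (fst z) (snd z)\<bar> \<le> \<bar>l\<bar> + \<bar>h\<bar>" by linarith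
          then show ?thesis using True by simp
        qed simp
      qed
    qed (use Km in simp)
    have le1: "(\<integral>z. indicator ?Z z * l \<partial>lborel) \<le> (\<integral>z. indicator ?Z z * K (fst z) (snd z) \<partial>lborel)"
      by (rule integral_mono[OF integrable_mult_left[OF iZ] i]) (use b in \<open>auto simp: indicator_def\<close>)
    have le2: "(\<integral>z. indicator ?Z z * K (fst z) (snd z) \<partial>lborel) \<le> (\<integral>z. indicator ?Z z * h \<partial>lborel)"
      by (rule integral_mono[OF i integrable_mult_left[OF iZ]]) (use b in \<open>auto simp: indicator_def\<close>)
    have cst: "(\<integral>z. indicator ?Z z * c \<partial>lborel) = \<epsilon> * \<epsilon> * c" for c :: real using mZ by simp
    have eq: "averaged_coeff K \<epsilon> i j / \<epsilon> = (\<integral>z. indicator ?Z z * K (fst z) (snd z) \<partial>lborel) / (\<epsilon> * \<epsilon>)"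
      by (simp add: averaged_coeff_def set_lebesgue_integral_def)
    show ?thesis using le1 le2 e unfolding cst eq by (simp add: le_divide_eq divide_le_eq mult_ac)
  qed
  show "l \<le> a i j / \<epsilon>" "a i j / \<epsilon> \<le> h" using a P Q ij unfolding coefficient_of_def by auto
qed

lemma cell_kernel_between:
  assumes K: "kernel_hyps K" and e: "0 < \<epsilon>" and a: "coefficient_of K \<epsilon> a" and xy: "\<epsilon> / 2 \<le> x" "\<epsilon> / 2 \<le> y"
    and b: "\<And>z w. 0 \<le> z \<Longrightarrow> 0 \<le> w \<Longrightarrow> \<bar>z - x\<bar> \<le> \<epsilon> \<Longrightarrow> \<bar>w - y\<bar> \<le> \<epsilon> \<Longrightarrow> l \<le> K z w \<and> K z w \<le> h"
  shows "l \<le> cell_kernel \<epsilon> a x y" "cell_kernel \<epsilon> a x y \<le> h"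
proof -
  define i j where ij: "i = cell_index \<epsilon> x" "j = cell_index \<epsilon> y"
  have i1: "1 \<le> i" "1 \<le> j" using cell_index_eq_0_iff[OF e, of x] cell_index_eq_0_iff[OF e, of y] xy
    unfolding ij by linarith+
  have x: "x \<in> cell \<epsilon> i" and y: "y \<in> cell \<epsilon> j"
    using cell_index_eq_iff[OF e i1(1)] cell_index_eq_iff[OF e i1(2)] ij by auto
  have pos: "0 \<le> z" if "1 \<le> k" "z \<in> cell \<epsilon> k" for k z
  proof -
    have "(real k - 1/2) * \<epsilon> \<le> z" using that by (simp add: cell_def)
    moreover have "0 \<le> (real k - 1/2) * \<epsilon>" using that e by simp
    ultimately show ?thesis by simp
  qed
  have "l \<le> K z w \<and> K z w \<le> h" if "z \<in> cell \<epsilon> i" "w \<in> cell \<epsilon> j" for z w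
    using cell_diameter[OF e that(1) x] cell_diameter[OF e that(2) y] pos[OF i1(1) that(1)] pos[OF i1(2) that(2)]
    by (intro b)
  from coefficient_between[OF K e a i1 this] show "l \<le> cell_kernel \<epsilon> a x y" "cell_kernel \<epsilon> a x y \<le> h"
    using i1 unfolding cell_kernel_def by_cell_def ij[symmetric] by auto
qed

lemma cell_kernel_eq_0: "0 < \<epsilon> \<Longrightarrow> x < \<epsilon> / 2 \<or> y < \<epsilon> / 2 \<Longrightarrow> cell_kernel \<epsilon> a x y = 0"
  using cell_index_eq_0_iff[of \<epsilon> x] cell_index_eq_0_iff[of \<epsilon> y] unfolding cell_kernel_def by_cell_def by auto

lemma cell_kernel_nonneg:
  assumes K: "kernel_hyps K" and e: "0 < \<epsilon>" and a: "coefficient_of K \<epsilon> a"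
  shows "0 \<le> cell_kernel \<epsilon> a x y"
proof (cases "x < \<epsilon> / 2 \<or> y < \<epsilon> / 2")
  case False
  then have xy: "\<epsilon> / 2 \<le> x" "\<epsilon> / 2 \<le> y" by auto
  obtain k where k: "\<And>z w. z \<in> {0..x + y + \<epsilon>} \<Longrightarrow> w \<in> {0..x + y + \<epsilon>} \<Longrightarrow> K z w \<le> k"
  proof -
    have "0 \<le> x + y + \<epsilon>" using e xy by linarith
    then show thesis using kernel_bounded_on_square[OF K, of "x + y + \<epsilon>"] that by blast
  qed
  show ?thesis
  proof (rule cell_kernel_between(1)[OF K e a xy])
    fix z w assume "0 \<le> z" "0 \<le> w" "\<bar>z - x\<bar> \<le> \<epsilon>" "\<bar>w - y\<bar> \<le> \<epsilon>"
    then show "0 \<le> K z w \<and> K z w \<le> k" using e xy by (intro conjI kernel_hyps_regular(1)[OF K] k) auto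
  qed
qed (simp add: cell_kernel_eq_0[OF e])

text \<open>
Moving by less than one unit changes each weight \<open>1 + x\<close> by a factor of at most two.
\<close>

lemma cell_kernel_upper:
  assumes K: "kernel_hyps K" and e: "0 < \<epsilon>" "\<epsilon> < 1" and a: "coefficient_of K \<epsilon> a"
    and xy: "\<epsilon> / 2 \<le> x" "\<epsilon> / 2 \<le> y" and c: "0 \<le> c"
    and b: "\<And>z w. 0 \<le> z \<Longrightarrow> 0 \<le> w \<Longrightarrow> \<bar>z - x\<bar> \<le> 1 \<Longrightarrow> \<bar>w - y\<bar> \<le> 1 \<Longrightarrow> K z w \<le> c * (1 + z) * (1 + w)"
  shows "cell_kernel \<epsilon> a x y \<le> 4 * c * (1 + x) * (1 + y)"
proof (rule cell_kernel_between(2)[OF K e(1) a xy])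
  fix z w assume zw: "0 \<le> z" "0 \<le> w" "\<bar>z - x\<bar> \<le> \<epsilon>" "\<bar>w - y\<bar> \<le> \<epsilon>"
  have "K z w \<le> c * (1 + z) * (1 + w)" using zw e by (intro b) auto
  also have "\<dots> \<le> c * (2 * (1 + x)) * (2 * (1 + y))"
    using zw e c xy by (intro mult_mono) auto
  also have "\<dots> = 4 * c * (1 + x) * (1 + y)" by (simp only: mult_ac)
  finally show "0 \<le> K z w \<and> K z w \<le> 4 * c * (1 + x) * (1 + y)" using kernel_hyps_regular(1)[OF K zw(1,2)] by simp
qed

lemma cell_kernel_linear_growth:
  assumes K: "kernel_hyps K"
  shows "\<exists>C\<ge>0. \<forall>\<epsilon> a x y. 0 < \<epsilon> \<longrightarrow> \<epsilon> < 1 \<longrightarrow> coefficient_of K \<epsilon> a \<longrightarrow> 0 < x \<longrightarrow> 0 < y \<longrightarrow>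
    cell_kernel \<epsilon> a x y \<le> C * (1 + x) * (1 + y)"
proof -
  obtain C where C: "0 \<le> C" "\<And>x y. 0 \<le> x \<Longrightarrow> 0 \<le> y \<Longrightarrow> K x y \<le> C * (1 + x) * (1 + y)"
    using kernel_linear_growth[OF K] by blast
  have "cell_kernel \<epsilon> a x y \<le> 4 * C * (1 + x) * (1 + y)"
    if "0 < \<epsilon>" "\<epsilon> < 1" "coefficient_of K \<epsilon> a" "0 < x" "0 < y" for \<epsilon> a x y
  proof (cases "x < \<epsilon> / 2 \<or> y < \<epsilon> / 2")
    case True
    then show ?thesis using C that by (simp add: cell_kernel_eq_0)
  next
    case False
    then show ?thesis using C that by (intro cell_kernel_upper[OF K]) auto
  qed
  then show ?thesis using C(1) by (intro exI[of _ "4 * C"]) auto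
qed

lemma cell_kernel_sublinear:
  assumes K: "kernel_hyps K" and \<eta>: "0 < \<eta>"
  shows "\<exists>R\<ge>1. \<forall>\<epsilon> a x y. 0 < \<epsilon> \<longrightarrow> \<epsilon> < 1 \<longrightarrow> coefficient_of K \<epsilon> a \<longrightarrow> 0 < x \<longrightarrow> 0 < y \<longrightarrow> R \<le> x \<or> R \<le> y \<longrightarrow>
    cell_kernel \<epsilon> a x y \<le> \<eta> * (1 + x) * (1 + y)"
proof -
  obtain R where R: "1 \<le> R" "\<And>x y. 0 \<le> x \<Longrightarrow> 0 \<le> y \<Longrightarrow> R \<le> x \<or> R \<le> y \<Longrightarrow> K x y \<le> (\<eta> / 4) * (1 + x) * (1 + y)"
    using kernel_sublinear[OF K, of "\<eta> / 4"] \<eta> by (metis zero_less_divide_iff zero_less_numeral)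
  have "cell_kernel \<epsilon> a x y \<le> \<eta> * (1 + x) * (1 + y)"
    if "0 < \<epsilon>" "\<epsilon> < 1" "coefficient_of K \<epsilon> a" "0 < x" "0 < y" "R + 1 \<le> x \<or> R + 1 \<le> y" for \<epsilon> a x y
  proof (cases "x < \<epsilon> / 2 \<or> y < \<epsilon> / 2")
    case True
    then show ?thesis using \<eta> that by (simp add: cell_kernel_eq_0)
  next
    case False
    have "cell_kernel \<epsilon> a x y \<le> 4 * (\<eta> / 4) * (1 + x) * (1 + y)"
    proof (rule cell_kernel_upper[OF K that(1-3)])
      fix z w assume "0 \<le> z" "0 \<le> w" "\<bar>z - x\<bar> \<le> 1" "\<bar>w - y\<bar> \<le> 1"
      then show "K z w \<le> \<eta> / 4 * (1 + z) * (1 + w)" using that(6) by (intro R(2)) auto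
    qed (use False \<eta> in auto)
    then show ?thesis by simp
  qed
  then show ?thesis using R(1) by (intro exI[of _ "R + 1"]) auto
qed

lemma cell_kernel_tendsto:
  assumes K: "kernel_hyps K" and e: "\<epsilon> \<longlonglongrightarrow> 0" "\<And>n. 0 < \<epsilon> n" and a: "\<And>n. coefficient_of K (\<epsilon> n) (a n)"
    and xy: "0 < x" "0 < y"
  shows "(\<lambda>n. cell_kernel (\<epsilon> n) (a n) x y) \<longlonglongrightarrow> K x y"
proof (rule LIMSEQ_I)
  fix r :: real assume r: "0 < r"
  obtain d where d: "0 < d" "\<And>z. z \<in> {0..} \<times> {0..} \<Longrightarrow> dist z (x, y) < d \<Longrightarrow> dist (K (fst z) (snd z)) (K x y) < r / 2"
    using kernel_hyps_regular(3)[OF K] xy r unfolding continuous_on_iff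
    by (metis (no_types, lifting) SigmaI atLeast_iff fst_conv half_gt_zero less_imp_le snd_conv)
  define d' where "d' = min (d / 2) (min x y)"
  have "0 < d'" using d xy by (auto simp: d'_def)
  then obtain n0 where n0: "\<And>n. n0 \<le> n \<Longrightarrow> \<bar>\<epsilon> n\<bar> < d'" using LIMSEQ_D[OF e(1)] by auto
  show "\<exists>n0. \<forall>n\<ge>n0. norm (cell_kernel (\<epsilon> n) (a n) x y - K x y) < r"
  proof (intro exI[of _ n0] allI impI)
    fix n assume n: "n0 \<le> n"
    have en: "\<epsilon> n < d / 2" "\<epsilon> n < x" "\<epsilon> n < y" using n0[OF n] by (auto simp: d'_def)
    have "K x y - r / 2 \<le> K z w \<and> K z w \<le> K x y + r / 2"
      if "0 \<le> z" "0 \<le> w" "\<bar>z - x\<bar> \<le> \<epsilon> n" "\<bar>w - y\<bar> \<le> \<epsilon> n" for z w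
    proof -
      have "dist (z, w) (x, y) \<le> \<bar>z - x\<bar> + \<bar>w - y\<bar>"
        unfolding dist_prod_def dist_real_def fst_conv snd_conv using sqrt_sum_squares_le_sum_abs[of "\<bar>z-x\<bar>" "\<bar>w-y\<bar>"] by simp
      also have "\<dots> < d" using that en by linarith
      finally have "dist (K z w) (K x y) < r / 2" using d(2)[of "(z, w)"] that by simp
      then show ?thesis unfolding dist_real_def by linarith
    qed
    then have "K x y - r / 2 \<le> cell_kernel (\<epsilon> n) (a n) x y" "cell_kernel (\<epsilon> n) (a n) x y \<le> K x y + r / 2"
      using cell_kernel_between[OF K e(2) a, of n x y "K x y - r / 2" "K x y + r / 2"] en e(2)[of n] by auto
    then show "norm (cell_kernel (\<epsilon> n) (a n) x y - K x y) < r" using r by (simp add: abs_less_iff)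
  qed
qed

section \<open>Averages of the initial datum\<close>

definition cell_average :: "real \<Rightarrow> (real \<Rightarrow> real) \<Rightarrow> real \<Rightarrow> real" where
  "cell_average \<epsilon> \<psi> = by_cell \<epsilon> (discrete_init \<psi> \<epsilon>)"

lemma cell_average_measurable [measurable]: "cell_average \<epsilon> \<psi> \<in> borel_measurable borel"
  unfolding cell_average_def by measurable

lemma cell_measurable [measurable]: "cell \<epsilon> i \<in> sets borel"
  unfolding cell_def by simp

lemma cell_content:
  assumes "0 < \<epsilon>"
  shows "emeasure lborel (cell \<epsilon> i) = ennreal \<epsilon>" "measure lborel (cell \<epsilon> i) = \<epsilon>"
    "integrable lborel (indicator (cell \<epsilon> i) :: real \<Rightarrow> real)"
proof -
  show e: "emeasure lborel (cell \<epsilon> i) = ennreal \<epsilon>" using assms unfolding cell_def by (simp add: algebra_simps)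
  then show "measure lborel (cell \<epsilon> i) = \<epsilon>" using assms by (simp add: measure_def)
  show "integrable lborel (indicator (cell \<epsilon> i) :: real \<Rightarrow> real)"
    by (rule integrable_real_indicator) (auto simp: e)
qed

text \<open>
The integral kernel of the averaging operator.
\<close>

definition same_cell :: "real \<Rightarrow> real \<Rightarrow> real \<Rightarrow> real" where
  "same_cell \<epsilon> x z = (if cell_index \<epsilon> x \<noteq> 0 \<and> cell_index \<epsilon> x = cell_index \<epsilon> z then 1 / \<epsilon> else 0)"

lemma cell_average_alt:
  assumes e: "0 < \<epsilon>"
  shows "cell_average \<epsilon> \<psi> x = (\<integral>z. same_cell \<epsilon> x z * \<psi> z \<partial>lborel)"
proof (cases "cell_index \<epsilon> x = 0")
  case True
  then show ?thesis by (simp add: cell_average_def by_cell_def same_cell_def)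
next
  case False
  define i where "i = cell_index \<epsilon> x"
  have i: "1 \<le> i" using False by (simp add: i_def)
  have "same_cell \<epsilon> x z * \<psi> z = 1 / \<epsilon> * (indicator (cell \<epsilon> i) z * \<psi> z)" for z
    using cell_index_eq_iff[OF e i, of z] i by (auto simp: same_cell_def i_def[symmetric])
  then show ?thesis using i
    by (simp add: cell_average_def by_cell_def i_def[symmetric] discrete_init_def set_lebesgue_integral_def)
qed

lemma same_cell_sym: "same_cell \<epsilon> x z = same_cell \<epsilon> z x"
  by (auto simp: same_cell_def)

lemma same_cell_alt:
  assumes "0 < \<epsilon>" "\<epsilon> / 2 \<le> x"
  shows "same_cell \<epsilon> x = (\<lambda>z. indicator (cell \<epsilon> (cell_index \<epsilon> x)) z * (1 / \<epsilon>))"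
proof
  fix z
  define i where "i = cell_index \<epsilon> x"
  have i: "1 \<le> i" using cell_index_eq_0_iff[OF assms(1), of x] assms(2) unfolding i_def by linarith
  have "(i = cell_index \<epsilon> z) = (z \<in> cell \<epsilon> i)" using cell_index_eq_iff[OF assms(1) i, of z] by blast
  then show "same_cell \<epsilon> x z = indicator (cell \<epsilon> (cell_index \<epsilon> x)) z * (1 / \<epsilon>)"
    using i unfolding same_cell_def i_def[symmetric] by (simp add: indicator_def)
qed

lemma same_cell_eq_0: "0 < \<epsilon> \<Longrightarrow> x < \<epsilon> / 2 \<Longrightarrow> same_cell \<epsilon> x z = 0"
  using cell_index_eq_0_iff[of \<epsilon> x] by (simp add: same_cell_def)

lemma same_cell_measurable [measurable (raw)]:
  assumes [measurable]: "f \<in> borel_measurable N" "g \<in> borel_measurable N"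
  shows "(\<lambda>z. same_cell \<epsilon> (f z) (g z)) \<in> borel_measurable N"
proof -
  have [measurable]: "(\<lambda>z. real (cell_index \<epsilon> (h z))) \<in> borel_measurable N"
    if "h \<in> borel_measurable N" for h
    using measurable_compose[OF measurable_compose[OF that cell_index_measurable], of real borel] by simp
  have "(\<lambda>z. same_cell \<epsilon> (f z) (g z)) = (\<lambda>z. if real (cell_index \<epsilon> (f z)) \<noteq> 0 \<and>
      real (cell_index \<epsilon> (f z)) = real (cell_index \<epsilon> (g z)) then 1 / \<epsilon> else 0)"
    by (simp add: same_cell_def)
  also have "\<dots> \<in> borel_measurable N" by measurable
  finally show ?thesis .
qed

lemma same_cell_integral:
  assumes e: "0 < \<epsilon>"
  shows "integrable lborel (same_cell \<epsilon> x)" "(\<integral>z. same_cell \<epsilon> x z \<partial>lborel) = indicator {\<epsilon>/2..} x"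
proof -
  show "integrable lborel (same_cell \<epsilon> x)"
  proof (cases "x < \<epsilon> / 2")
    case True
    then have "same_cell \<epsilon> x = (\<lambda>_. 0)" using same_cell_eq_0[OF e] by auto
    then show ?thesis by simp
  next
    case False
    then show ?thesis by (subst same_cell_alt[OF e]) (auto intro!: integrable_divide cell_content(3)[OF e])
  qed
  show "(\<integral>z. same_cell \<epsilon> x z \<partial>lborel) = indicator {\<epsilon>/2..} x"
    using e by (cases "x < \<epsilon> / 2") (auto simp: same_cell_eq_0 same_cell_alt cell_content)
qed

lemma same_cell_nonneg: "0 < \<epsilon> \<Longrightarrow> 0 \<le> same_cell \<epsilon> x z"
  by (simp add: same_cell_def)

lemma cell_average_between:
  assumes e: "0 < \<epsilon>" and x: "\<epsilon> / 2 \<le> x" and [measurable]: "\<psi> \<in> borel_measurable borel"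
    and b: "\<And>z. \<bar>z - x\<bar> \<le> \<epsilon> \<Longrightarrow> l \<le> \<psi> z \<and> \<psi> z \<le> h"
  shows "l \<le> cell_average \<epsilon> \<psi> x" "cell_average \<epsilon> \<psi> x \<le> h"
proof -
  define i where "i = cell_index \<epsilon> x"
  have i: "1 \<le> i" using cell_index_eq_0_iff[OF e, of x] x unfolding i_def by linarith
  have xi: "x \<in> cell \<epsilon> i" using cell_index_eq_iff[OF e i, of x] i_def by blast
  have close: "l \<le> \<psi> z \<and> \<psi> z \<le> h" if "same_cell \<epsilon> x z \<noteq> 0" for z
  proof -
    have "z \<in> cell \<epsilon> i" using that cell_index_eq_iff[OF e i, of z] by (auto simp: same_cell_def i_def split: if_splits)
    then show ?thesis using cell_diameter[OF e _ xi] by (intro b)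
  qed
  have int1: "(\<integral>z. same_cell \<epsilon> x z * c \<partial>lborel) = c" for c using same_cell_integral(2)[OF e, of x] x by simp
  have ii: "integrable lborel (\<lambda>z. same_cell \<epsilon> x z * \<psi> z)"
  proof (rule Bochner_Integration.integrable_bound[OF integrable_mult_left[OF same_cell_integral(1)[OF e, of x], of "\<bar>l\<bar> + \<bar>h\<bar>"]])
    show "AE z in lborel. norm (same_cell \<epsilon> x z * \<psi> z) \<le> norm (same_cell \<epsilon> x z * (\<bar>l\<bar> + \<bar>h\<bar>))"
    proof (rule AE_I2)
      fix z
      show "norm (same_cell \<epsilon> x z * \<psi> z) \<le> norm (same_cell \<epsilon> x z * (\<bar>l\<bar> + \<bar>h\<bar>))"
      proof (cases "same_cell \<epsilon> x z = 0")
        case False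
        have "\<bar>\<psi> z\<bar> \<le> \<bar>\<bar>l\<bar> + \<bar>h\<bar>\<bar>" using close[OF False] by linarith
        then show ?thesis unfolding real_norm_def abs_mult by (rule mult_left_mono) simp
      qed simp
    qed
  qed measurable
  have m: "same_cell \<epsilon> x z * l \<le> same_cell \<epsilon> x z * \<psi> z" "same_cell \<epsilon> x z * \<psi> z \<le> same_cell \<epsilon> x z * h" for z
  proof -
    have "same_cell \<epsilon> x z * l \<le> same_cell \<epsilon> x z * \<psi> z \<and> same_cell \<epsilon> x z * \<psi> z \<le> same_cell \<epsilon> x z * h"
    proof (cases "same_cell \<epsilon> x z = 0")
      case False
      show ?thesis using close[OF False] by (intro conjI mult_left_mono same_cell_nonneg[OF e]) blast+
    qed simp
    then show "same_cell \<epsilon> x z * l \<le> same_cell \<epsilon> x z * \<psi> z" "same_cell \<epsilon> x z * \<psi> z \<le> same_cell \<epsilon> x z * h" by blast+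
  qed
  have "(\<integral>z. same_cell \<epsilon> x z * l \<partial>lborel) \<le> (\<integral>z. same_cell \<epsilon> x z * \<psi> z \<partial>lborel)"
    by (intro integral_mono ii integrable_mult_left same_cell_integral(1)[OF e] m)
  then show "l \<le> cell_average \<epsilon> \<psi> x" unfolding int1 cell_average_alt[OF e] .
  have "(\<integral>z. same_cell \<epsilon> x z * \<psi> z \<partial>lborel) \<le> (\<integral>z. same_cell \<epsilon> x z * h \<partial>lborel)"
    by (intro integral_mono ii integrable_mult_left same_cell_integral(1)[OF e] m)
  then show "cell_average \<epsilon> \<psi> x \<le> h" unfolding int1 cell_average_alt[OF e] .
qed

lemma cell_average_eq_0: "0 < \<epsilon> \<Longrightarrow> x < \<epsilon> / 2 \<Longrightarrow> cell_average \<epsilon> \<psi> x = 0"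
  using cell_index_eq_0_iff[of \<epsilon> x] by (simp add: cell_average_def by_cell_def)

text \<open>
The averaging operator has a symmetric kernel.
\<close>

lemma cell_average_adjoint:
  assumes e: "0 < \<epsilon>" and G: "integrable lborel G" and [measurable]: "\<psi> \<in> borel_measurable borel"
    and D: "\<And>x. \<bar>\<psi> x\<bar> \<le> D"
  shows "(\<integral>x. cell_average \<epsilon> G x * \<psi> x \<partial>lborel) = (\<integral>z. G z * cell_average \<epsilon> \<psi> z \<partial>lborel)"
    and "integrable lborel (\<lambda>x. cell_average \<epsilon> G x * \<psi> x)"
proof -
  have [measurable]: "G \<in> borel_measurable borel" using G by auto
  define H where "H = (\<lambda>z x. G z * (same_cell \<epsilon> z x * \<psi> x))"
  have Hx: "integrable lborel (H z)" for z unfolding H_def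
    by (intro integrable_mult_right integrable_bounded_mult[OF same_cell_integral(1)[OF e] _ D]) simp
  have H: "integrable plane (case_prod H)"
  proof (rule lborel_pair.Fubini_integrable)
    show "case_prod H \<in> borel_measurable plane" unfolding H_def case_prod_unfold by measurable
    show "AE x in lborel. integrable lborel (\<lambda>y. case (x, y) of (x, xa) \<Rightarrow> H x xa)" using Hx by simp
    show "integrable lborel (\<lambda>x. \<integral>y. norm (case (x, y) of (x, xa) \<Rightarrow> H x xa) \<partial>lborel)"
    proof (rule Bochner_Integration.integrable_bound[where f="\<lambda>z. D * \<bar>G z\<bar>"])
      show "integrable lborel (\<lambda>z. D * \<bar>G z\<bar>)" using G by simp
      show "(\<lambda>x. \<integral>y. norm (case (x, y) of (x, xa) \<Rightarrow> H x xa) \<partial>lborel) \<in> borel_measurable lborel"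
        unfolding H_def by measurable
      show "AE x in lborel. norm (\<integral>y. norm (case (x, y) of (x, xa) \<Rightarrow> H x xa) \<partial>lborel) \<le> norm (D * \<bar>G x\<bar>)"
      proof (rule AE_I2)
        fix z
        have "(\<integral>x. \<bar>H z x\<bar> \<partial>lborel) \<le> (\<integral>x. \<bar>G z\<bar> * (same_cell \<epsilon> z x * D) \<partial>lborel)"
        proof (rule integral_mono)
          show "integrable lborel (\<lambda>x. \<bar>H z x\<bar>)" using Hx by simp
          show "integrable lborel (\<lambda>x. \<bar>G z\<bar> * (same_cell \<epsilon> z x * D))"
            by (intro integrable_mult_right integrable_mult_left same_cell_integral(1)[OF e])
          show "\<bar>H z x\<bar> \<le> \<bar>G z\<bar> * (same_cell \<epsilon> z x * D)" for x
            unfolding H_def abs_mult using same_cell_nonneg[OF e, of z x] D[of x] by (simp add: mult_left_mono)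
        qed
        also have "\<dots> = \<bar>G z\<bar> * (indicator {\<epsilon>/2..} z * D)" by (simp add: same_cell_integral(2)[OF e])
        also have "\<dots> \<le> D * \<bar>G z\<bar>" using D[of 0] by (auto simp: indicator_def)
        finally have "(\<integral>x. \<bar>H z x\<bar> \<partial>lborel) \<le> D * \<bar>G z\<bar>" .
        moreover have "0 \<le> (\<integral>x. \<bar>H z x\<bar> \<partial>lborel)" by (intro integral_nonneg_AE) simp
        ultimately show "norm (\<integral>y. norm (case (z, y) of (x, xa) \<Rightarrow> H x xa) \<partial>lborel) \<le> norm (D * \<bar>G z\<bar>)" by simp
      qed
    qed
  qed
  have a: "(\<integral>z. H z x \<partial>lborel) = cell_average \<epsilon> G x * \<psi> x" for x
  proof -
    have "(\<integral>z. H z x \<partial>lborel) = (\<integral>z. (same_cell \<epsilon> x z * G z) * \<psi> x \<partial>lborel)"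
      unfolding H_def by (simp add: same_cell_sym[of \<epsilon> x] mult_ac)
    also have "\<dots> = (\<integral>z. same_cell \<epsilon> x z * G z \<partial>lborel) * \<psi> x" by (rule integral_mult_left_zero)
    finally show ?thesis by (simp add: cell_average_alt[OF e])
  qed
  have b: "(\<integral>x. H z x \<partial>lborel) = G z * cell_average \<epsilon> \<psi> z" for z
    unfolding H_def cell_average_alt[OF e] by (rule integral_mult_right_zero)
  show "(\<integral>x. cell_average \<epsilon> G x * \<psi> x \<partial>lborel) = (\<integral>z. G z * cell_average \<epsilon> \<psi> z \<partial>lborel)"
    using lborel_pair.Fubini_integral[OF H] unfolding a b .
  show "integrable lborel (\<lambda>x. cell_average \<epsilon> G x * \<psi> x)"
    using lborel_pair.integrable_snd[OF H] unfolding a .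
qed

lemma cell_average_nonneg:
  assumes "0 < \<epsilon>" "\<And>z. 0 \<le> G z"
  shows "0 \<le> cell_average \<epsilon> G x"
  unfolding cell_average_alt[OF assms(1)]
  by (intro integral_nonneg_AE AE_I2 mult_nonneg_nonneg same_cell_nonneg assms)

lemma cell_average_integral_le:
  assumes e: "0 < \<epsilon>" and G: "integrable lborel G" "\<And>z. 0 \<le> G z"
  shows "integrable lborel (cell_average \<epsilon> G)" "(\<integral>x. cell_average \<epsilon> G x \<partial>lborel) \<le> (\<integral>z. G z \<partial>lborel)"
proof -
  have one: "0 \<le> cell_average \<epsilon> (\<lambda>_. 1) z \<and> cell_average \<epsilon> (\<lambda>_. 1) z \<le> 1" for z
    using cell_average_between[OF e, of z "\<lambda>_. 1" 0 1] cell_average_eq_0[OF e, of z] by (cases "z < \<epsilon> / 2") auto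
  show i: "integrable lborel (cell_average \<epsilon> G)"
    using cell_average_adjoint(2)[OF e G(1), of "\<lambda>_. 1" 1] by simp
  have "(\<integral>x. cell_average \<epsilon> G x \<partial>lborel) = (\<integral>z. G z * cell_average \<epsilon> (\<lambda>_. 1) z \<partial>lborel)"
    using cell_average_adjoint(1)[OF e G(1), of "\<lambda>_. 1" 1] by simp
  also have "\<dots> \<le> (\<integral>z. G z \<partial>lborel)"
  proof (rule integral_mono[OF _ G(1)])
    show "integrable lborel (\<lambda>z. G z * cell_average \<epsilon> (\<lambda>_. 1) z)"
      by (rule integrable_bounded_mult[OF G(1), where C=1]) (use one in auto)
    show "G z * cell_average \<epsilon> (\<lambda>_. 1) z \<le> G z" for z
      using mult_left_mono[of "cell_average \<epsilon> (\<lambda>_. 1) z" 1 "G z"] one G(2)[of z] by simp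
  qed
  finally show "(\<integral>x. cell_average \<epsilon> G x \<partial>lborel) \<le> (\<integral>z. G z \<partial>lborel)" .
qed

text \<open>
Averaging is monotone and contracts \<open>L\<^sup>1\<close>, so the excess of the average over a truncation is at most
the average of the excess. Averages of \<open>indicator {0..n}\<close> are at most \<open>indicator {0..n + 1}\<close>
because cells have a diameter less than one. The excess \<open>H n\<close> of \<open>F\<close> itself tends to zero in \<open>L\<^sup>1\<close>.
\<close>

lemma cell_average_uniformly_integrable:
  assumes F: "integrable lborel F" "\<And>x. 0 \<le> F x" "\<And>x. x < 0 \<Longrightarrow> F x = 0" and \<eta>: "0 < \<eta>"
  shows "\<exists>A\<ge>0. \<exists>R\<ge>0. \<forall>\<epsilon>. 0 < \<epsilon> \<longrightarrow> \<epsilon> < 1 \<longrightarrow>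
    (\<integral>x. max 0 (cell_average \<epsilon> F x - A * indicator {0..R} x) \<partial>lborel) \<le> \<eta>"
proof -
  have [measurable]: "F \<in> borel_measurable borel" using F by auto
  have ind: "integrable lborel (indicator {0..R::real} :: real \<Rightarrow> real)" for R
    by (rule integrable_real_indicator) (auto simp: emeasure_lborel_Icc_eq)
  define H where "H = (\<lambda>n::nat. \<lambda>x. max 0 (F x - real n * indicator {0..real n} x))"
  have "(\<lambda>n. \<integral>x. H n x \<partial>lborel) \<longlonglongrightarrow> (\<integral>x. 0 \<partial>(lborel :: real measure))"
  proof (rule integral_dominated_convergence[where w=F])
    show "integrable lborel F" by (rule F(1))
    show "AE x in lborel. (\<lambda>n. H n x) \<longlonglongrightarrow> 0"
    proof (rule AE_I2)
      fix x
      obtain N :: nat where N: "max (F x) x < real N" using reals_Archimedean2 by blast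
      have "H n x = 0" if "N \<le> n" for n
      proof (cases "x < 0")
        case True then show ?thesis using F(3) by (simp add: H_def)
      next
        case False
        have "real N \<le> real n" using that by simp
        then have "x \<in> {0..real n}" "F x \<le> real n" using N False by auto
        then show ?thesis by (simp add: H_def)
      qed
      then show "(\<lambda>n. H n x) \<longlonglongrightarrow> 0" by (intro tendsto_eventually eventually_sequentiallyI)
    qed
    show "AE x in lborel. norm (H n x) \<le> F x" for n using F(2) by (intro AE_I2) (auto simp: H_def indicator_def)
  qed (simp_all add: H_def)
  then have "(\<lambda>n. \<integral>x. H n x \<partial>lborel) \<longlonglongrightarrow> 0" by simp
  then have "\<forall>\<^sub>F n in sequentially. (\<integral>x. H n x \<partial>lborel) < \<eta>" using \<eta> by (rule order_tendstoD(2))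
  then obtain n where n: "(\<integral>x. H n x \<partial>lborel) < \<eta>" unfolding eventually_sequentially by blast
  have Hi: "integrable lborel (H n)" unfolding H_def
    by (intro integrable_max Bochner_Integration.integrable_diff integrable_mult_right F(1) ind) simp
  have H0: "0 \<le> H n x" for x by (simp add: H_def)
  define I where "I = (indicator {0..real n} :: real \<Rightarrow> real)"
  have "(\<integral>x. max 0 (cell_average \<epsilon> F x - real n * indicator {0..real n + 1} x) \<partial>lborel) \<le> \<eta>"
    if e: "0 < \<epsilon>" "\<epsilon> < 1" for \<epsilon>
  proof -
    have pt: "max 0 (cell_average \<epsilon> F x - real n * indicator {0..real n + 1} x) \<le> cell_average \<epsilon> (H n) x" for x
    proof (cases "x < \<epsilon> / 2")
      case True
      then show ?thesis using cell_average_nonneg[of \<epsilon> "H n" x] H0 e by (auto simp: cell_average_eq_0)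
    next
      case False
      have sc: "integrable lborel (\<lambda>z. same_cell \<epsilon> x z * g z)" if "integrable lborel g" for g
        using integrable_bounded_mult[OF that, of "same_cell \<epsilon> x" "1/\<epsilon>"] e by (simp add: same_cell_def mult.commute)
      have Ii: "integrable lborel I" unfolding I_def by (rule ind)
      have "cell_average \<epsilon> F x \<le> (\<integral>z. same_cell \<epsilon> x z * H n z + real n * (same_cell \<epsilon> x z * I z) \<partial>lborel)"
        unfolding cell_average_alt[OF e(1)]
      proof (rule integral_mono)
        show "integrable lborel (\<lambda>z. same_cell \<epsilon> x z * H n z + real n * (same_cell \<epsilon> x z * I z))"
          by (intro Bochner_Integration.integrable_add integrable_mult_right sc Hi Ii)
        fix z
        have "F z \<le> H n z + real n * I z" by (simp add: H_def I_def)
        then have "same_cell \<epsilon> x z * F z \<le> same_cell \<epsilon> x z * (H n z + real n * I z)"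
          by (intro mult_left_mono same_cell_nonneg e)
        then show "same_cell \<epsilon> x z * F z \<le> same_cell \<epsilon> x z * H n z + real n * (same_cell \<epsilon> x z * I z)"
          by (simp add: algebra_simps)
      qed (intro sc F)
      also have "\<dots> = cell_average \<epsilon> (H n) x + real n * cell_average \<epsilon> I x"
        unfolding cell_average_alt[OF e(1)] using sc[OF Hi] sc[OF Ii] by simp
      also have "\<dots> \<le> cell_average \<epsilon> (H n) x + real n * indicator {0..real n + 1} x"
      proof (intro add_left_mono mult_left_mono)
        show "cell_average \<epsilon> I x \<le> indicator {0..real n + 1} x"
        proof (cases "x \<le> real n + 1")
          case True
          then have "(indicator {0..real n + 1} x :: real) = 1" using False e by auto
          moreover have "cell_average \<epsilon> I x \<le> 1"
            by (rule cell_average_between(2)[OF e(1), where l=0]) (use False in \<open>auto simp: I_def indicator_def\<close>)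
          ultimately show ?thesis by simp
        next
          case far: False
          have "cell_average \<epsilon> I x \<le> 0"
            by (rule cell_average_between(2)[OF e(1), where l=0]) (use False far e in \<open>auto simp: I_def indicator_def\<close>)
          then show ?thesis by (auto simp: indicator_def)
        qed
      qed simp
      finally show ?thesis using cell_average_nonneg[of \<epsilon> "H n" x] H0 e(1) by simp
    qed
    have "(\<integral>x. max 0 (cell_average \<epsilon> F x - real n * indicator {0..real n + 1} x) \<partial>lborel) \<le> (\<integral>x. cell_average \<epsilon> (H n) x \<partial>lborel)"
      by (rule integral_mono[OF _ _ pt])
        (intro integrable_max Bochner_Integration.integrable_diff integrable_mult_right ind
           cell_average_integral_le(1)[OF e(1)] F Hi H0 integrable_zero)+
    also have "\<dots> \<le> (\<integral>x. H n x \<partial>lborel)" by (rule cell_average_integral_le(2)[of \<epsilon> "H n", OF e(1) Hi H0])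
    finally show ?thesis using n by simp
  qed
  then show ?thesis by (intro exI[of _ "real n"] conjI exI[of _ "real n + 1"]) auto
qed

text \<open>
By symmetry the average is moved to the indicator of the ray, which it leaves unchanged at every
point further than \<open>\<epsilon> n\<close> from \<open>q\<close>.
\<close>

lemma cell_average_weak_limit:
  assumes F: "integrable lborel F" "\<And>x. x \<le> 0 \<Longrightarrow> F x = 0"
    and e: "\<epsilon> \<longlonglongrightarrow> 0" "\<And>n. 0 < \<epsilon> n"
  shows "(\<lambda>n. \<integral>x. cell_average (\<epsilon> n) F x * indicator {q<..} x \<partial>lborel) \<longlonglongrightarrow> (\<integral>x. F x * indicator {q<..} x \<partial>lborel)"
proof -
  have [measurable]: "F \<in> borel_measurable borel" using F by auto
  let ?I = "indicator {q<..} :: real \<Rightarrow> real"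
  have b: "0 \<le> cell_average (\<epsilon> n) ?I z \<and> cell_average (\<epsilon> n) ?I z \<le> 1" for n z
    using cell_average_between[OF e(2), of n z ?I 0 1] cell_average_eq_0[OF e(2), of z] by (cases "z < \<epsilon> n / 2") auto
  have "(\<lambda>n. \<integral>z. F z * cell_average (\<epsilon> n) ?I z \<partial>lborel) \<longlonglongrightarrow> (\<integral>z. F z * ?I z \<partial>lborel)"
  proof (rule integral_mult_bounded_convergence[OF F(1), where D=1])
    have "AE z in lborel. z \<noteq> q" by (rule AE_lborel_singleton)
    then show "AE z in lborel. (\<lambda>n. F z * cell_average (\<epsilon> n) ?I z) \<longlonglongrightarrow> F z * ?I z"
    proof eventually_elim
      case (elim z)
      show ?case
      proof (cases "z \<le> 0")
        case True then show ?thesis using F(2) by simp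
      next
        case False
        have "0 < min z \<bar>z - q\<bar>" using False elim by simp
        then obtain n0 where n0: "\<And>n. n0 \<le> n \<Longrightarrow> norm (\<epsilon> n - 0) < min z \<bar>z - q\<bar>" using LIMSEQ_D[OF e(1)] by blast
        have "F z * cell_average (\<epsilon> n) ?I z = F z * ?I z" if "n0 \<le> n" for n
        proof -
          have en: "\<epsilon> n < z" "\<epsilon> n < \<bar>z - q\<bar>" using n0[OF that] by auto
          have I: "?I z \<le> ?I w \<and> ?I w \<le> ?I z" if "\<bar>w - z\<bar> \<le> \<epsilon> n" for w using that en by (auto simp: indicator_def)
          have z2: "\<epsilon> n / 2 \<le> z" using en e(2)[of n] by linarith
          have Im: "?I \<in> borel_measurable borel" by simp
          have "cell_average (\<epsilon> n) ?I z = ?I z"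
            by (intro antisym cell_average_between[OF e(2) z2 Im I])
          then show ?thesis by simp
        qed
        then show ?thesis by (intro tendsto_eventually eventually_sequentiallyI)
      qed
    qed
  qed (use b in \<open>auto simp: abs_le_iff intro: order_trans[OF _ conjunct1]\<close>)
  moreover have "(\<integral>x. cell_average (\<epsilon> n) F x * ?I x \<partial>lborel) = (\<integral>z. F z * cell_average (\<epsilon> n) ?I z \<partial>lborel)" for n
    by (rule cell_average_adjoint(1)[OF e(2) F(1), where D=1]) (auto simp: indicator_def)
  ultimately show ?thesis by simp
qed

text \<open>
On the \<open>i\<close>-th cell \<open>\<epsilon> * i\<close> is at most \<open>2 * x\<close>, with equality at the left end of the first cell.
Partial sums are bounded first since summability is part of the claim.
\<close>

lemma discrete_init_moment:
  assumes e: "0 < \<epsilon>" and F: "integrable lborel (\<lambda>x. x * F x)" "integrable lborel F" "\<And>x. 0 \<le> F x" "\<And>x. x < 0 \<Longrightarrow> F x = 0"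
  shows "summable (\<lambda>j. real (Suc j) * discrete_init F \<epsilon> (Suc j))"
    "\<epsilon>\<^sup>2 * (\<Sum>j. real (Suc j) * discrete_init F \<epsilon> (Suc j)) \<le> 2 * (\<integral>x. x * F x \<partial>lborel)"
proof -
  define b where "b = (\<lambda>j. real (Suc j) * discrete_init F \<epsilon> (Suc j))"
  have b0: "0 \<le> b j" for j
    unfolding b_def discrete_init_def set_lebesgue_integral_def
    using e F(3) by (intro mult_nonneg_nonneg integral_nonneg_AE) (auto simp: indicator_def)
  have part: "(\<Sum>j<n. b j) \<le> 2 * (\<integral>x. x * F x \<partial>lborel) / \<epsilon>\<^sup>2" for n
  proof -
    have ci: "integrable lborel (\<lambda>x. \<epsilon> * real (Suc j) * (indicator (cell \<epsilon> (Suc j)) x * F x))" for j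
      using integrable_bounded_mult[OF F(2), of "indicator (cell \<epsilon> (Suc j))" 1]
      by (intro integrable_mult_right) (simp add: mult.commute indicator_def)
    have "\<epsilon>\<^sup>2 * (\<Sum>j<n. b j) = (\<Sum>j<n. (\<integral>x. \<epsilon> * real (Suc j) * (indicator (cell \<epsilon> (Suc j)) x * F x) \<partial>lborel))"
      unfolding sum_distrib_left
    proof (rule sum.cong[OF refl])
      fix j
      have "(\<integral>x. \<epsilon> * real (Suc j) * (indicator (cell \<epsilon> (Suc j)) x * F x) \<partial>lborel)
        = \<epsilon> * real (Suc j) * (\<integral>x. indicator (cell \<epsilon> (Suc j)) x * F x \<partial>lborel)" by (rule integral_mult_right_zero)
      then show "\<epsilon>\<^sup>2 * b j = (\<integral>x. \<epsilon> * real (Suc j) * (indicator (cell \<epsilon> (Suc j)) x * F x) \<partial>lborel)"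
        using e by (simp add: b_def discrete_init_def set_lebesgue_integral_def power2_eq_square del: of_nat_Suc)
    qed
    also have "\<dots> = (\<integral>x. (\<Sum>j<n. \<epsilon> * real (Suc j) * (indicator (cell \<epsilon> (Suc j)) x * F x)) \<partial>lborel)"
      by (rule Bochner_Integration.integral_sum[symmetric]) (rule ci)
    also have "\<dots> \<le> (\<integral>x. 2 * (x * F x) \<partial>lborel)"
    proof (rule integral_mono)
      show "integrable lborel (\<lambda>x. \<Sum>j<n. \<epsilon> * real (Suc j) * (indicator (cell \<epsilon> (Suc j)) x * F x))"
        by (intro Bochner_Integration.integrable_sum ci)
      show "integrable lborel (\<lambda>x. 2 * (x * F x))" using F by simp
      fix x
      show "(\<Sum>j<n. \<epsilon> * real (Suc j) * (indicator (cell \<epsilon> (Suc j)) x * F x)) \<le> 2 * (x * F x)"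
      proof (cases "cell_index \<epsilon> x")
        case 0
        then have "x \<notin> cell \<epsilon> (Suc j)" for j using cell_index_eq_iff[OF e, of "Suc j" x] by simp
        moreover have "0 \<le> x * F x" using F(3,4)[of x] by (cases "x < 0") auto
        ultimately show ?thesis by simp
      next
        case (Suc i)
        have x2: "\<epsilon> / 2 \<le> x" using cell_index_eq_0_iff[OF e, of x] Suc by linarith
        have "\<epsilon> * real (Suc i) \<le> 2 * x"
          using cell_node_close[OF e x2] x2 unfolding Suc abs_le_iff by linarith
        have "(\<Sum>j<n. \<epsilon> * real (Suc j) * (indicator (cell \<epsilon> (Suc j)) x * F x))
          = (\<Sum>j<n. if j = i then \<epsilon> * real (Suc i) * F x else 0)"
        proof (rule sum.cong[OF refl])
          fix j
          have "x \<in> cell \<epsilon> (Suc j) \<longleftrightarrow> j = i" using cell_index_eq_iff[OF e, of "Suc j" x] Suc by auto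
          then show "\<epsilon> * real (Suc j) * (indicator (cell \<epsilon> (Suc j)) x * F x) = (if j = i then \<epsilon> * real (Suc i) * F x else 0)"
            by (simp add: indicator_def)
        qed
        also have "\<dots> \<le> \<epsilon> * real (Suc i) * F x" using e F(3)[of x] by (simp add: sum.delta del: of_nat_Suc)
        also have "\<dots> \<le> 2 * x * F x" by (intro mult_right_mono F(3)) fact
        finally show ?thesis by simp
      qed
    qed
    also have "\<dots> = 2 * (\<integral>x. x * F x \<partial>lborel)" by simp
    finally show ?thesis using e by (simp add: le_divide_eq mult.commute)
  qed
  have s: "summable b" by (rule summableI_nonneg_bounded[OF b0 part])
  then show "summable (\<lambda>j. real (Suc j) * discrete_init F \<epsilon> (Suc j))" by (simp only: b_def)
  have "suminf b \<le> 2 * (\<integral>x. x * F x \<partial>lborel) / \<epsilon>\<^sup>2" by (rule suminf_le_const[OF s part])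
  then show "\<epsilon>\<^sup>2 * (\<Sum>j. real (Suc j) * discrete_init F \<epsilon> (Suc j)) \<le> 2 * (\<integral>x. x * F x \<partial>lborel)"
    using e unfolding b_def by (simp add: le_divide_eq mult.commute)
qed

section \<open>From the discrete equation to the shifted equation\<close>

text \<open>
The suprema over \<open>s\<close> of the terms need not be summable, so the Weierstrass test does not apply.
But the weights tend to zero while the sums of the \<open>h j s\<close> are bounded, so the tails of the weighted
series are uniformly small.
\<close>

lemma continuous_weighted_suminf:
  fixes c :: "nat \<Rightarrow> real" and h :: "nat \<Rightarrow> real \<Rightarrow> real"
  assumes c: "c \<longlonglongrightarrow> 0" and cont: "\<And>j. continuous_on S (h j)"
    and h0: "\<And>j s. s \<in> S \<Longrightarrow> 0 \<le> h j s"
    and sm: "\<And>s. s \<in> S \<Longrightarrow> summable (\<lambda>j. h j s)" and M: "\<And>s. s \<in> S \<Longrightarrow> (\<Sum>j. h j s) \<le> M"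
  shows "continuous_on S (\<lambda>s. \<Sum>j. c j * h j s)"
    and "\<And>s. s \<in> S \<Longrightarrow> summable (\<lambda>j. c j * h j s)"
proof -
  obtain D where D: "\<And>j. norm (c j) \<le> D"
    using convergent_imp_Bseq[OF convergentI[OF c]] unfolding Bseq_def by blast
  have D0: "0 \<le> D" using D[of 0] norm_ge_zero order_trans by blast
  show sc: "summable (\<lambda>j. c j * h j s)" if s: "s \<in> S" for s
  proof (rule summable_comparison_test'[where N=0])
    show "summable (\<lambda>j. D * h j s)" by (intro summable_mult sm s)
    show "norm (c n * h n s) \<le> D * h n s" for n
      using D[of n] h0[OF s, of n] by (simp add: abs_mult mult_right_mono)
  qed
  have "uniform_limit S (\<lambda>n s. \<Sum>j<n. c j * h j s) (\<lambda>s. \<Sum>j. c j * h j s) sequentially"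
  proof (rule uniform_limitI)
    fix e :: real assume e: "0 < e"
    define e' where "e' = e / (\<bar>M\<bar> + 1)"
    have e': "0 < e'" "e' * \<bar>M\<bar> < e" using e by (auto simp: e'_def field_simps)
    obtain n0 where n0: "\<And>j. n0 \<le> j \<Longrightarrow> \<bar>c j\<bar> < e'" using LIMSEQ_D[OF c e'(1)] by auto
    have "dist (\<Sum>j<n. c j * h j s) (\<Sum>j. c j * h j s) < e" if n: "n0 \<le> n" and s: "s \<in> S" for n s
    proof -
      have st: "summable (\<lambda>j. h (j + n) s)" using sm[OF s] by (rule summable_ignore_initial_segment)
      have bd: "norm (c (j + n) * h (j + n) s) \<le> e' * h (j + n) s" for j
        using n0[of "j + n"] n h0[OF s, of "j + n"] by (simp add: abs_mult mult_right_mono)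
      have sa: "summable (\<lambda>j. norm (c (j + n) * h (j + n) s))"
        by (rule summable_comparison_test'[where N=0, OF summable_mult[OF st, of e']]) (use bd in simp)
      have "(\<Sum>j. c j * h j s) - (\<Sum>j<n. c j * h j s) = (\<Sum>j. c (j + n) * h (j + n) s)"
        using suminf_minus_initial_segment[OF sc[OF s], of n] by simp
      also have "norm \<dots> \<le> (\<Sum>j. norm (c (j + n) * h (j + n) s))" by (rule summable_norm[OF sa])
      also have "\<dots> \<le> (\<Sum>j. e' * h (j + n) s)" by (rule suminf_le[OF bd sa summable_mult[OF st]])
      also have "\<dots> = e' * (\<Sum>j. h (j + n) s)" by (rule suminf_mult[OF st])
      also have "(\<Sum>j. h (j + n) s) = (\<Sum>j. h j s) - (\<Sum>j<n. h j s)"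
        using suminf_minus_initial_segment[OF sm[OF s], of n] by simp
      also have "e' * ((\<Sum>j. h j s) - (\<Sum>j<n. h j s)) \<le> e' * \<bar>M\<bar>"
      proof (rule mult_left_mono)
        have "0 \<le> (\<Sum>j<n. h j s)" by (intro sum_nonneg h0 s)
        then show "(\<Sum>j. h j s) - (\<Sum>j<n. h j s) \<le> \<bar>M\<bar>" using M[OF s] by linarith
      qed (use e' in simp)
      also have "\<dots> < e" by (rule e'(2))
      finally show ?thesis by (simp add: dist_real_def abs_minus_commute)
    qed
    then show "\<forall>\<^sub>F n in sequentially. \<forall>s\<in>S. dist (\<Sum>j<n. c j * h j s) (\<Sum>j. c j * h j s) < e"
      unfolding eventually_sequentially by blast
  qed
  moreover have "\<forall>\<^sub>F n in sequentially. continuous_on S (\<lambda>s. \<Sum>j<n. c j * h j s)"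
    by (intro always_eventually allI continuous_intros cont)
  ultimately show "continuous_on S (\<lambda>s. \<Sum>j. c j * h j s)"
    by (intro uniform_limit_theorem) auto
qed

locale discretised_rbk =
  fixes K :: "real \<Rightarrow> real \<Rightarrow> real" and \<epsilon> :: real and a :: "nat \<Rightarrow> nat \<Rightarrow> real"
    and f0 :: "nat \<Rightarrow> real" and f :: "nat \<Rightarrow> real \<Rightarrow> real"
  assumes K: "kernel_hyps K" and e0: "0 < \<epsilon>" and e1: "\<epsilon> < 1" and a: "coefficient_of K \<epsilon> a"
    and sol: "discrete_solution a f0 f"
begin

abbreviation "\<kappa> \<equiv> cell_kernel \<epsilon> a"
abbreviation "u \<equiv> cell_solution \<epsilon> f"

lemma f_continuous: "1 \<le> i \<Longrightarrow> continuous_on {0..} (f i)"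
  using sol unfolding discrete_solution_def by (elim conjE) blast

lemma f_nonneg: "1 \<le> i \<Longrightarrow> 0 \<le> t \<Longrightarrow> 0 \<le> f i t"
  using sol unfolding discrete_solution_def by (elim conjE) blast

lemma f_equation:
  assumes "1 \<le> i" "0 \<le> t"
  shows "f i t = f0 i + (\<integral>s. indicator {0..t} s * (gain a f i s - loss a f i s) \<partial>lborel)"
proof -
  have "f i t = f0 i + (LINT s:{0..t}|lborel. gain a f i s - loss a f i s)"
    using sol assms unfolding discrete_solution_def by (elim conjE) blast
  then show ?thesis by (simp add: set_lebesgue_integral_def)
qed

text \<open>
Finite by the definition of a discrete solution, but depending on the step.
\<close>

definition mass_bound :: real where
  "mass_bound = enn2real (SUP t\<in>{0..}. \<Sum>i. ennreal (real (Suc i) * f (Suc i) t))"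

lemma mass_summable: "0 \<le> t \<Longrightarrow> summable (\<lambda>j. real (Suc j) * f (Suc j) t)"
  and mass_le: "0 \<le> t \<Longrightarrow> (\<Sum>j. real (Suc j) * f (Suc j) t) \<le> mass_bound"
proof -
  assume t: "0 \<le> t"
  let ?S = "SUP t\<in>{0..}. \<Sum>i. ennreal (real (Suc i) * f (Suc i) t)"
  have fin: "?S < \<infinity>" using sol unfolding discrete_solution_def by (elim conjE)
  have le: "(\<Sum>i. ennreal (real (Suc i) * f (Suc i) t)) \<le> ?S" by (rule SUP_upper) (use t in simp)
  have nn: "0 \<le> real (Suc j) * f (Suc j) t" for j using f_nonneg[of "Suc j" t] t by simp
  show s: "summable (\<lambda>j. real (Suc j) * f (Suc j) t)"
    by (rule summable_suminf_not_top[OF nn]) (use le fin in \<open>auto simp: top_unique\<close>)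
  have "ennreal (\<Sum>j. real (Suc j) * f (Suc j) t) \<le> ?S" using le suminf_ennreal2[OF nn s] by simp
  then show "(\<Sum>j. real (Suc j) * f (Suc j) t) \<le> mass_bound"
    unfolding mass_bound_def using enn2real_mono[of "ennreal (\<Sum>j. real (Suc j) * f (Suc j) t)" ?S] fin suminf_nonneg[OF s nn]
    by (simp add: less_top)
qed

lemma mass_term_le: "1 \<le> i \<Longrightarrow> 0 \<le> t \<Longrightarrow> real i * f i t \<le> mass_bound"
proof -
  assume i: "1 \<le> i" and t: "0 \<le> t"
  have nn: "0 \<le> real (Suc j) * f (Suc j) t" for j using f_nonneg[of "Suc j" t] t by simp
  obtain k where k: "i = Suc k" using i by (cases i) auto
  have "(\<Sum>j\<in>{k}. real (Suc j) * f (Suc j) t) \<le> (\<Sum>j. real (Suc j) * f (Suc j) t)"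
    by (rule sum_le_suminf[OF mass_summable[OF t]]) (use nn in auto)
  also have "\<dots> \<le> mass_bound" by (rule mass_le[OF t])
  finally show "real i * f i t \<le> mass_bound" unfolding k by (simp del: of_nat_Suc)
qed

lemma coefficient_nonneg: "1 \<le> i \<Longrightarrow> 1 \<le> j \<Longrightarrow> 0 \<le> a i j"
  using cell_kernel_nonneg[OF K e0 a, of "\<epsilon> * real i" "\<epsilon> * real j"] e0
  by (simp add: cell_kernel_def by_cell_def cell_index_node zero_le_divide_iff)

text \<open>
The discrete counterpart of the sublinear growth of the kernel. It makes all series in the discrete
equation converge uniformly in time, hence the solution continuously differentiable.
\<close>

lemma coefficient_small:
  assumes "0 < \<eta>"
  shows "\<exists>J. \<forall>i\<ge>1. \<forall>j\<ge>J. 1 \<le> j \<longrightarrow> a i j \<le> \<eta> * real i * real j"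
proof -
  obtain R where R: "\<And>x y. 0 < x \<Longrightarrow> 0 < y \<Longrightarrow> R \<le> x \<or> R \<le> y \<Longrightarrow> \<kappa> x y \<le> (\<eta> / 4) * (1 + x) * (1 + y)"
  proof -
    have "0 < \<eta> / 4" using assms by simp
    from cell_kernel_sublinear[OF K this] show thesis using e0 e1 a that by blast
  qed
  obtain J :: nat where J: "R / \<epsilon> < real J" using reals_Archimedean2 by blast
  have "a i j \<le> \<eta> * real i * real j" if i: "1 \<le> i" and j: "J \<le> j" "1 \<le> j" for i j
  proof -
    have "R < \<epsilon> * real J" using J e0 by (simp add: divide_less_eq mult.commute)
    also have "\<dots> \<le> \<epsilon> * real j" using j e0 by simp
    finally have "\<kappa> (\<epsilon> * real i) (\<epsilon> * real j) \<le> (\<eta> / 4) * (1 + \<epsilon> * real i) * (1 + \<epsilon> * real j)"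
      using i j e0 by (intro R) auto
    moreover have "\<kappa> (\<epsilon> * real i) (\<epsilon> * real j) = a i j / \<epsilon>"
      using i j e0 by (simp add: cell_kernel_def by_cell_def cell_index_node)
    ultimately have "a i j / \<epsilon> \<le> (\<eta> / 4) * (1 + \<epsilon> * real i) * (1 + \<epsilon> * real j)" by simp
    also have "\<dots> \<le> (\<eta> / 4) * (2 * real i) * (2 * real j)"
    proof -
      have "\<epsilon> * real k \<le> 1 * real k" for k using e1 by (intro mult_right_mono) auto
      then have "1 + \<epsilon> * real k \<le> 2 * real k" if "1 \<le> k" for k using that by (smt (verit) of_nat_1 of_nat_mono)
      then show ?thesis using i j e0 assms by (intro mult_mono) auto
    qed
    finally have "a i j / \<epsilon> \<le> \<eta> * real i * real j" by simp
    then have "a i j \<le> \<epsilon> * (\<eta> * real i * real j)" using e0 by (simp add: divide_le_eq mult.commute)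
    also have "\<dots> \<le> 1 * (\<eta> * real i * real j)" using e1 assms by (intro mult_right_mono) auto
    finally show ?thesis by simp
  qed
  then show ?thesis by blast
qed

lemma loss_series:
  assumes i: "1 \<le> i"
  shows "continuous_on {0..} (\<lambda>s. \<Sum>j. a i (Suc j) * f (Suc j) s)"
    "\<And>s. 0 \<le> s \<Longrightarrow> summable (\<lambda>j. a i (Suc j) * f (Suc j) s)"
proof -
  define c where "c = (\<lambda>j. a i (Suc j) / real (Suc j))"
  define h where "h = (\<lambda>j s. real (Suc j) * f (Suc j) s)"
  have ch: "c j * h j s = a i (Suc j) * f (Suc j) s" for j s by (simp add: c_def h_def del: of_nat_Suc)
  have c: "c \<longlonglongrightarrow> 0"
  proof (rule LIMSEQ_I)
    fix r :: real assume r: "0 < r"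
    then have "0 < r / (2 * real i)" using i by simp
    from coefficient_small[OF this] obtain J where J: "\<And>j. J \<le> j \<Longrightarrow> 1 \<le> j \<Longrightarrow> a i j \<le> r / (2 * real i) * real i * real j"
      using i by blast
    have "norm (c j - 0) < r" if "J \<le> j" for j
    proof -
      have "a i (Suc j) \<le> (r / 2) * real (Suc j)" using J[of "Suc j"] that i by simp
      then have "c j \<le> r / 2" unfolding c_def by (simp add: divide_le_eq del: of_nat_Suc)
      moreover have "0 \<le> c j" unfolding c_def using coefficient_nonneg[OF i, of "Suc j"] by simp
      ultimately show ?thesis using r by simp
    qed
    then show "\<exists>no. \<forall>n\<ge>no. norm (c n - 0) < r" by blast
  qed
  have hc: "continuous_on {0..} (h j)" for j unfolding h_def by (intro continuous_intros f_continuous) simp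
  have h0: "0 \<le> h j s" if "s \<in> {0..}" for j s unfolding h_def using f_nonneg[of "Suc j" s] that by simp
  have hs: "summable (\<lambda>j. h j s)" "(\<Sum>j. h j s) \<le> mass_bound" if "s \<in> {0..}" for s
    unfolding h_def using mass_summable[of s] mass_le[of s] that by auto
  show "continuous_on {0..} (\<lambda>s. \<Sum>j. a i (Suc j) * f (Suc j) s)"
    using continuous_weighted_suminf(1)[OF c hc h0 hs] unfolding ch by blast
  show "summable (\<lambda>j. a i (Suc j) * f (Suc j) s)" if "0 \<le> s" for s
    using continuous_weighted_suminf(2)[OF c hc h0 hs, of s] that unfolding ch by simp
qed

text \<open>
Each factor \<open>i * f i\<close> is bounded by the mass, so the products of two such factors are dominated by a
multiple of the mass series.
\<close>

lemma gain_series: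
  assumes i: "1 \<le> i"
  shows "continuous_on {0..} (gain a f i)"
    "\<And>s. 0 \<le> s \<Longrightarrow> summable (\<lambda>j. a (i + Suc j) (Suc j) * f (i + Suc j) s * f (Suc j) s)"
proof -
  define c where "c = (\<lambda>j. a (i + Suc j) (Suc j) / (real (i + Suc j) * real (Suc j)))"
  define h where "h = (\<lambda>j s. (real (i + Suc j) * f (i + Suc j) s) * (real (Suc j) * f (Suc j) s))"
  have ch: "c j * h j s = a (i + Suc j) (Suc j) * f (i + Suc j) s * f (Suc j) s" for j s
  proof -
    have "real (i + Suc j) \<noteq> 0" "real (Suc j) \<noteq> 0" by auto
    then show ?thesis unfolding c_def h_def by (simp add: field_simps del: of_nat_Suc of_nat_add)
  qed
  have c: "c \<longlonglongrightarrow> 0"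
  proof (rule LIMSEQ_I)
    fix r :: real assume r: "0 < r"
    then have "0 < r / 2" by simp
    from coefficient_small[OF this] obtain J where J: "\<And>i j. 1 \<le> i \<Longrightarrow> J \<le> j \<Longrightarrow> 1 \<le> j \<Longrightarrow> a i j \<le> r / 2 * real i * real j"
      by blast
    have "norm (c j - 0) < r" if "J \<le> j" for j
    proof -
      have "a (i + Suc j) (Suc j) \<le> (r / 2) * (real (i + Suc j) * real (Suc j))" using J[of "i + Suc j" "Suc j"] that by (simp add: mult.assoc)
      moreover have "0 < real (i + Suc j) * real (Suc j)" by (simp del: of_nat_Suc of_nat_add)
      ultimately have "c j \<le> r / 2" unfolding c_def by (simp only: divide_le_eq if_True)
      moreover have "0 \<le> c j" unfolding c_def using coefficient_nonneg[of "i + Suc j" "Suc j"]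
        by (intro divide_nonneg_nonneg mult_nonneg_nonneg) auto
      ultimately show ?thesis using r by simp
    qed
    then show "\<exists>no. \<forall>n\<ge>no. norm (c n - 0) < r" by blast
  qed
  have hc: "continuous_on {0..} (h j)" for j unfolding h_def by (intro continuous_intros f_continuous) simp_all
  have h0: "0 \<le> h j s" if "s \<in> {0..}" for j s
    unfolding h_def using f_nonneg[of "Suc j" s] f_nonneg[of "i + Suc j" s] that by simp
  have hle: "h j s \<le> mass_bound * (real (Suc j) * f (Suc j) s)" if "s \<in> {0..}" for j s
    unfolding h_def using mass_term_le[of "i + Suc j" s] f_nonneg[of "Suc j" s] that
    by (intro mult_right_mono mult_nonneg_nonneg) auto
  have hs: "summable (\<lambda>j. h j s)" if s: "s \<in> {0..}" for s
  proof (rule summable_comparison_test'[where N=0])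
    show "summable (\<lambda>j. mass_bound * (real (Suc j) * f (Suc j) s))" using s by (intro summable_mult mass_summable) simp
    show "norm (h j s) \<le> mass_bound * (real (Suc j) * f (Suc j) s)" for j using h0[OF s, of j] hle[OF s, of j] by simp
  qed
  have hM: "(\<Sum>j. h j s) \<le> mass_bound * mass_bound" if s: "s \<in> {0..}" for s
  proof -
    have "(\<Sum>j. h j s) \<le> (\<Sum>j. mass_bound * (real (Suc j) * f (Suc j) s))"
      using s by (intro suminf_le hle hs summable_mult mass_summable) auto
    also have "\<dots> = mass_bound * (\<Sum>j. real (Suc j) * f (Suc j) s)" using s by (intro suminf_mult mass_summable) simp
    also have "\<dots> \<le> mass_bound * mass_bound"
      using s mass_le[of s] by (intro mult_left_mono) (auto simp: mass_bound_def)
    finally show ?thesis .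
  qed
  show "continuous_on {0..} (gain a f i)"
    using continuous_weighted_suminf(1)[OF c hc h0 hs hM] unfolding ch gain_def[abs_def] by blast
  show "summable (\<lambda>j. a (i + Suc j) (Suc j) * f (i + Suc j) s * f (Suc j) s)" if "0 \<le> s" for s
    using continuous_weighted_suminf(2)[OF c hc h0 hs hM, of s] that unfolding ch by simp
qed

lemma loss_alt: "1 \<le> i \<Longrightarrow> 0 \<le> s \<Longrightarrow> loss a f i s = f i s * (\<Sum>j. a i (Suc j) * f (Suc j) s)"
proof -
  assume i: "1 \<le> i" and s: "0 \<le> s"
  have "loss a f i s = (\<Sum>j. f i s * (a i (Suc j) * f (Suc j) s))" unfolding loss_def by (simp add: mult_ac)
  also have "\<dots> = f i s * (\<Sum>j. a i (Suc j) * f (Suc j) s)" by (rule suminf_mult[OF loss_series(2)[OF i s]])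
  finally show ?thesis .
qed

text \<open>
The discrete right-hand side is the shifted right-hand side of the piecewise constant function,
exactly: rounding the shift maps cells to cells.
\<close>

lemma rate_eq:
  assumes s: "0 \<le> s"
  shows "shifted_rate \<kappa> (node \<epsilon>) (\<epsilon> / 2) (u s) x =
    by_cell \<epsilon> (\<lambda>i. gain a f i s - loss a f i s) x"
proof (cases "x < \<epsilon> / 2")
  case True
  then have "cell_index \<epsilon> x = 0" using cell_index_eq_0_iff[OF e0] by blast
  then show ?thesis using True by (simp add: shifted_rate_def by_cell_def cell_solution_def)
next
  case False
  define i where "i = cell_index \<epsilon> x"
  have i: "1 \<le> i" using False cell_index_eq_0_iff[OF e0, of x] unfolding i_def by linarith
  have us: "max 0 s = s" using s by simp
  have integrand: "\<kappa> (x + node \<epsilon> y) y * u s (x + node \<epsilon> y) * u s y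
     = by_cell \<epsilon> (\<lambda>j. (a (i + j) j * f (i + j) s * f j s) / \<epsilon>) y" for y
  proof -
    have "cell_index \<epsilon> (x + node \<epsilon> y) = i + cell_index \<epsilon> y"
      unfolding node_def i_def using False by (intro cell_index_shift e0) simp
    then show ?thesis using i unfolding cell_kernel_def cell_solution_def by_cell_def us by simp
  qed
  have g: "(\<integral>y. \<kappa> (x + node \<epsilon> y) y * u s (x + node \<epsilon> y) * u s y \<partial>lborel) = gain a f i s"
  proof -
    have "(\<integral>y. by_cell \<epsilon> (\<lambda>j. (a (i + j) j * f (i + j) s * f j s) / \<epsilon>) y \<partial>lborel) =
        \<epsilon> * (\<Sum>j. (a (i + Suc j) (Suc j) * f (i + Suc j) s * f (Suc j) s) / \<epsilon>)"
    proof (rule by_cell_integral(2)[OF e0])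
      show "0 \<le> a (i + j) j * f (i + j) s * f j s / \<epsilon>" if "1 \<le> j" for j
        using that i s e0 by (intro divide_nonneg_nonneg mult_nonneg_nonneg coefficient_nonneg f_nonneg) auto
      show "summable (\<lambda>j. a (i + Suc j) (Suc j) * f (i + Suc j) s * f (Suc j) s / \<epsilon>)"
        by (intro summable_divide gain_series(2) i s)
    qed
    also have "\<dots> = gain a f i s"
      unfolding gain_def using suminf_divide[OF gain_series(2)[OF i s], of \<epsilon>] e0 by simp
    finally show ?thesis using integrand by simp
  qed
  have "\<kappa> x y * u s y = by_cell \<epsilon> (\<lambda>j. (a i j * f j s) / \<epsilon>) y" for y
    using i unfolding cell_kernel_def cell_solution_def by_cell_def us i_def[symmetric] by simp
  then have "(\<integral>y. \<kappa> x y * u s y \<partial>lborel) = (\<integral>y. by_cell \<epsilon> (\<lambda>j. (a i j * f j s) / \<epsilon>) y \<partial>lborel)" by simp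
  also have "\<dots> = \<epsilon> * (\<Sum>j. (a i (Suc j) * f (Suc j) s) / \<epsilon>)"
  proof (rule by_cell_integral(2)[OF e0])
    show "0 \<le> a i j * f j s / \<epsilon>" if "1 \<le> j" for j
      using that i s e0 by (intro divide_nonneg_nonneg mult_nonneg_nonneg coefficient_nonneg f_nonneg) auto
    show "summable (\<lambda>j. a i (Suc j) * f (Suc j) s / \<epsilon>)" by (intro summable_divide loss_series(2) i s)
  qed
  also have "\<dots> = (\<Sum>j. a i (Suc j) * f (Suc j) s)"
    using suminf_divide[OF loss_series(2)[OF i s], of \<epsilon>] e0 by simp
  finally have l: "(\<integral>y. \<kappa> x y * u s y \<partial>lborel) = (\<Sum>j. a i (Suc j) * f (Suc j) s)" .
  have "u s x = f i s" using i unfolding cell_solution_def by_cell_def us i_def[symmetric] by simp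
  then show ?thesis using False i
    unfolding shifted_rate_def g l by_cell_def i_def[symmetric] by (simp add: loss_alt[OF i s])
qed

lemma rate_continuous:
  "continuous_on {0..} (\<lambda>s. shifted_rate \<kappa> (node \<epsilon>) (\<epsilon> / 2) (u s) x)"
proof -
  have "continuous_on {0..} (\<lambda>s. by_cell \<epsilon> (\<lambda>i. gain a f i s - loss a f i s) x)"
  proof (cases "cell_index \<epsilon> x = 0")
    case True then show ?thesis by (simp add: by_cell_def)
  next
    case False
    then have i: "1 \<le> cell_index \<epsilon> x" by simp
    have "continuous_on {0..} (\<lambda>s. gain a f (cell_index \<epsilon> x) s - f (cell_index \<epsilon> x) s * (\<Sum>j. a (cell_index \<epsilon> x) (Suc j) * f (Suc j) s))"
      by (intro continuous_intros gain_series(1) loss_series(1) f_continuous i)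
    then show ?thesis
      by (rule continuous_on_eq) (use i loss_alt in \<open>auto simp: by_cell_def\<close>)
  qed
  then show ?thesis by (rule continuous_on_eq) (simp add: rate_eq)
qed

lemma initial: "1 \<le> i \<Longrightarrow> f i 0 = f0 i"
proof -
  assume i: "1 \<le> i"
  have "(\<integral>s. indicator {0..0} s * (gain a f i s - loss a f i s) \<partial>lborel) = 0"
    by (rule integral_eq_zero_AE, use AE_lborel_singleton[of "0::real"] in eventually_elim) (auto simp: indicator_def)
  then show ?thesis using f_equation[OF i, of 0] by simp
qed

lemma u_initial: "u 0 = by_cell \<epsilon> f0"
  unfolding cell_solution_def by_cell_def using initial by auto

lemma evolution:
  assumes t: "0 \<le> t"
  shows "u t x = u 0 x + (\<integral>s. indicator {0..t} s * shifted_rate \<kappa> (node \<epsilon>) (\<epsilon> / 2) (u s) x \<partial>lborel)"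
proof -
  have eq: "(\<integral>s. indicator {0..t} s * shifted_rate \<kappa> (node \<epsilon>) (\<epsilon> / 2) (u s) x \<partial>lborel) =
      (\<integral>s. indicator {0..t} s * by_cell \<epsilon> (\<lambda>i. gain a f i s - loss a f i s) x \<partial>lborel)"
    by (intro Bochner_Integration.integral_cong) (auto simp: rate_eq indicator_def)
  show ?thesis
  proof (cases "cell_index \<epsilon> x = 0")
    case True then show ?thesis unfolding eq by (simp add: by_cell_def cell_solution_def)
  next
    case False
    then have i: "1 \<le> cell_index \<epsilon> x" by simp
    show ?thesis unfolding eq using False f_equation[OF i t] initial[OF i] t
      by (simp add: by_cell_def cell_solution_def)
  qed
qed

lemma cell_solution_measurable: "(\<lambda>z. u (fst z) (snd z)) \<in> borel_measurable (borel \<Otimes>\<^sub>M borel)"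
proof -
  have c: "(\<lambda>t. if i = 0 then 0 else f i (max 0 t)) \<in> borel_measurable borel" for i
  proof (cases "i = 0")
    case False
    then have "1 \<le> i" by simp
    then have "continuous_on UNIV (\<lambda>t. f i (max 0 t))"
      by (intro continuous_on_compose2[OF f_continuous]) (auto intro!: continuous_intros)
    then show ?thesis using False by (simp add: borel_measurable_continuous_onI)
  qed simp
  have "(\<lambda>z. (\<lambda>i z. if i = 0 then 0 else f i (max 0 (fst z))) (cell_index \<epsilon> (snd z)) z) \<in> borel_measurable (borel \<Otimes>\<^sub>M borel)"
  proof (rule measurable_compose_countable)
    show "(\<lambda>z. if i = 0 then 0 else f i (max 0 (fst z))) \<in> borel_measurable (borel \<Otimes>\<^sub>M borel)" for i
      using measurable_compose[OF measurable_fst c[of i], of borel] by simp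
    show "(\<lambda>z. cell_index \<epsilon> (snd z)) \<in> borel \<Otimes>\<^sub>M borel \<rightarrow>\<^sub>M count_space UNIV"
      using measurable_compose[OF measurable_snd cell_index_measurable] by simp
  qed
  then show ?thesis by (simp add: cell_solution_def by_cell_def)
qed

lemma cell_kernel_measurable: "(\<lambda>z. \<kappa> (fst z) (snd z)) \<in> borel_measurable (borel \<Otimes>\<^sub>M borel)"
proof -
  have "(\<lambda>z. (\<lambda>i z. if i = 0 then 0 else by_cell \<epsilon> (\<lambda>j. a i j / \<epsilon>) (snd z)) (cell_index \<epsilon> (fst z)) z) \<in> borel_measurable (borel \<Otimes>\<^sub>M borel)"
  proof (rule measurable_compose_countable)
    show "(\<lambda>z. if i = 0 then 0 else by_cell \<epsilon> (\<lambda>j. a i j / \<epsilon>) (snd z)) \<in> borel_measurable (borel \<Otimes>\<^sub>M borel)" for i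
      by measurable
    show "(\<lambda>z. cell_index \<epsilon> (fst z)) \<in> borel \<Otimes>\<^sub>M borel \<rightarrow>\<^sub>M count_space UNIV"
      using measurable_compose[OF measurable_fst cell_index_measurable] by simp
  qed
  then show ?thesis by (simp add: cell_kernel_def by_cell_def)
qed

text \<open>
On the \<open>i\<close>-th cell \<open>1 + x\<close> is at most \<open>2 + 2 * \<epsilon> * i\<close>, which reduces the first moment to the sums
of \<open>f i\<close> and \<open>i * f i\<close>.
\<close>

lemma u_moment:
  "integrable lborel (\<lambda>x. (1 + x) * u t x)"
  "(\<integral>x. (1 + x) * u t x \<partial>lborel) \<le> 2 * (\<integral>x. u t x \<partial>lborel) + 2 * \<epsilon>\<^sup>2 * (\<Sum>j. real (Suc j) * f (Suc j) (max 0 t))"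
  "(\<integral>x. u t x \<partial>lborel) \<le> \<epsilon> * mass_bound"
proof -
  let ?t = "max 0 t"
  have t: "0 \<le> ?t" by simp
  have ms: "summable (\<lambda>j. real (Suc j) * f (Suc j) ?t)" by (rule mass_summable[OF t])
  have fs: "summable (\<lambda>j. f (Suc j) ?t)"
  proof (rule summable_comparison_test'[where N=0, OF ms])
    show "norm (f (Suc j) ?t) \<le> real (Suc j) * f (Suc j) ?t" for j
      using f_nonneg[OF _ t, of "Suc j"] by (simp add: mult_le_cancel_right1 algebra_simps)
  qed
  have ui: "integrable lborel (u t)" "(\<integral>x. u t x \<partial>lborel) = \<epsilon> * (\<Sum>j. f (Suc j) ?t)"
    unfolding cell_solution_def using by_cell_integral[OF e0, of "\<lambda>i. f i ?t"] f_nonneg[OF _ t] fs by auto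
  have "(\<Sum>j. f (Suc j) ?t) \<le> (\<Sum>j. real (Suc j) * f (Suc j) ?t)"
    by (rule suminf_le[OF _ fs ms]) (use f_nonneg[OF _ t] in \<open>simp add: algebra_simps\<close>)
  then show "(\<integral>x. u t x \<partial>lborel) \<le> \<epsilon> * mass_bound" unfolding ui(2) using mass_le[OF t] e0 by simp
  have mi: "integrable lborel (by_cell \<epsilon> (\<lambda>i. real i * f i ?t))"
    "(\<integral>x. by_cell \<epsilon> (\<lambda>i. real i * f i ?t) x \<partial>lborel) = \<epsilon> * (\<Sum>j. real (Suc j) * f (Suc j) ?t)"
    using by_cell_integral[OF e0, of "\<lambda>i. real i * f i ?t"] f_nonneg[OF _ t] ms by auto
  have u0: "0 \<le> u t x" for x using f_nonneg[OF _ t] by (simp add: cell_solution_def by_cell_def)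
  have pt: "0 \<le> (1 + x) * u t x \<and> (1 + x) * u t x \<le> 2 * u t x + 2 * \<epsilon> * by_cell \<epsilon> (\<lambda>i. real i * f i ?t) x" for x
  proof (cases "x < \<epsilon> / 2")
    case True
    then show ?thesis using cell_index_eq_0_iff[OF e0, of x] by (simp add: cell_solution_def by_cell_def)
  next
    case False
    then have x: "\<epsilon> / 2 \<le> x" by simp
    define i where "i = cell_index \<epsilon> x"
    have i: "i \<noteq> 0" using False cell_index_eq_0_iff[OF e0, of x] unfolding i_def by linarith
    have ux: "u t x = f i ?t" using i by (simp add: cell_solution_def by_cell_def i_def)
    have "\<bar>\<epsilon> * real i - x\<bar> \<le> \<epsilon> / 2" unfolding i_def by (rule cell_node_close[OF e0 x])
    moreover have "0 \<le> \<epsilon> * real i" using e0 by simp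
    ultimately have "1 + x \<le> 2 + 2 * (\<epsilon> * real i)" using e1 by linarith
    then have "(1 + x) * u t x \<le> (2 + 2 * (\<epsilon> * real i)) * u t x" by (rule mult_right_mono[OF _ u0])
    also have "\<dots> = 2 * u t x + 2 * \<epsilon> * by_cell \<epsilon> (\<lambda>i. real i * f i ?t) x"
      using i unfolding ux by (simp add: by_cell_def i_def[symmetric] algebra_simps)
    finally show ?thesis using x e0 u0[of x] by simp
  qed
  have Ri: "integrable lborel (\<lambda>x. 2 * u t x + 2 * \<epsilon> * by_cell \<epsilon> (\<lambda>i. real i * f i ?t) x)"
    by (intro Bochner_Integration.integrable_add integrable_mult_right ui mi)
  have um: "u t \<in> borel_measurable borel" using ui(1) by simp
  show i: "integrable lborel (\<lambda>x. (1 + x) * u t x)"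
    by (rule integrable_between[OF Ri]) (use um pt in auto)
  have "(\<integral>x. (1 + x) * u t x \<partial>lborel) \<le> (\<integral>x. 2 * u t x + 2 * \<epsilon> * by_cell \<epsilon> (\<lambda>i. real i * f i ?t) x \<partial>lborel)"
    by (rule integral_mono[OF i Ri]) (use pt in blast)
  also have "\<dots> = 2 * (\<integral>x. u t x \<partial>lborel) + 2 * \<epsilon>\<^sup>2 * (\<Sum>j. real (Suc j) * f (Suc j) ?t)"
    using ui(1) mi by (simp add: power2_eq_square)
  finally show "(\<integral>x. (1 + x) * u t x \<partial>lborel) \<le> 2 * (\<integral>x. u t x \<partial>lborel) + 2 * \<epsilon>\<^sup>2 * (\<Sum>j. real (Suc j) * f (Suc j) (max 0 t))" .
qed

lemma shifted_rbk_instance: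
  assumes C: "\<And>x y. 0 < x \<Longrightarrow> 0 < y \<Longrightarrow> \<kappa> x y \<le> C * (1 + x) * (1 + y)"
    and B: "\<And>t. (\<integral>x. (1 + x) * u t x \<partial>lborel) \<le> B"
  shows "shifted_rbk \<kappa> (node \<epsilon>) (\<epsilon> / 2) C B u"
proof
  show "(\<lambda>z. \<kappa> (fst z) (snd z)) \<in> borel_measurable (borel \<Otimes>\<^sub>M borel)" by (rule cell_kernel_measurable)
  show "(\<lambda>z. u (fst z) (snd z)) \<in> borel_measurable (borel \<Otimes>\<^sub>M borel)" by (rule cell_solution_measurable)
  show "0 \<le> u t x" for t x using f_nonneg[of _ "max 0 t"] by (simp add: cell_solution_def by_cell_def)
  show "u t x = 0" if "x < \<epsilon> / 2" for t x
    using that cell_index_eq_0_iff[OF e0, of x] by (simp add: cell_solution_def by_cell_def)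
qed (use e0 in \<open>auto intro!: cell_kernel_nonneg[OF K e0 a] C B u_moment evolution rate_continuous simp: node_def\<close>)

text \<open>
The estimates of the shifted equation presuppose some bound on the first moment. A first,
step-dependent bound comes from the mass bound of a discrete solution; it yields that the number
of particles does not increase, and this together with the assumption on the mass gives a bound
by the initial datum alone.
\<close>

lemma first_moment_le:
  assumes mass: "\<And>t. 0 \<le> t \<Longrightarrow> (\<Sum>i. real (Suc i) * f (Suc i) t) \<le> (\<Sum>i. real (Suc i) * f0 (Suc i))"
    and N: "(\<integral>x. by_cell \<epsilon> f0 x \<partial>lborel) \<le> N" and L: "\<epsilon>\<^sup>2 * (\<Sum>i. real (Suc i) * f0 (Suc i)) \<le> L"
  shows "(\<integral>x. (1 + x) * u t x \<partial>lborel) \<le> 2 * (N + L)"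
proof -
  obtain C where "\<And>x y. 0 < x \<Longrightarrow> 0 < y \<Longrightarrow> \<kappa> x y \<le> C * (1 + x) * (1 + y)"
    using cell_kernel_linear_growth[OF K] e0 e1 a by blast
  moreover have "(\<integral>x. (1 + x) * u t x \<partial>lborel) \<le> 2 * (\<epsilon> * mass_bound) + 2 * \<epsilon>\<^sup>2 * mass_bound" for t
  proof -
    have "2 * \<epsilon>\<^sup>2 * (\<Sum>j. real (Suc j) * f (Suc j) (max 0 t)) \<le> 2 * \<epsilon>\<^sup>2 * mass_bound"
      by (intro mult_left_mono mass_le) simp_all
    then show ?thesis using u_moment(2,3)[of t] by linarith
  qed
  ultimately interpret shifted_rbk \<kappa> "node \<epsilon>" "\<epsilon> / 2" C "2 * (\<epsilon> * mass_bound) + 2 * \<epsilon>\<^sup>2 * mass_bound" u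
    by (rule shifted_rbk_instance)
  have "(\<integral>x. u t x \<partial>lborel) \<le> N"
  proof -
    have "u t = u (max 0 t)" by (simp add: cell_solution_def)
    then have "(\<integral>x. u t x \<partial>lborel) = (\<integral>x. u (max 0 t) x \<partial>lborel)" by simp
    also have "\<dots> \<le> (\<integral>x. u 0 x \<partial>lborel)" by (rule number_nonincreasing) simp
    finally show ?thesis using N by (simp add: u_initial)
  qed
  moreover have "\<epsilon>\<^sup>2 * (\<Sum>j. real (Suc j) * f (Suc j) (max 0 t)) \<le> L"
  proof -
    have "\<epsilon>\<^sup>2 * (\<Sum>j. real (Suc j) * f (Suc j) (max 0 t)) \<le> \<epsilon>\<^sup>2 * (\<Sum>i. real (Suc i) * f0 (Suc i))"
      by (intro mult_left_mono mass) simp_all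
    then show ?thesis using L by linarith
  qed
  ultimately show ?thesis using u_moment(2)[of t] by (simp add: algebra_simps)
qed

end

lemma equi_integrable_reindex:
  assumes "equi_integrable M U" shows "equi_integrable M (\<lambda>i. U (\<sigma> i))"
  unfolding equi_integrable_def
proof (intro conjI allI impI)
  show "integrable M (U (\<sigma> i))" "0 \<le> U (\<sigma> i) x" for i x using assms by (auto simp: equi_integrable_def)
  fix \<eta> :: real assume "0 < \<eta>"
  then obtain B S where "B \<ge> 0" "S \<in> sets M" "emeasure M S < \<infinity>"
    and "\<And>i. (\<integral>x. max 0 (U i x - B * indicator S x) \<partial>M) \<le> \<eta>"
    using assms unfolding equi_integrable_def by meson
  then show "\<exists>B\<ge>0. \<exists>S\<in>sets M. emeasure M S < \<infinity> \<and> (\<forall>i. (\<integral>x. max 0 (U (\<sigma> i) x - B * indicator S x) \<partial>M) \<le> \<eta>)"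
    by blast
qed

text \<open>
Pointwise convergence on a finite grid is uniform there, and the common Lipschitz constant takes
care of the points in between.
\<close>

lemma equilipschitz_uniform_convergence:
  fixes h :: "nat \<Rightarrow> real \<Rightarrow> real"
  assumes lim: "\<And>t. 0 \<le> t \<Longrightarrow> (\<lambda>n. h n t) \<longlonglongrightarrow> 0"
    and lip: "\<And>n s t. 0 \<le> s \<Longrightarrow> s \<le> t \<Longrightarrow> \<bar>h n t - h n s\<bar> \<le> L * (t - s)"
    and e: "0 < e"
  shows "\<exists>n0. \<forall>n\<ge>n0. \<forall>t\<in>{0..T}. \<bar>h n t\<bar> \<le> e"
proof -
  have L0: "0 \<le> L" using lip[of 0 1 0] by (smt (verit) mult_cancel_left1)
  define \<delta> where "\<delta> = e / (2 * (L + 1))"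
  have d: "0 < \<delta>" "L * \<delta> \<le> e / 2" using e L0 by (auto simp: \<delta>_def field_simps)
  define m where "m = nat \<lceil>T / \<delta>\<rceil>"
  have "\<forall>k\<in>{..m}. \<forall>\<^sub>F n in sequentially. \<bar>h n (real k * \<delta>)\<bar> < e / 2"
  proof
    fix k
    have "(\<lambda>n. h n (real k * \<delta>)) \<longlonglongrightarrow> 0" using d by (intro lim) simp
    then show "\<forall>\<^sub>F n in sequentially. \<bar>h n (real k * \<delta>)\<bar> < e / 2"
      using e tendstoD[of "\<lambda>n. h n (real k * \<delta>)" 0 sequentially "e/2"] by (simp add: dist_real_def)
  qed
  then have "\<forall>\<^sub>F n in sequentially. \<forall>k\<in>{..m}. \<bar>h n (real k * \<delta>)\<bar> < e / 2"
    by (simp add: eventually_ball_finite_distrib)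
  then obtain n0 where n0: "\<And>n k. n0 \<le> n \<Longrightarrow> k \<le> m \<Longrightarrow> \<bar>h n (real k * \<delta>)\<bar> < e / 2"
    unfolding eventually_sequentially by auto
  have "\<bar>h n t\<bar> \<le> e" if n: "n0 \<le> n" and t: "t \<in> {0..T}" for n t
  proof -
    define k where "k = nat \<lfloor>t / \<delta>\<rfloor>"
    have td: "0 \<le> t / \<delta>" using t d by simp
    have k1: "real k \<le> t / \<delta>" "t / \<delta> < real k + 1" using td unfolding k_def by linarith+
    have "t / \<delta> \<le> T / \<delta>" using t d by (intro divide_right_mono) auto
    then have km: "k \<le> m" unfolding k_def m_def by linarith
    have a: "real k * \<delta> \<le> t" "t - real k * \<delta> \<le> \<delta>"
      using k1 d by (auto simp: le_divide_eq divide_less_eq algebra_simps)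
    have "\<bar>h n t - h n (real k * \<delta>)\<bar> \<le> L * (t - real k * \<delta>)" using a d by (intro lip) auto
    also have "\<dots> \<le> L * \<delta>" using a L0 by (intro mult_left_mono) auto
    also have "\<dots> \<le> e / 2" by (rule d)
    finally show ?thesis using n0[OF n km] by linarith
  qed
  then show ?thesis by blast
qed

lemma borel_greaterThan_generator:
  "sets (lborel :: real measure) = sigma_sets UNIV (range greaterThan)" "Int_stable (range (greaterThan :: real \<Rightarrow> _))"
  "space (lborel :: real measure) = UNIV"
proof -
  show "sets (lborel :: real measure) = sigma_sets UNIV (range greaterThan)"
    by (subst sets_lborel, subst borel_Ioi) (simp add: sets_measure_of)
  show "Int_stable (range (greaterThan :: real \<Rightarrow> _))"
  proof (rule Int_stableI_image)
    show "\<exists>c\<in>UNIV. {a<..} \<inter> {b<..} = {c<..}" for a b :: real by (intro bexI[of _ "max a b"]) auto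
  qed
qed simp

text \<open>
The function \<open>shifted_test\<close> without rounding.
\<close>

definition limit_test :: "(real \<Rightarrow> real) \<Rightarrow> real \<times> real \<Rightarrow> real" where
  "limit_test \<phi> z = indicator {0<..} (fst z - snd z) * \<phi> (fst z - snd z) - \<phi> (fst z)"

lemma limit_test_measurable [measurable]:
  assumes [measurable]: "p \<in> borel_measurable borel"
  shows "limit_test p \<in> borel_measurable (borel \<Otimes>\<^sub>M borel)"
  unfolding limit_test_def by measurable

lemma limit_test_bounded:
  assumes "\<And>x. \<bar>p x\<bar> \<le> D"
  shows "\<bar>limit_test p z\<bar> \<le> 2 * D"
proof -
  have "\<bar>indicator {0<..} a * p a\<bar> \<le> D" for a :: real using assms[of a] by (auto simp: indicator_def)
  then have "\<bar>indicator {0<..} (fst z - snd z) * p (fst z - snd z)\<bar> \<le> D" .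
  then show ?thesis using assms[of "fst z"] unfolding limit_test_def by linarith
qed

lemma AE_diff_neq: "AE z in plane. fst z - snd z \<noteq> (c :: real)"
proof (rule lborel_pair.AE_pair_measure)
  show "{z \<in> space plane. fst z - snd z \<noteq> c} \<in> sets plane" by measurable
  show "AE x in lborel. AE y in lborel. fst (x, y) - snd (x, y) \<noteq> c"
  proof (rule AE_I2)
    fix x :: real
    show "AE y in lborel. fst (x, y) - snd (x, y) \<noteq> c"
      using AE_lborel_singleton[of "x - c"] by eventually_elim auto
  qed
qed

section \<open>Compactness\<close>

text \<open>
The properties of the discretised solutions that enter the passage to the limit, free of cells and
indices.
\<close>

locale rbk_sequence =
  fixes \<kappa> :: "nat \<Rightarrow> real \<Rightarrow> real \<Rightarrow> real" and \<tau> :: "nat \<Rightarrow> real \<Rightarrow> real" and d :: "nat \<Rightarrow> real" and C B :: real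
    and U :: "nat \<Rightarrow> real \<Rightarrow> real \<Rightarrow> real" and K :: "real \<Rightarrow> real \<Rightarrow> real" and F :: "real \<Rightarrow> real"
  assumes approx: "\<And>n. shifted_rbk (\<kappa> n) (\<tau> n) (d n) C B (U n)"
    and d_lim: "d \<longlonglongrightarrow> 0" and d_le: "\<And>n. d n \<le> 1"
    and shift_close: "\<And>n y. d n \<le> y \<Longrightarrow> \<bar>\<tau> n y - y\<bar> \<le> d n"
    and initial_tails: "\<And>\<eta>. 0 < \<eta> \<Longrightarrow> \<exists>A\<ge>0. \<exists>R\<ge>0. \<forall>n. (\<integral>x. max 0 (U n 0 x - A * indicator {0..R} x) \<partial>lborel) \<le> \<eta>"
    and sublinear: "\<And>\<eta>. 0 < \<eta> \<Longrightarrow> \<exists>R\<ge>1. \<forall>n x y. 0 < x \<longrightarrow> 0 < y \<longrightarrow> R \<le> x \<or> R \<le> y \<longrightarrow> \<kappa> n x y \<le> \<eta> * (1 + x) * (1 + y)"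
    and kernel_lim: "\<And>x y. 0 < x \<Longrightarrow> 0 < y \<Longrightarrow> (\<lambda>n. \<kappa> n x y) \<longlonglongrightarrow> K x y"
    and F: "integrable lborel F" "\<And>x. x \<le> 0 \<Longrightarrow> F x = 0"
    and initial_lim: "\<And>q. (\<lambda>n. \<integral>x. U n 0 x * indicator {q<..} x \<partial>lborel) \<longlonglongrightarrow> (\<integral>x. F x * indicator {q<..} x \<partial>lborel)"
begin

lemma U_nonneg: "0 \<le> U n t x" by (rule shifted_rbk.u_nonneg[OF approx])
lemma U_integrable: "integrable lborel (U n t)" by (rule shifted_rbk.u_integrable[OF approx])
lemma U_integral_le: "(\<integral>x. U n t x \<partial>lborel) \<le> B" by (rule shifted_rbk.u_integral_le[OF approx])
lemma U_support: "x \<le> 0 \<Longrightarrow> U n t x = 0"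
  using shifted_rbk.u_support[OF approx] shifted_rbk.d_pos[OF approx, of n] by (metis less_le_trans not_le)
lemma B_nonneg: "0 \<le> B" by (rule shifted_rbk.B_nonneg[OF approx])
lemma C_nonneg: "0 \<le> C" by (rule shifted_rbk.C_nonneg[OF approx])

text \<open>
Comparison with the supersolution that starts from the bound on the initial data. A particle that
survives a collision with one of size \<open>y\<close> was larger than the rounded size, so only sizes below
\<open>R + 2\<close> matter for the bound \<open>k\<close> on the kernel.
\<close>

lemma equi_integrable_at:
  assumes t: "0 \<le> t"
  shows "equi_integrable lborel (\<lambda>n. U n t)"
  unfolding equi_integrable_def
proof (intro conjI allI impI)
  fix \<eta> :: real assume "0 < \<eta>"
  then obtain A R where A: "0 \<le> A" "0 \<le> R" and ini: "\<And>n. (\<integral>x. max 0 (U n 0 x - A * indicator {0..R} x) \<partial>lborel) \<le> \<eta>"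
    using initial_tails by blast
  define k where "k = C * (1 + R) * (3 + R)"
  have k: "0 \<le> k" using A C_nonneg by (simp add: k_def)
  have "(\<integral>x. max 0 (U n t x - (A * exp (k * B * t)) * indicator {0..R} x) \<partial>lborel) \<le> \<eta>" for n
  proof -
    interpret shifted_rbk "\<kappa> n" "\<tau> n" "d n" C B "U n" by (rule approx)
    have "(\<integral>x. max 0 (U n t x - A * exp (k * B * t) * indicator {0..R} x) \<partial>lborel)
      \<le> (\<integral>x. max 0 (U n 0 x - A * indicator {0..R} x) \<partial>lborel)"
    proof (rule comparison[OF t A(1) k _ u_integral_le])
      fix x y assume xy: "0 < x" "x \<le> R" "0 < y" "\<tau> n y \<le> x"
      have "y \<le> R + 2"
      proof (cases "d n \<le> y")
        case True
        then show ?thesis using shift_close[OF True] d_le[of n] xy by linarith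
      next
        case False
        then show ?thesis using d_le[of n] A by linarith
      qed
      have "\<kappa> n x y \<le> C * (1 + x) * (1 + y)" using xy by (intro kernel_le) auto
      also have "\<dots> \<le> C * (1 + R) * (3 + R)" using xy \<open>y \<le> R + 2\<close> C_nonneg by (intro mult_mono) auto
      finally show "\<kappa> n x y \<le> k" by (simp add: k_def)
    qed
    then show ?thesis using ini[of n] by simp
  qed
  then show "\<exists>B\<ge>0. \<exists>S\<in>sets lborel. emeasure lborel S < \<infinity> \<and> (\<forall>i. (\<integral>x. max 0 (U i t x - B * indicator S x) \<partial>lborel) \<le> \<eta>)"
    using A by (intro exI[of _ "A * exp (k * B * t)"] conjI bexI[of _ "{0..R}"]) (auto simp: emeasure_lborel_Icc_eq)
qed (auto intro: U_integrable U_nonneg)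

lemma U_lipschitz:
  assumes "0 \<le> s" "s \<le> t" "\<phi> \<in> borel_measurable borel" "\<And>x. \<bar>\<phi> x\<bar> \<le> D"
  shows "\<bar>(\<integral>x. U n t x * \<phi> x \<partial>lborel) - (\<integral>x. U n s x * \<phi> x \<partial>lborel)\<bar> \<le> 2 * D * (C * B\<^sup>2) * (t - s)"
  by (rule shifted_rbk.weak_lipschitz[OF approx assms])

lemma subsequence:
  assumes "strict_mono \<sigma>"
  shows "rbk_sequence (\<lambda>n. \<kappa> (\<sigma> n)) (\<lambda>n. \<tau> (\<sigma> n)) (\<lambda>n. d (\<sigma> n)) C B (\<lambda>n. U (\<sigma> n)) K F"
proof (rule rbk_sequence.intro)
  show "(\<lambda>n. d (\<sigma> n)) \<longlonglongrightarrow> 0" using LIMSEQ_subseq_LIMSEQ[OF d_lim assms] by (simp add: o_def)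
  show "(\<lambda>n. \<kappa> (\<sigma> n) x y) \<longlonglongrightarrow> K x y" if "0 < x" "0 < y" for x y
    using LIMSEQ_subseq_LIMSEQ[OF kernel_lim[OF that] assms] by (simp add: o_def)
  show "(\<lambda>n. \<integral>x. U (\<sigma> n) 0 x * indicator {q<..} x \<partial>lborel) \<longlonglongrightarrow> (\<integral>x. F x * indicator {q<..} x \<partial>lborel)" for q
    using LIMSEQ_subseq_LIMSEQ[OF initial_lim assms] by (simp add: o_def)
  show "\<exists>A\<ge>0. \<exists>R\<ge>0. \<forall>n. (\<integral>x. max 0 (U (\<sigma> n) 0 x - A * indicator {0..R} x) \<partial>lborel) \<le> \<eta>" if "0 < \<eta>" for \<eta>
    using initial_tails[OF that] by blast
  show "\<exists>R\<ge>1. \<forall>n x y. 0 < x \<longrightarrow> 0 < y \<longrightarrow> R \<le> x \<or> R \<le> y \<longrightarrow> \<kappa> (\<sigma> n) x y \<le> \<eta> * (1 + x) * (1 + y)" if "0 < \<eta>" for \<eta>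
    using sublinear[OF that] by blast
qed (use approx d_le shift_close F in auto)

text \<open>
A diagonal argument makes the integrals over rational rays converge at rational times. Right limits
give all rays and the monotone class argument all bounded test functions. The Lipschitz estimate
carries the convergence to all times, and the density comes from the equi-integrability.
\<close>

lemma weakly_convergent_subsequence:
  obtains \<sigma> g where "strict_mono (\<sigma> :: nat \<Rightarrow> nat)"
    "\<And>t. 0 \<le> t \<Longrightarrow> integrable lborel (g t)" "\<And>t x. 0 \<le> t \<Longrightarrow> 0 \<le> g t x" "\<And>t x. 0 \<le> t \<Longrightarrow> x \<le> 0 \<Longrightarrow> g t x = 0"
    "\<And>t \<phi> D. 0 \<le> t \<Longrightarrow> \<phi> \<in> borel_measurable borel \<Longrightarrow> (\<And>x. \<bar>\<phi> x\<bar> \<le> D) \<Longrightarrow>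
       (\<lambda>n. \<integral>x. U (\<sigma> n) t x * \<phi> x \<partial>lborel) \<longlonglongrightarrow> (\<integral>x. g t x * \<phi> x \<partial>lborel)"
proof -
  define S where "S = (\<rat> \<times> (\<rat> \<inter> {0..}) :: (real \<times> real) set)"
  have cS: "countable S" unfolding S_def by (intro countable_SIGMA countable_rat countable_Int1)
  have bS: "norm (\<integral>x. U n (snd z) x * indicator {fst z<..} x \<partial>lborel) \<le> B" if "z \<in> S" for n z
  proof -
    have "\<bar>\<integral>x. U n (snd z) x * indicator {fst z<..} x \<partial>lborel\<bar> \<le> 1 * (\<integral>x. U n (snd z) x \<partial>lborel)"
      by (rule integral_bounded_mult_le[OF U_integrable]) (auto simp: U_nonneg indicator_def)
    then show ?thesis using U_integral_le[of n "snd z"] by simp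
  qed
  obtain \<sigma> where \<sigma>: "strict_mono (\<sigma> :: nat \<Rightarrow> nat)"
    and conv: "\<And>z. z \<in> S \<Longrightarrow> \<exists>l. (\<lambda>n. \<integral>x. U (\<sigma> n) (snd z) x * indicator {fst z<..} x \<partial>lborel) \<longlonglongrightarrow> l"
  proof -
    show thesis
      by (rule function_convergent_subsequence[where f="\<lambda>n z. \<integral>x. U n (snd z) x * indicator {fst z<..} x \<partial>lborel", OF cS bS])
        (assumption, rule that, assumption+)
  qed
  have EI: "equi_integrable lborel (\<lambda>n. U (\<sigma> n) t)" if "0 \<le> t" for t
    by (rule equi_integrable_reindex[OF equi_integrable_at[OF that]])
  have rational_times: "convergent (\<lambda>n. \<integral>x. U (\<sigma> n) t x * \<phi> x \<partial>lborel)"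
    if t: "t \<in> \<rat>" "0 \<le> t" and \<phi>: "\<phi> \<in> borel_measurable lborel" "\<And>x. \<bar>\<phi> x\<bar> \<le> D" for t :: real and \<phi> :: "real \<Rightarrow> real" and D :: real
    using borel_greaterThan_generator \<phi>
  proof (induction \<phi> rule: bounded_measurable_induct)
    case (base A)
    then obtain q where A: "A = {q<..}" by auto
    have "\<exists>r\<in>\<rat>. q < r \<and> r < q + 1 / real (Suc k)" for k
      by (rule Rats_dense_in_real) simp
    then obtain r where r: "\<And>k. r k \<in> \<rat>" "\<And>k. q < r k" "\<And>k. r k < q + 1 / real (Suc k)" by metis
    show ?case unfolding A
    proof (rule convergent_bounded_limit[OF EI[OF t(2)], where \<phi>="\<lambda>k. indicator {r k<..}" and C=1])
      show "AE x in lborel. (\<lambda>k. indicator {r k<..} x :: real) \<longlonglongrightarrow> indicator {q<..} x"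
      proof (rule AE_I2)
        fix x
        show "(\<lambda>k. indicator {r k<..} x :: real) \<longlonglongrightarrow> indicator {q<..} x"
        proof (cases "q < x")
          case True
          obtain k0 where k0: "inverse (real (Suc k0)) < x - q" using reals_Archimedean[of "x - q"] True by auto
          have "r k < x" if "k0 \<le> k" for k
          proof -
            have "1 / real (Suc k) \<le> 1 / real (Suc k0)" using that by (intro divide_left_mono) auto
            then show ?thesis using r(3)[of k] k0 by (simp add: inverse_eq_divide)
          qed
          then show ?thesis using True
            by (intro tendsto_eventually eventually_sequentiallyI[of k0]) (auto simp: indicator_def)
        next
          case False
          have "\<not> r k < x" for k using r(2)[of k] False by linarith
          then show ?thesis using False by simp
        qed
      qed
      show "convergent (\<lambda>n. \<integral>x. U (\<sigma> n) t x * indicator {r k<..} x \<partial>lborel)" for k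
        using conv[of "(r k, t)"] r(1)[of k] t by (auto simp: S_def convergent_def)
    qed (auto simp: indicator_def)
  next
    case const
    have "(\<integral>x. U (\<sigma> n) t x * 1 \<partial>lborel) = (\<integral>x. U (\<sigma> n) t x * indicator {0<..} x \<partial>lborel)" for n
      using U_support[of _ "\<sigma> n" t] by (intro Bochner_Integration.integral_cong) (auto simp: indicator_def not_less)
    moreover have "convergent (\<lambda>n. \<integral>x. U (\<sigma> n) t x * indicator {0<..} x \<partial>lborel)"
      using conv[of "(0, t)"] t by (auto simp: S_def convergent_def)
    ultimately show ?case by simp
  next
    case (lin f g c Cf Cg)
    note eq = integral_mult_linear[OF U_integrable lin(1,3,2,4)]
    obtain l1 l2 where "(\<lambda>n. \<integral>x. U (\<sigma> n) t x * f x \<partial>lborel) \<longlonglongrightarrow> l1" "(\<lambda>n. \<integral>x. U (\<sigma> n) t x * g x \<partial>lborel) \<longlonglongrightarrow> l2"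
      using lin(5,6) unfolding convergent_def by blast
    then have "(\<lambda>n. (\<integral>x. U (\<sigma> n) t x * f x \<partial>lborel) + c * (\<integral>x. U (\<sigma> n) t x * g x \<partial>lborel)) \<longlonglongrightarrow> l1 + c * l2"
      by (intro tendsto_intros)
    then show ?case unfolding eq by (auto simp: convergent_def)
  next
    case (lim u w D)
    have ae: "AE x in lborel. (\<lambda>k. u k x) \<longlonglongrightarrow> w x" using lim(5) by simp
    show ?case by (rule convergent_bounded_limit[OF EI[OF t(2)] lim(1-4) ae lim(6)])
  qed
  \<comment> \<open>compare with a rational time \<open>s\<close> slightly later than \<open>t\<close>\<close>
  have all_times: "convergent (\<lambda>n. \<integral>x. U (\<sigma> n) t x * \<phi> x \<partial>lborel)"
    if t: "0 \<le> t" and \<phi>: "\<phi> \<in> borel_measurable borel" "\<And>x. \<bar>\<phi> x\<bar> \<le> D" for t :: real and \<phi> :: "real \<Rightarrow> real" and D :: real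
    unfolding Cauchy_convergent_iff[symmetric]
  proof (rule metric_CauchyI)
    fix e :: real assume e: "0 < e"
    define L where "L = 2 * D * (C * B\<^sup>2)"
    have L0: "0 \<le> L" unfolding L_def using \<phi>(2)[of 0] C_nonneg by simp
    have "t < t + e / (4 * (L + 1))" using e L0 by simp
    then obtain s where s: "s \<in> \<rat>" "t < s" "s < t + e / (4 * (L + 1))" using Rats_dense_in_real by blast
    have "L * (s - t) \<le> (L + 1) * (e / (4 * (L + 1)))" using s L0 by (intro mult_mono) auto
    also have "\<dots> = e / 4"
    proof -
      have "c * (e / (4 * c)) = e / 4" if "c \<noteq> 0" for c using that by simp
      then show ?thesis using L0 by (smt (verit))
    qed
    finally have Ls: "L * (s - t) \<le> e / 4" .
    have lip: "\<bar>(\<integral>x. U (\<sigma> n) s x * \<phi> x \<partial>lborel) - (\<integral>x. U (\<sigma> n) t x * \<phi> x \<partial>lborel)\<bar> \<le> e / 4" for n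
      using U_lipschitz[of t s \<phi> D "\<sigma> n"] t s \<phi> Ls by (simp add: L_def)
    have "Cauchy (\<lambda>n. \<integral>x. U (\<sigma> n) s x * \<phi> x \<partial>lborel)"
      unfolding Cauchy_convergent_iff using s t \<phi> by (intro rational_times[of s \<phi> D]) auto
    then obtain N where N: "\<And>m n. N \<le> m \<Longrightarrow> N \<le> n \<Longrightarrow> dist (\<integral>x. U (\<sigma> m) s x * \<phi> x \<partial>lborel) (\<integral>x. U (\<sigma> n) s x * \<phi> x \<partial>lborel) < e / 4"
    proof -
      have e4: "0 < e / 4" using e by simp
      show thesis using metric_CauchyD[OF \<open>Cauchy _\<close> e4] that by blast
    qed
    show "\<exists>N. \<forall>m\<ge>N. \<forall>n\<ge>N. dist (\<integral>x. U (\<sigma> m) t x * \<phi> x \<partial>lborel) (\<integral>x. U (\<sigma> n) t x * \<phi> x \<partial>lborel) < e"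
    proof (intro exI[of _ N] allI impI)
      fix m n assume "N \<le> m" "N \<le> n"
      from N[OF this] lip[of m] lip[of n] e
      show "dist (\<integral>x. U (\<sigma> m) t x * \<phi> x \<partial>lborel) (\<integral>x. U (\<sigma> n) t x * \<phi> x \<partial>lborel) < e"
        unfolding dist_real_def by linarith
    qed
  qed
  have "\<exists>g. integrable lborel g \<and> (\<forall>x. 0 \<le> g x) \<and>
    (\<forall>\<phi>\<in>borel_measurable lborel. \<forall>D. (\<forall>x. \<bar>\<phi> x\<bar> \<le> D) \<longrightarrow>
       (\<lambda>n. \<integral>x. U (\<sigma> n) t x * \<phi> x \<partial>lborel) \<longlonglongrightarrow> (\<integral>x. g x * \<phi> x \<partial>lborel))" if t: "0 \<le> t" for t
  proof (rule weak_limit_density[OF EI[OF t] sigma_finite_lborel])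
    show "convergent (\<lambda>n. \<integral>x. U (\<sigma> n) t x * indicator A x \<partial>lborel)" if "A \<in> sets lborel" for A
      using that by (intro all_times[OF t, of _ 1]) (auto simp: indicator_def)
  qed simp
  then have "\<exists>g. \<forall>t\<in>{0..}. integrable lborel (g t) \<and> (\<forall>x. 0 \<le> g t x) \<and>
    (\<forall>\<phi>\<in>borel_measurable lborel. \<forall>D. (\<forall>x. \<bar>\<phi> x\<bar> \<le> D) \<longrightarrow>
       (\<lambda>n. \<integral>x. U (\<sigma> n) t x * \<phi> x \<partial>lborel) \<longlonglongrightarrow> (\<integral>x. g t x * \<phi> x \<partial>lborel))"
    by (intro bchoice ballI) simp
  then obtain g where gg: "\<forall>t\<in>{0..}. integrable lborel (g t) \<and> (\<forall>x. 0 \<le> g t x) \<and>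
    (\<forall>\<phi>\<in>borel_measurable lborel. \<forall>D. (\<forall>x. \<bar>\<phi> x\<bar> \<le> D) \<longrightarrow>
       (\<lambda>n. \<integral>x. U (\<sigma> n) t x * \<phi> x \<partial>lborel) \<longlonglongrightarrow> (\<integral>x. g t x * \<phi> x \<partial>lborel))" ..
  have g: "integrable lborel (g t)" "0 \<le> g t x" if "0 \<le> t" for t x using gg that by auto
  have glim: "(\<lambda>n. \<integral>x. U (\<sigma> n) t x * \<phi> x \<partial>lborel) \<longlonglongrightarrow> (\<integral>x. g t x * \<phi> x \<partial>lborel)"
    if "0 \<le> t" "\<phi> \<in> borel_measurable borel" "\<And>x. \<bar>\<phi> x\<bar> \<le> D" for t :: real and \<phi> :: "real \<Rightarrow> real" and D :: real
  proof -
    have "\<phi> \<in> borel_measurable lborel" using that by simp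
    then show ?thesis using gg that(1,3) by (meson atLeast_iff)
  qed
  \<comment> \<open>no mass sits at non-positive sizes, so the limit may be cut off there\<close>
  show thesis
  proof (rule that[OF \<sigma>, of "\<lambda>t x. g t x * indicator {0<..} x"])
    show "integrable lborel (\<lambda>x. g t x * indicator {0<..} x)" if "0 \<le> t" for t
      by (rule integrable_bounded_mult[OF g(1)[OF that], where C=1]) (auto simp: indicator_def)
    fix t :: real and \<phi> D assume t: "0 \<le> t" and \<phi>: "\<phi> \<in> borel_measurable borel" "\<And>x::real. \<bar>\<phi> x\<bar> \<le> (D::real)"
    have "(\<lambda>n. \<integral>x. U (\<sigma> n) t x * (indicator {0<..} x * \<phi> x) \<partial>lborel) \<longlonglongrightarrow> (\<integral>x. g t x * (indicator {0<..} x * \<phi> x) \<partial>lborel)"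
    proof (rule glim[OF t])
      have "0 \<le> D" using \<phi>(2)[of 0] by linarith
      then show "\<bar>indicator {0<..} x * \<phi> x\<bar> \<le> D" for x using \<phi>(2)[of x] by (auto simp: indicator_def)
    qed (use \<phi> in measurable)
    moreover have "(\<integral>x. U (\<sigma> n) t x * (indicator {0<..} x * \<phi> x) \<partial>lborel) = (\<integral>x. U (\<sigma> n) t x * \<phi> x \<partial>lborel)" for n
      using U_support[of _ "\<sigma> n" t] by (intro Bochner_Integration.integral_cong) (auto simp: indicator_def not_less)
    ultimately show "(\<lambda>n. \<integral>x. U (\<sigma> n) t x * \<phi> x \<partial>lborel) \<longlonglongrightarrow> (\<integral>x. g t x * indicator {0<..} x * \<phi> x \<partial>lborel)"
      by (simp add: mult.assoc)
  qed (use g in auto)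
qed

end

section \<open>The collision functional in the limit\<close>

text \<open>
The sequence together with a weak limit at every time.
\<close>

locale rbk_limit = rbk_sequence +
  fixes g :: "real \<Rightarrow> real \<Rightarrow> real"
  assumes g_integrable: "\<And>t. 0 \<le> t \<Longrightarrow> integrable lborel (g t)"
    and g_nonneg: "\<And>t x. 0 \<le> t \<Longrightarrow> 0 \<le> g t x"
    and g_support: "\<And>t x. 0 \<le> t \<Longrightarrow> x \<le> 0 \<Longrightarrow> g t x = 0"
    and g_lim: "\<And>t \<phi> D. 0 \<le> t \<Longrightarrow> \<phi> \<in> borel_measurable borel \<Longrightarrow> (\<And>x. \<bar>\<phi> x\<bar> \<le> D) \<Longrightarrow>
       (\<lambda>n. \<integral>x. U n t x * \<phi> x \<partial>lborel) \<longlonglongrightarrow> (\<integral>x. g t x * \<phi> x \<partial>lborel)"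
begin

lemma g_measurable: "0 \<le> t \<Longrightarrow> g t \<in> borel_measurable borel"
  using g_integrable[of t] by auto

lemma g_weighted_nonneg: "0 \<le> t \<Longrightarrow> 0 \<le> (1 + x) * g t x"
  using g_nonneg[of t x] g_support[of t x] by (cases "x \<le> 0") auto

text \<open>
The weight \<open>1 + x\<close> is unbounded; its truncations pass to the weak limit and increase to it.
\<close>

lemma g_moment:
  assumes t: "0 \<le> t"
  shows "integrable lborel (\<lambda>x. (1 + x) * g t x)" "(\<integral>x. (1 + x) * g t x \<partial>lborel) \<le> B"
proof -
  have [measurable]: "g t \<in> borel_measurable borel" by (rule g_measurable[OF t])
  define w where "w = (\<lambda>(k::nat) x. (1 + x) * indicator {0..real k} x)"
  have w: "\<bar>w k x\<bar> \<le> 1 + real k" for k x by (auto simp: w_def indicator_def)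
  have wm: "w k \<in> borel_measurable borel" for k unfolding w_def by measurable
  have le: "(\<integral>x. g t x * w k x \<partial>lborel) \<le> B" for k
  proof (rule LIMSEQ_le_const2[OF g_lim[OF t wm w]], intro exI[of _ 0] allI impI)
    fix n
    interpret shifted_rbk "\<kappa> n" "\<tau> n" "d n" C B "U n" by (rule approx)
    have "(\<integral>x. U n t x * w k x \<partial>lborel) \<le> (\<integral>x. (1 + x) * U n t x \<partial>lborel)"
    proof (rule integral_mono[OF integrable_bounded_mult[OF U_integrable _ w] moment_integrable])
      show "U n t x * w k x \<le> (1 + x) * U n t x" for x
        using weighted_nonneg[of x t] by (auto simp: w_def indicator_def)
    qed (use wm in simp)
    also have "\<dots> \<le> B" by (rule moment_le)
    finally show "(\<integral>x. U n t x * w k x \<partial>lborel) \<le> B" .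
  qed
  have gi: "integrable lborel (\<lambda>x. g t x * w k x)" for k
    by (rule integrable_bounded_mult[OF g_integrable[OF t] _ w]) (use wm in simp)
  have "(\<integral>\<^sup>+x. ennreal ((1 + x) * g t x) \<partial>lborel) \<le> ennreal B"
  proof -
    have "(\<integral>\<^sup>+x. ennreal ((1 + x) * g t x) \<partial>lborel) = (\<integral>\<^sup>+x. (SUP k. ennreal (g t x * w k x)) \<partial>lborel)"
    proof (rule nn_integral_cong)
      fix x
      have "mono (\<lambda>k. ennreal (g t x * w k x))"
        using g_nonneg[OF t, of x] by (intro monoI ennreal_leI mult_left_mono) (auto simp: w_def indicator_def)
      moreover have "(\<lambda>k. ennreal (g t x * w k x)) \<longlonglongrightarrow> ennreal ((1 + x) * g t x)"
      proof (cases "x \<le> 0")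
        case True then show ?thesis using g_support[OF t] by simp
      next
        case False
        obtain N :: nat where N: "x < real N" using reals_Archimedean2 by blast
        have "w k x = 1 + x" if "N \<le> k" for k
        proof -
          have "real N \<le> real k" using that by simp
          then show ?thesis using N False by (simp add: w_def)
        qed
        then show ?thesis by (intro tendsto_eventually eventually_sequentiallyI[of N]) (simp add: mult.commute)
      qed
      ultimately show "ennreal ((1 + x) * g t x) = (SUP k. ennreal (g t x * w k x))"
        using LIMSEQ_SUP[of "\<lambda>k. ennreal (g t x * w k x)"] LIMSEQ_unique by blast
    qed
    also have "\<dots> = (SUP k. \<integral>\<^sup>+x. ennreal (g t x * w k x) \<partial>lborel)"
    proof (rule nn_integral_monotone_convergence_SUP)
      show "incseq (\<lambda>k x. ennreal (g t x * w k x))"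
        using g_nonneg[OF t] by (intro incseq_SucI le_funI ennreal_leI mult_left_mono) (auto simp: w_def indicator_def)
    qed (use wm in measurable)
    also have "\<dots> \<le> ennreal B"
    proof (rule SUP_least)
      fix k
      have "0 \<le> g t x * w k x" for x using g_nonneg[OF t, of x] by (auto simp: w_def indicator_def)
      then have "(\<integral>\<^sup>+x. ennreal (g t x * w k x) \<partial>lborel) = ennreal (\<integral>x. g t x * w k x \<partial>lborel)"
        by (intro nn_integral_eq_integral gi) simp
      also have "\<dots> \<le> ennreal B" by (intro ennreal_leI le)
      finally show "(\<integral>\<^sup>+x. ennreal (g t x * w k x) \<partial>lborel) \<le> ennreal B" .
    qed
    finally show ?thesis .
  qed
  note nn = this
  show i: "integrable lborel (\<lambda>x. (1 + x) * g t x)"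
    by (rule integrableI_nonneg) (use nn g_weighted_nonneg[OF t] in \<open>auto simp: le_less_trans\<close>)
  have "ennreal (\<integral>x. (1 + x) * g t x \<partial>lborel) \<le> ennreal B"
    using nn nn_integral_eq_integral[OF i] g_weighted_nonneg[OF t] by simp
  then show "(\<integral>x. (1 + x) * g t x \<partial>lborel) \<le> B" using B_nonneg by (simp add: ennreal_le_iff)
qed

text \<open>
Cutting off makes the kernel a measurable function on the whole plane, as a pointwise limit of the
approximate kernels.
\<close>

definition quadrant_kernel :: "real \<times> real \<Rightarrow> real" where
  "quadrant_kernel z = indicator ({0<..} \<times> {0<..}) z * K (fst z) (snd z)"

lemma kernel_measurable_n: "(\<lambda>z. \<kappa> n (fst z) (snd z)) \<in> borel_measurable (borel \<Otimes>\<^sub>M borel)"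
  by (rule shifted_rbk.kernel_measurable[OF approx])

lemma quadrant_sets [measurable]: "{0<..} \<times> {0<..} \<in> sets (borel \<Otimes>\<^sub>M (borel :: real measure) :: (real \<times> real) measure)"
  by simp

lemma quadrant_kernel_lim: "(\<lambda>n. indicator ({0<..} \<times> {0<..}) z * \<kappa> n (fst z) (snd z)) \<longlonglongrightarrow> quadrant_kernel z"
proof (cases "z \<in> {0<..} \<times> {0<..}")
  case True
  then have "0 < fst z" "0 < snd z" by auto
  then show ?thesis unfolding quadrant_kernel_def by (intro tendsto_mult_left kernel_lim)
qed (simp add: quadrant_kernel_def)

lemma quadrant_kernel_measurable [measurable]: "quadrant_kernel \<in> borel_measurable (borel \<Otimes>\<^sub>M borel)"
proof (rule borel_measurable_LIMSEQ_real[OF quadrant_kernel_lim])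
  show "(\<lambda>z. indicator ({0<..} \<times> {0<..}) z * \<kappa> n (fst z) (snd z)) \<in> borel_measurable (borel \<Otimes>\<^sub>M borel)" for n
    using kernel_measurable_n[of n] by measurable
qed

lemma quadrant_kernel_nonneg: "0 \<le> quadrant_kernel z"
proof (rule LIMSEQ_le_const[OF quadrant_kernel_lim])
  show "\<exists>N. \<forall>n\<ge>N. 0 \<le> indicator ({0<..} \<times> {0<..}) z * \<kappa> n (fst z) (snd z)"
    using shifted_rbk.kernel_nonneg[OF approx] by simp
qed

lemma quadrant_kernel_le_limit:
  assumes "\<And>n. 0 < fst z \<Longrightarrow> 0 < snd z \<Longrightarrow> \<kappa> n (fst z) (snd z) \<le> c" "0 \<le> c"
  shows "quadrant_kernel z \<le> c"
proof (rule LIMSEQ_le_const2[OF quadrant_kernel_lim])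
  show "\<exists>N. \<forall>n\<ge>N. indicator ({0<..} \<times> {0<..}) z * \<kappa> n (fst z) (snd z) \<le> c"
    using assms by (auto simp: indicator_def mem_Times_iff)
qed

definition g_pair :: "real \<Rightarrow> real \<times> real \<Rightarrow> real" where
  "g_pair s z = g s (fst z) * g s (snd z)"

definition weights :: "(real \<Rightarrow> real) \<Rightarrow> real \<times> real \<Rightarrow> real" where
  "weights v z = ((1 + fst z) * v (fst z)) * ((1 + snd z) * v (snd z))"

lemma g_pair_nonneg: "0 \<le> s \<Longrightarrow> 0 \<le> g_pair s z" by (simp add: g_pair_def g_nonneg)

lemma g_pair_integrable: "0 \<le> s \<Longrightarrow> integrable plane (g_pair s)"
  unfolding g_pair_def by (intro tensor_integrable g_integrable)

lemma g_pair_eq_0: "0 \<le> s \<Longrightarrow> \<not> (0 < fst z \<and> 0 < snd z) \<Longrightarrow> g_pair s z = 0"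
  by (auto simp: g_pair_def g_support not_less)

lemma g_pair_le_weights:
  assumes "0 \<le> s" "0 \<le> c" "0 < fst z \<Longrightarrow> 0 < snd z \<Longrightarrow> quadrant_kernel z \<le> c * (1 + fst z) * (1 + snd z)"
  shows "g_pair s z * quadrant_kernel z \<le> c * weights (g s) z"
proof (cases "0 < fst z \<and> 0 < snd z")
  case True
  then have "g_pair s z * quadrant_kernel z \<le> g_pair s z * (c * (1 + fst z) * (1 + snd z))"
    using assms g_pair_nonneg by (intro mult_left_mono) auto
  then show ?thesis by (simp add: g_pair_def weights_def mult_ac)
next
  case False
  then show ?thesis using assms g_weighted_nonneg by (simp add: g_pair_eq_0 weights_def)
qed

lemma weights_g:
  assumes "0 \<le> s"
  shows "integrable plane (weights (g s))" "(\<integral>z. weights (g s) z \<partial>plane) \<le> B\<^sup>2"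
proof -
  note i = g_moment(1)[OF assms]
  show "integrable plane (weights (g s))" unfolding weights_def by (rule tensor_integrable(1)[OF i i])
  have "(\<integral>z. weights (g s) z \<partial>plane) = (\<integral>x. (1 + x) * g s x \<partial>lborel) * (\<integral>x. (1 + x) * g s x \<partial>lborel)"
    unfolding weights_def by (rule tensor_integrable(2)[OF i i])
  also have "\<dots> \<le> B * B"
    by (intro mult_mono g_moment(2)[OF assms] B_nonneg integral_nonneg_AE AE_I2 g_weighted_nonneg[OF assms])
  finally show "(\<integral>z. weights (g s) z \<partial>plane) \<le> B\<^sup>2" by (simp add: power2_eq_square)
qed

lemma weights_U:
  "integrable plane (weights (U n s))" "(\<integral>z. weights (U n s) z \<partial>plane) \<le> B\<^sup>2"
proof -
  interpret shifted_rbk "\<kappa> n" "\<tau> n" "d n" C B "U n" by (rule approx)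
  note i = moment_integrable
  show "integrable plane (weights (U n s))" unfolding weights_def by (rule tensor_integrable(1)[OF i i])
  have "(\<integral>z. weights (U n s) z \<partial>plane) = (\<integral>x. (1 + x) * U n s x \<partial>lborel) * (\<integral>x. (1 + x) * U n s x \<partial>lborel)"
    unfolding weights_def by (rule tensor_integrable(2)[OF i i])
  also have "\<dots> \<le> B * B"
    by (intro mult_mono moment_le B_nonneg integral_nonneg_AE AE_I2 weighted_nonneg)
  finally show "(\<integral>z. weights (U n s) z \<partial>plane) \<le> B\<^sup>2" by (simp add: power2_eq_square)
qed

definition limit_collisions :: "real \<Rightarrow> real \<times> real \<Rightarrow> real" where
  "limit_collisions s z = g_pair s z * quadrant_kernel z"

lemma limit_collisions_nonneg: "0 \<le> s \<Longrightarrow> 0 \<le> limit_collisions s z"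
  by (simp add: limit_collisions_def g_pair_nonneg quadrant_kernel_nonneg)

lemma g_pair_measurable: "0 \<le> s \<Longrightarrow> g_pair s \<in> borel_measurable (borel \<Otimes>\<^sub>M borel)"
  using g_pair_integrable[of s] borel_measurable_integrable by force

lemma limit_collisions_integrable:
  assumes s: "0 \<le> s"
  shows "integrable plane (limit_collisions s)"
    "(\<integral>z. limit_collisions s z \<partial>plane) \<le> C * B\<^sup>2"
proof -
  have le: "limit_collisions s z \<le> C * weights (g s) z" for z
    unfolding limit_collisions_def
    by (intro g_pair_le_weights s C_nonneg quadrant_kernel_le_limit shifted_rbk.kernel_le[OF approx]) (auto simp: C_nonneg)
  have [measurable]: "g_pair s \<in> borel_measurable (borel \<Otimes>\<^sub>M borel)" by (rule g_pair_measurable[OF s])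
  have "limit_collisions s \<in> borel_measurable plane" unfolding limit_collisions_def by measurable
  then show i: "integrable plane (limit_collisions s)"
    by (rule integrable_between[OF integrable_mult_right[OF weights_g(1)[OF s]] _ limit_collisions_nonneg[OF s] le])
  have "(\<integral>z. limit_collisions s z \<partial>plane) \<le> (\<integral>z. C * weights (g s) z \<partial>plane)"
    by (intro integral_mono i le integrable_mult_right weights_g s)
  also have "\<dots> \<le> C * B\<^sup>2" using weights_g(2)[OF s] C_nonneg by (simp add: mult_left_mono)
  finally show "(\<integral>z. limit_collisions s z \<partial>plane) \<le> C * B\<^sup>2" .
qed

abbreviation "approx_collisions n \<equiv> shifted_rbk.collisions (\<kappa> n) (U n)"

lemma approx_collisions_alt: "approx_collisions n s z = U n s (fst z) * U n s (snd z) * \<kappa> n (fst z) (snd z)"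
  using shifted_rbk.collisions_def[OF approx] by (simp add: mult_ac)

lemma approx_collisions_le_weights:
  assumes "0 \<le> c" "0 < fst z \<Longrightarrow> 0 < snd z \<Longrightarrow> \<kappa> n (fst z) (snd z) \<le> c * (1 + fst z) * (1 + snd z)"
  shows "approx_collisions n s z \<le> c * weights (U n s) z"
proof (cases "0 < fst z \<and> 0 < snd z")
  case True
  then have "U n s (fst z) * U n s (snd z) * \<kappa> n (fst z) (snd z) \<le> U n s (fst z) * U n s (snd z) * (c * (1 + fst z) * (1 + snd z))"
    using assms U_nonneg by (intro mult_left_mono) auto
  then show ?thesis unfolding approx_collisions_alt by (simp add: weights_def mult_ac)
next
  case False
  then have "U n s (fst z) * U n s (snd z) = 0" using U_support[of _ n s] by (auto simp: not_less)
  then have "approx_collisions n s z = 0" unfolding approx_collisions_alt by simp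
  moreover have "0 \<le> c * weights (U n s) z"
    unfolding weights_def by (intro mult_nonneg_nonneg assms(1) shifted_rbk.weighted_nonneg[OF approx])
  ultimately show ?thesis by simp
qed

text \<open>
Inside a large square the weighted kernels are bounded and converge almost everywhere, while the
tensor squares converge weakly and are equi-integrable, so the products converge. Outside the
square sublinear growth bounds the kernels by \<open>\<eta> * (1 + x) * (1 + y)\<close>, and the first moments bound
the rest by \<open>\<eta> * B\<^sup>2\<close>, for the sequence as well as for its limit.
\<close>

lemma collision_limit:
  fixes w :: "nat \<Rightarrow> real \<times> real \<Rightarrow> real" and v :: "real \<times> real \<Rightarrow> real"
  assumes s: "0 \<le> s"
    and wm: "\<And>n. w n \<in> borel_measurable (borel \<Otimes>\<^sub>M borel)" and vm: "v \<in> borel_measurable (borel \<Otimes>\<^sub>M borel)"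
    and wb: "\<And>n z. \<bar>w n z\<bar> \<le> 2" and vb: "\<And>z. \<bar>v z\<bar> \<le> 2"
    and lim: "AE z in plane. 0 < fst z \<longrightarrow> 0 < snd z \<longrightarrow> (\<lambda>n. w n z) \<longlonglongrightarrow> v z"
  shows "(\<lambda>n. \<integral>z. approx_collisions n s z * w n z \<partial>plane) \<longlonglongrightarrow> (\<integral>z. limit_collisions s z * v z \<partial>plane)"
proof (rule LIMSEQ_I)
    fix r :: real assume r: "0 < r"
  \<comment> \<open>both tails then contribute at most \<open>r / 8\<close>\<close>
  define \<eta> where "\<eta> = r / (16 * (B\<^sup>2 + 1))"
  have eta: "0 < \<eta>" "2 * (\<eta> * B\<^sup>2) \<le> r / 8"
  proof -
    have "0 < B\<^sup>2 + 1" by (simp add: add_nonneg_pos)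
    then show "0 < \<eta>" using r by (simp add: \<eta>_def)
    have "\<eta> * B\<^sup>2 \<le> \<eta> * (B\<^sup>2 + 1)" using \<open>0 < \<eta>\<close> by (intro mult_left_mono) auto
    also have "\<dots> = r / 16"
    proof -
      have "r / (16 * c) * c = r / 16" if "0 < c" for c using that by simp
      then show ?thesis using \<open>0 < B\<^sup>2 + 1\<close> unfolding \<eta>_def by blast
    qed
    finally show "2 * (\<eta> * B\<^sup>2) \<le> r / 8" by simp
  qed
  obtain R where R: "1 \<le> R" "\<And>n x y. 0 < x \<Longrightarrow> 0 < y \<Longrightarrow> R \<le> x \<or> R \<le> y \<Longrightarrow> \<kappa> n x y \<le> \<eta> * (1 + x) * (1 + y)"
    using sublinear[OF eta(1)] by blast
  define Q where "Q = ({0<..<R} \<times> {0<..<R} :: (real \<times> real) set)"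
  have Qm[measurable]: "Q \<in> sets (borel \<Otimes>\<^sub>M borel)" unfolding Q_def by simp
  define V where "V = (\<lambda>n z. U n s (fst z) * U n s (snd z))"
  have EI: "equi_integrable plane V" unfolding V_def
    by (rule equi_integrable_tensor[OF equi_integrable_at[OF s] U_integral_le])
  define \<psi> where "\<psi> = (\<lambda>n z. indicator Q z * \<kappa> n (fst z) (snd z) * w n z)"
  define \<theta> where "\<theta> = (\<lambda>z. indicator Q z * quadrant_kernel z * v z)"
  define D where "D = C * (1 + R) * (1 + R) * 2"
  have \<psi>m: "\<psi> n \<in> borel_measurable plane" for n unfolding \<psi>_def using kernel_measurable_n[of n] wm by measurable
  have \<theta>m: "\<theta> \<in> borel_measurable plane" unfolding \<theta>_def using vm by measurable
  have kb: "\<kappa> n (fst z) (snd z) \<le> C * (1 + R) * (1 + R)" if "z \<in> Q" for n z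
  proof -
    have z: "0 < fst z" "0 < snd z" "fst z < R" "snd z < R" using that by (auto simp: Q_def)
    have "\<kappa> n (fst z) (snd z) \<le> C * (1 + fst z) * (1 + snd z)" using z by (intro shifted_rbk.kernel_le[OF approx])
    also have "\<dots> \<le> C * (1 + R) * (1 + R)" using z C_nonneg by (intro mult_mono) auto
    finally show ?thesis .
  qed
  have D0: "0 \<le> C * (1 + R) * (1 + R)" using C_nonneg R by simp
  have \<psi>b: "\<bar>\<psi> n z\<bar> \<le> D" for n z
  proof (cases "z \<in> Q")
    case True
    have "\<bar>\<kappa> n (fst z) (snd z)\<bar> * \<bar>w n z\<bar> \<le> (C * (1 + R) * (1 + R)) * 2"
      using kb[OF True, of n] shifted_rbk.kernel_nonneg[OF approx, of n] wb D0 by (intro mult_mono) auto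
    then show ?thesis using True by (simp add: \<psi>_def D_def abs_mult)
  qed (use D0 in \<open>simp add: \<psi>_def D_def\<close>)
  have \<theta>b: "\<bar>\<theta> z\<bar> \<le> D" for z
  proof (cases "z \<in> Q")
    case True
    have "quadrant_kernel z \<le> C * (1 + R) * (1 + R)" by (rule quadrant_kernel_le_limit) (use kb[OF True] D0 in auto)
    then have "\<bar>quadrant_kernel z\<bar> * \<bar>v z\<bar> \<le> (C * (1 + R) * (1 + R)) * 2"
      using quadrant_kernel_nonneg[of z] vb D0 by (intro mult_mono) auto
    then show ?thesis using True by (simp add: \<theta>_def D_def abs_mult)
  qed (use D0 in \<open>simp add: \<theta>_def D_def\<close>)
  have ae: "AE z in plane. (\<lambda>n. \<psi> n z) \<longlonglongrightarrow> \<theta> z"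
    using lim
  proof eventually_elim
    case (elim z)
    show ?case
    proof (cases "z \<in> Q")
      case True
      then have z: "0 < fst z" "0 < snd z" by (auto simp: Q_def)
      then have "z \<in> {0<..} \<times> {0<..}" by (simp add: mem_Times_iff)
      then have "(\<lambda>n. \<kappa> n (fst z) (snd z)) \<longlonglongrightarrow> quadrant_kernel z" using kernel_lim[OF z] by (simp add: quadrant_kernel_def)
      then have "(\<lambda>n. \<kappa> n (fst z) (snd z) * w n z) \<longlonglongrightarrow> quadrant_kernel z * v z" using elim z by (intro tendsto_mult) auto
      then show ?thesis using True by (simp add: \<psi>_def \<theta>_def)
    qed (simp add: \<psi>_def \<theta>_def)
  qed
  have "(\<lambda>n. (\<integral>z. V n z * \<psi> n z \<partial>plane) - (\<integral>z. V n z * \<theta> z \<partial>plane)) \<longlonglongrightarrow> 0"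
    by (rule equi_integrable_bounded_convergence_diagonal[OF EI \<psi>m \<theta>m \<psi>b \<theta>b ae])
  moreover have "(\<lambda>n. \<integral>z. V n z * \<theta> z \<partial>plane) \<longlonglongrightarrow> (\<integral>z. g_pair s z * \<theta> z \<partial>plane)"
    unfolding V_def g_pair_def
    by (rule tensor_weak_convergence[OF equi_integrable_at[OF s] U_integral_le g_integrable[OF s] g_nonneg[OF s] g_lim[OF s] \<theta>m \<theta>b])
  ultimately have "(\<lambda>n. (\<integral>z. V n z * \<psi> n z \<partial>plane) - (\<integral>z. V n z * \<theta> z \<partial>plane) + (\<integral>z. V n z * \<theta> z \<partial>plane)) \<longlonglongrightarrow> 0 + (\<integral>z. g_pair s z * \<theta> z \<partial>plane)"
    by (rule tendsto_add)
  then have inner: "(\<lambda>n. \<integral>z. V n z * \<psi> n z \<partial>plane) \<longlonglongrightarrow> (\<integral>z. g_pair s z * \<theta> z \<partial>plane)" by simp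
  have tail: "\<bar>(\<integral>z. H z * p z \<partial>plane) - (\<integral>z. H z * (indicator Q z * p z) \<partial>plane)\<bar> \<le> r / 8"
    if H: "integrable plane H" "\<And>z. 0 \<le> H z" and W: "integrable plane W" "(\<integral>z. W z \<partial>plane) \<le> B\<^sup>2" "\<And>z. 0 \<le> W z"
      and HW: "\<And>z. z \<notin> Q \<Longrightarrow> H z \<le> \<eta> * W z" and p: "p \<in> borel_measurable (borel \<Otimes>\<^sub>M borel)" "\<And>z. \<bar>p z\<bar> \<le> 2"
    for H W p :: "real \<times> real \<Rightarrow> real"
  proof -
    have pm: "p \<in> borel_measurable plane" using p by simp
    have qm: "(\<lambda>z. indicator Q z * p z) \<in> borel_measurable plane" using p by measurable
    have qb: "\<bar>indicator Q z * p z\<bar> \<le> 2" for z using p(2)[of z] by (auto simp: indicator_def)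
    have i1: "integrable plane (\<lambda>z. H z * p z)" by (rule integrable_bounded_mult[OF H(1) pm p(2)])
    have i2: "integrable plane (\<lambda>z. H z * (indicator Q z * p z))" by (rule integrable_bounded_mult[OF H(1) qm qb])
    have "\<bar>(\<integral>z. H z * p z \<partial>plane) - (\<integral>z. H z * (indicator Q z * p z) \<partial>plane)\<bar>
       = \<bar>\<integral>z. H z * p z - H z * (indicator Q z * p z) \<partial>plane\<bar>" using i1 i2 by simp
    also have "\<dots> \<le> (\<integral>z. \<bar>H z * p z - H z * (indicator Q z * p z)\<bar> \<partial>plane)" by (rule integral_abs_bound)
    also have "\<dots> \<le> (\<integral>z. 2 * (\<eta> * W z) \<partial>plane)"
    proof (rule integral_mono)
      show "integrable plane (\<lambda>z. \<bar>H z * p z - H z * (indicator Q z * p z)\<bar>)"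
        by (intro integrable_abs Bochner_Integration.integrable_diff i1 i2)
      show "integrable plane (\<lambda>z. 2 * (\<eta> * W z))" using W by simp
      fix z
      show "\<bar>H z * p z - H z * (indicator Q z * p z)\<bar> \<le> 2 * (\<eta> * W z)"
      proof (cases "z \<in> Q")
        case True then show ?thesis using W(3)[of z] eta by simp
      next
        case False
        have "\<bar>H z * p z\<bar> \<le> (\<eta> * W z) * 2"
          unfolding abs_mult using HW[OF False] H(2)[of z] p(2)[of z] W(3)[of z] eta by (intro mult_mono) auto
        then show ?thesis using False by simp
      qed
    qed
    also have "\<dots> = 2 * (\<eta> * (\<integral>z. W z \<partial>plane))" by simp
    also have "\<dots> \<le> 2 * (\<eta> * B\<^sup>2)" using W(2) eta by (intro mult_left_mono) auto
    finally show ?thesis using eta by linarith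
  qed
  have Rz: "R \<le> fst z \<or> R \<le> snd z" if "z \<notin> Q" "0 < fst z" "0 < snd z" for z :: "real \<times> real"
    using that by (cases z) (auto simp: Q_def)
  have t1: "\<bar>(\<integral>z. approx_collisions n s z * w n z \<partial>plane) - (\<integral>z. approx_collisions n s z * (indicator Q z * w n z) \<partial>plane)\<bar> \<le> r / 8" for n
  proof (rule tail[OF shifted_rbk.collisions_integrable[OF approx] shifted_rbk.collisions_nonneg[OF approx] weights_U _ _ wm wb])
    show "0 \<le> weights (U n s) z" for z using shifted_rbk.weighted_nonneg[OF approx, of _ n s] by (simp add: weights_def)
    show "approx_collisions n s z \<le> \<eta> * weights (U n s) z" if "z \<notin> Q" for z
      using eta Rz[OF that] by (intro approx_collisions_le_weights R(2)) auto
  qed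
  have t2: "\<bar>(\<integral>z. limit_collisions s z * v z \<partial>plane) - (\<integral>z. limit_collisions s z * (indicator Q z * v z) \<partial>plane)\<bar> \<le> r / 8"
  proof (rule tail[OF limit_collisions_integrable(1)[OF s] limit_collisions_nonneg[OF s] weights_g[OF s] _ _ vm vb])
    show "0 \<le> weights (g s) z" for z using g_weighted_nonneg[OF s] by (simp add: weights_def)
    show "limit_collisions s z \<le> \<eta> * weights (g s) z" if z: "z \<notin> Q" for z
      unfolding limit_collisions_def
    proof (rule g_pair_le_weights[OF s])
      assume p: "0 < fst z" "0 < snd z"
      show "quadrant_kernel z \<le> \<eta> * (1 + fst z) * (1 + snd z)"
        by (rule quadrant_kernel_le_limit) (use R(2)[OF p Rz[OF z p]] p eta in auto)
    qed (use eta in simp)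
  qed
  have e1: "(\<integral>z. approx_collisions n s z * (indicator Q z * w n z) \<partial>plane) = (\<integral>z. V n z * \<psi> n z \<partial>plane)" for n
    by (simp add: approx_collisions_alt V_def \<psi>_def mult_ac)
  have e2: "(\<integral>z. limit_collisions s z * (indicator Q z * v z) \<partial>plane) = (\<integral>z. g_pair s z * \<theta> z \<partial>plane)"
    by (simp add: limit_collisions_def \<theta>_def mult_ac)
  obtain n0 where n0: "\<And>n. n0 \<le> n \<Longrightarrow> norm ((\<integral>z. V n z * \<psi> n z \<partial>plane) - (\<integral>z. g_pair s z * \<theta> z \<partial>plane)) < r / 2"
    using LIMSEQ_D[OF inner, of "r/2"] r by auto
  have "norm ((\<integral>z. approx_collisions n s z * w n z \<partial>plane) - (\<integral>z. limit_collisions s z * v z \<partial>plane)) < r" if "n0 \<le> n" for n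
    using n0[OF that] t1[of n] t2 r unfolding e1 e2 real_norm_def by linarith
  then show "\<exists>n0. \<forall>n\<ge>n0. norm ((\<integral>z. approx_collisions n s z * w n z \<partial>plane) - (\<integral>z. limit_collisions s z * v z \<partial>plane)) < r" by blast
qed

end

section \<open>The weak formulation of the limit\<close>

context rbk_limit
begin

lemma g_lipschitz:
  assumes "0 \<le> s" "s \<le> t" "\<phi> \<in> borel_measurable borel" "\<And>x. \<bar>\<phi> x\<bar> \<le> D"
  shows "\<bar>(\<integral>x. g t x * \<phi> x \<partial>lborel) - (\<integral>x. g s x * \<phi> x \<partial>lborel)\<bar> \<le> 2 * D * (C * B\<^sup>2) * (t - s)"
proof (rule LIMSEQ_le_const2)
  show "(\<lambda>n. \<bar>(\<integral>x. U n t x * \<phi> x \<partial>lborel) - (\<integral>x. U n s x * \<phi> x \<partial>lborel)\<bar>) \<longlonglongrightarrow>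
     \<bar>(\<integral>x. g t x * \<phi> x \<partial>lborel) - (\<integral>x. g s x * \<phi> x \<partial>lborel)\<bar>"
    using assms by (intro tendsto_rabs tendsto_diff g_lim) auto
  show "\<exists>N. \<forall>n\<ge>N. \<bar>(\<integral>x. U n t x * \<phi> x \<partial>lborel) - (\<integral>x. U n s x * \<phi> x \<partial>lborel)\<bar> \<le> 2 * D * (C * B\<^sup>2) * (t - s)"
    using U_lipschitz[OF assms] by blast
qed

text \<open>
The sign of the difference is an admissible test function, so the weak Lipschitz estimate is
already one in \<open>L\<^sup>1\<close>. This provides the strong continuity in time.
\<close>

lemma g_L1_lipschitz:
  assumes s: "0 \<le> s" and st: "s \<le> t"
  shows "(\<integral>x. \<bar>g t x - g s x\<bar> \<partial>lborel) \<le> 2 * (C * B\<^sup>2) * (t - s)"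
proof -
  have t: "0 \<le> t" using s st by simp
  have [measurable]: "g t \<in> borel_measurable borel" "g s \<in> borel_measurable borel" using g_measurable s t by auto
  define p where "p = (\<lambda>x. sgn (g t x - g s x))"
  have pm: "p \<in> borel_measurable borel" unfolding p_def by measurable
  have pb: "\<bar>p x\<bar> \<le> 1" for x by (simp add: p_def sgn_if)
  have i: "integrable lborel (\<lambda>x. g r x * p x)" if "0 \<le> r" for r
    by (rule integrable_bounded_mult[OF g_integrable[OF that] _ pb]) (use pm in simp)
  have "(\<integral>x. \<bar>g t x - g s x\<bar> \<partial>lborel) = (\<integral>x. g t x * p x - g s x * p x \<partial>lborel)"
    by (simp add: p_def abs_sgn left_diff_distrib[symmetric])
  also have "\<dots> = (\<integral>x. g t x * p x \<partial>lborel) - (\<integral>x. g s x * p x \<partial>lborel)"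
    using i s t by simp
  also have "\<dots> \<le> 2 * 1 * (C * B\<^sup>2) * (t - s)" using g_lipschitz[OF s st pm pb] by (simp add: abs_le_iff)
  finally show ?thesis by simp
qed

lemma weak_convergence_uniform:
  assumes \<phi>: "\<phi> \<in> borel_measurable borel" "\<And>x. \<bar>\<phi> x\<bar> \<le> D" and e: "0 < e"
  shows "\<exists>n0. \<forall>n\<ge>n0. \<forall>t\<in>{0..T}. \<bar>(\<integral>x. U n t x * \<phi> x \<partial>lborel) - (\<integral>x. g t x * \<phi> x \<partial>lborel)\<bar> \<le> e"
proof (rule equilipschitz_uniform_convergence[OF _ _ e])
  show "(\<lambda>n. (\<integral>x. U n t x * \<phi> x \<partial>lborel) - (\<integral>x. g t x * \<phi> x \<partial>lborel)) \<longlonglongrightarrow> 0" if "0 \<le> t" for t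
    using g_lim[OF that \<phi>] by (simp add: LIM_zero)
  fix n s t assume st: "0 \<le> s" "s \<le> (t::real)"
  show "\<bar>((\<integral>x. U n t x * \<phi> x \<partial>lborel) - (\<integral>x. g t x * \<phi> x \<partial>lborel)) - ((\<integral>x. U n s x * \<phi> x \<partial>lborel) - (\<integral>x. g s x * \<phi> x \<partial>lborel))\<bar>
    \<le> (4 * D * (C * B\<^sup>2)) * (t - s)"
    using U_lipschitz[OF st \<phi>, of n] g_lipschitz[OF st \<phi>] by linarith
qed

text \<open>
The time derivative of \<open>\<integral> g s x * \<phi> x\<close>, written over ordered pairs of the quadrant.
\<close>

definition limit_rate :: "(real \<Rightarrow> real) \<Rightarrow> real \<Rightarrow> real" where
  "limit_rate \<phi> s = (\<integral>z. limit_collisions s z * limit_test \<phi> z \<partial>plane)"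

lemma limit_rate_bound:
  assumes "0 \<le> s" "\<phi> \<in> borel_measurable borel" "\<And>x. \<bar>\<phi> x\<bar> \<le> D"
  shows "\<bar>limit_rate \<phi> s\<bar> \<le> 2 * D * (C * B\<^sup>2)"
proof -
  have "\<bar>limit_rate \<phi> s\<bar> \<le> 2 * D * (\<integral>z. limit_collisions s z \<partial>plane)"
    unfolding limit_rate_def
    by (rule integral_bounded_mult_le[OF limit_collisions_integrable(1)[OF assms(1)] _ limit_test_bounded[OF assms(3)] limit_collisions_nonneg[OF assms(1)]])
      (use limit_test_measurable[OF assms(2)] in simp)
  also have "\<dots> \<le> 2 * D * (C * B\<^sup>2)"
    using assms(3)[of 0] by (intro mult_left_mono limit_collisions_integrable(2) assms) auto
  finally show ?thesis .
qed

text \<open>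
For a ray the test function after a rounded collision agrees with the one after an exact collision
as soon as the rounding error is smaller than the distances of \<open>x - y\<close> to \<open>0\<close> and \<open>q\<close>. These
distances are positive off two lines. For a general bounded test function \<open>\<phi> (x - \<tau> y)\<close> need
not converge to \<open>\<phi> (x - y)\<close> at any given point, which is why rays come first.
\<close>

lemma weak_form_ray:
  assumes t: "0 \<le> t" and q: "0 \<le> q"
  defines "\<phi> \<equiv> indicator {q<..}"
  shows "(\<lambda>s. indicator {0..t} s * limit_rate \<phi> s) \<in> borel_measurable borel"
    and "(\<integral>x. g t x * \<phi> x \<partial>lborel) = (\<integral>x. F x * \<phi> x \<partial>lborel) + (\<integral>s. indicator {0..t} s * limit_rate \<phi> s \<partial>lborel)"
proof -
  have \<phi>m: "\<phi> \<in> borel_measurable borel" and \<phi>b: "\<bar>\<phi> x\<bar> \<le> 1" for x by (auto simp: \<phi>_def indicator_def)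
  define b where "b = (\<lambda>n s. \<integral>z. approx_collisions n s z * shifted_test (\<tau> n) (d n) \<phi> z \<partial>plane)"
  have b_lim: "(\<lambda>n. b n s) \<longlonglongrightarrow> limit_rate \<phi> s" if s: "0 \<le> s" for s
    unfolding b_def limit_rate_def
  proof (rule collision_limit[OF s])
    show "shifted_test (\<tau> n) (d n) \<phi> \<in> borel_measurable (borel \<Otimes>\<^sub>M borel)" for n
      by (rule shifted_rbk.shifted_test_measurable[OF approx \<phi>m])
    show "limit_test \<phi> \<in> borel_measurable (borel \<Otimes>\<^sub>M borel)" using limit_test_measurable[OF \<phi>m] by simp
    show "\<bar>shifted_test (\<tau> n) (d n) \<phi> z\<bar> \<le> 2" for n z
      using shifted_rbk.shifted_test_bounded[OF approx, where p=\<phi> and D=1 and z=z] \<phi>b by simp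
    show "\<bar>limit_test \<phi> z\<bar> \<le> 2" for z using limit_test_bounded[of \<phi> 1 z] \<phi>b by simp
    show "AE z in plane. 0 < fst z \<longrightarrow> 0 < snd z \<longrightarrow> (\<lambda>n. shifted_test (\<tau> n) (d n) \<phi> z) \<longlonglongrightarrow> limit_test \<phi> z"
      using AE_diff_neq[of 0] AE_diff_neq[of q]
    proof eventually_elim
      case (elim z)
      show ?case
      proof (intro impI)
        assume z: "0 < fst z" "0 < snd z"
        \<comment> \<open>half of the distances, as the rounding error and the threshold \<open>d n\<close> add up\<close>
        define m where "m = min (snd z) (min \<bar>fst z - snd z\<bar> \<bar>fst z - snd z - q\<bar>) / 2"
        have "0 < m" using elim z by (simp add: m_def)
        then obtain n0 where n0: "\<And>n. n0 \<le> n \<Longrightarrow> norm (d n - 0) < m" using LIMSEQ_D[OF d_lim] by blast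
        have "shifted_test (\<tau> n) (d n) \<phi> z = limit_test \<phi> z" if n: "n0 \<le> n" for n
        proof -
          have dn: "0 < d n" "d n < m" using shifted_rbk.d_pos[OF approx, of n] n0[OF n] by auto
          have "d n \<le> snd z" using dn by (auto simp: m_def)
          then have c: "\<bar>\<tau> n (snd z) - snd z\<bar> \<le> d n" by (rule shift_close)
          have m: "2 * m \<le> \<bar>fst z - snd z\<bar>" "2 * m \<le> \<bar>fst z - snd z - q\<bar>" by (auto simp: m_def)
          have "d n \<le> fst z - \<tau> n (snd z) \<longleftrightarrow> 0 < fst z - snd z" using c dn m by linarith
          moreover have "q < fst z - \<tau> n (snd z) \<longleftrightarrow> q < fst z - snd z" using c dn m by linarith
          ultimately show ?thesis by (simp add: shifted_test_def limit_test_def \<phi>_def indicator_def)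
        qed
        then show "(\<lambda>n. shifted_test (\<tau> n) (d n) \<phi> z) \<longlonglongrightarrow> limit_test \<phi> z"
          by (intro tendsto_eventually eventually_sequentiallyI)
      qed
    qed
  qed
  have bm: "b n \<in> borel_measurable borel" for n
    unfolding b_def by (rule shifted_rbk.rate_weak_measurable[OF approx \<phi>m \<phi>b])
  have bb: "\<bar>b n s\<bar> \<le> 2 * 1 * (C * B\<^sup>2)" for n s
    unfolding b_def by (rule shifted_rbk.rate_weak_bound[OF approx \<phi>m \<phi>b])
  have lim: "(\<lambda>n. indicator {0..t} s * b n s) \<longlonglongrightarrow> indicator {0..t} s * limit_rate \<phi> s" for s
  proof (cases "0 \<le> s")
    case True then show ?thesis by (intro tendsto_mult_left b_lim)
  qed simp
  show lm: "(\<lambda>s. indicator {0..t} s * limit_rate \<phi> s) \<in> borel_measurable borel"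
  proof (rule borel_measurable_LIMSEQ_real[OF lim])
    show "(\<lambda>s. indicator {0..t} s * b n s) \<in> borel_measurable borel" for n using bm[of n] by measurable
  qed
  have "(\<lambda>n. \<integral>s. indicator {0..t} s * b n s \<partial>lborel) \<longlonglongrightarrow> (\<integral>s. indicator {0..t} s * limit_rate \<phi> s \<partial>lborel)"
  proof (rule integral_dominated_convergence[where w="\<lambda>s. indicator {0..t} s * (2 * 1 * (C * B\<^sup>2))"])
    show "integrable lborel (\<lambda>s. indicator {0..t} s * (2 * 1 * (C * B\<^sup>2)))"
      by (rule integrable_Icc_const)
    show "AE s in lborel. norm (indicator {0..t} s * b n s) \<le> indicator {0..t} s * (2 * 1 * (C * B\<^sup>2))" for n
      using bb by (intro AE_I2) (simp add: indicator_def)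
    show "AE s in lborel. (\<lambda>n. indicator {0..t} s * b n s) \<longlonglongrightarrow> indicator {0..t} s * limit_rate \<phi> s"
      using lim by simp
    show "(\<lambda>s. indicator {0..t} s * b n s) \<in> borel_measurable lborel" for n using bm[of n] by measurable
  qed (use lm in simp)
  then have "(\<lambda>n. (\<integral>x. U n 0 x * \<phi> x \<partial>lborel) + (\<integral>s. indicator {0..t} s * b n s \<partial>lborel)) \<longlonglongrightarrow>
     (\<integral>x. F x * \<phi> x \<partial>lborel) + (\<integral>s. indicator {0..t} s * limit_rate \<phi> s \<partial>lborel)"
    unfolding \<phi>_def by (intro tendsto_add initial_lim)
  moreover have "(\<integral>x. U n 0 x * \<phi> x \<partial>lborel) + (\<integral>s. indicator {0..t} s * b n s \<partial>lborel) = (\<integral>x. U n t x * \<phi> x \<partial>lborel)" for n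
    using shifted_rbk.weak_form[OF approx t \<phi>m \<phi>b, of n] by (simp add: b_def)
  ultimately have "(\<lambda>n. \<integral>x. U n t x * \<phi> x \<partial>lborel) \<longlonglongrightarrow> (\<integral>x. F x * \<phi> x \<partial>lborel) + (\<integral>s. indicator {0..t} s * limit_rate \<phi> s \<partial>lborel)"
    by simp
  from LIMSEQ_unique[OF g_lim[OF t \<phi>m \<phi>b] this]
  show "(\<integral>x. g t x * \<phi> x \<partial>lborel) = (\<integral>x. F x * \<phi> x \<partial>lborel) + (\<integral>s. indicator {0..t} s * limit_rate \<phi> s \<partial>lborel)" .
qed

lemma limit_rate_cong:
  assumes s: "0 \<le> s" and eq: "\<And>x. 0 < x \<Longrightarrow> \<phi> x = \<psi> x"
  shows "limit_rate \<phi> s = limit_rate \<psi> s"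
  unfolding limit_rate_def
proof (intro Bochner_Integration.integral_cong refl)
  fix z
  show "limit_collisions s z * limit_test \<phi> z = limit_collisions s z * limit_test \<psi> z"
  proof (cases "0 < fst z \<and> 0 < snd z")
    case True
    then show ?thesis using eq[of "fst z"] eq[of "fst z - snd z"] by (auto simp: limit_test_def indicator_def)
  qed (simp add: limit_collisions_def g_pair_eq_0[OF s])
qed

lemma limit_rate_linear:
  assumes s: "0 \<le> s" and f: "f \<in> borel_measurable borel" "\<And>x. \<bar>f x\<bar> \<le> Cf" and h: "h \<in> borel_measurable borel" "\<And>x. \<bar>h x\<bar> \<le> Ch"
  shows "limit_rate (\<lambda>x. f x + c * h x) s = limit_rate f s + c * limit_rate h s"
proof -
  have lin: "limit_test (\<lambda>x. f x + c * h x) = (\<lambda>z. limit_test f z + c * limit_test h z)"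
    by (auto simp: limit_test_def algebra_simps)
  have m: "limit_test f \<in> borel_measurable plane" "limit_test h \<in> borel_measurable plane"
    using limit_test_measurable f(1) h(1) by simp_all
  show ?thesis unfolding limit_rate_def lin
    by (rule integral_mult_linear[OF limit_collisions_integrable(1)[OF s] m(1) limit_test_bounded[OF f(2)] m(2) limit_test_bounded[OF h(2)]])
qed

lemma limit_rate_tendsto:
  assumes s: "0 \<le> s" and p: "\<And>k. p k \<in> borel_measurable borel" "\<And>k x. \<bar>p k x\<bar> \<le> D"
    and w: "w \<in> borel_measurable borel" and lim: "\<And>x. (\<lambda>k. p k x) \<longlonglongrightarrow> w x"
  shows "(\<lambda>k. limit_rate (p k) s) \<longlonglongrightarrow> limit_rate w s"
  unfolding limit_rate_def
proof (rule integral_mult_bounded_convergence[OF limit_collisions_integrable(1)[OF s] _ limit_test_bounded[OF p(2)]])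
  show "limit_test w \<in> borel_measurable plane" using limit_test_measurable[OF w] by simp
  show "limit_test (p k) \<in> borel_measurable plane" for k using limit_test_measurable[OF p(1)[of k]] by simp
  show "AE z in plane. (\<lambda>k. limit_collisions s z * limit_test (p k) z) \<longlonglongrightarrow> limit_collisions s z * limit_test w z"
    unfolding limit_test_def by (intro AE_I2 tendsto_intros lim)
qed

lemma limit_rate_time_integrable:
  assumes m: "(\<lambda>s. indicator {0..t} s * limit_rate \<phi> s) \<in> borel_measurable borel"
    and \<phi>: "\<phi> \<in> borel_measurable borel" "\<And>x. \<bar>\<phi> x\<bar> \<le> D"
  shows "integrable lborel (\<lambda>s. indicator {0..t} s * limit_rate \<phi> s)"
proof (rule Bochner_Integration.integrable_bound[OF integrable_Icc_const[of 0 t "2 * D * (C * B\<^sup>2)"]])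
  show "AE s in lborel. norm (indicator {0..t} s * limit_rate \<phi> s) \<le> norm (indicator {0..t} s * (2 * D * (C * B\<^sup>2)))"
  proof (rule AE_I2)
    fix s
    show "norm (indicator {0..t} s * limit_rate \<phi> s) \<le> norm (indicator {0..t} s * (2 * D * (C * B\<^sup>2)))"
    proof (cases "s \<in> {0..t}")
      case True
      then have "\<bar>limit_rate \<phi> s\<bar> \<le> 2 * D * (C * B\<^sup>2)" using limit_rate_bound[OF _ \<phi>, of s] by simp
      then show ?thesis using True by simp
    qed simp
  qed
qed (use m in simp)

text \<open>
The equation is linear in the test function and stable under bounded pointwise limits, so it
extends from rays to all bounded measurable functions. Measurability of the rate in time is part
of the induction because \<open>g\<close> is only a family of functions of the size, with no joint measurability.
\<close>

lemma weak_form_limit: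
  assumes t: "0 \<le> t" and \<phi>: "\<phi> \<in> borel_measurable lborel" "\<And>x. \<bar>\<phi> x\<bar> \<le> D"
  shows "(\<lambda>s. indicator {0..t} s * limit_rate \<phi> s) \<in> borel_measurable borel \<and>
    (\<integral>x. g t x * \<phi> x \<partial>lborel) = (\<integral>x. F x * \<phi> x \<partial>lborel) + (\<integral>s. indicator {0..t} s * limit_rate \<phi> s \<partial>lborel)"
    (is "?P \<phi>")
proof -
  have cong: "?P \<psi>" if "?P \<phi>" and eq: "\<And>x. 0 < x \<Longrightarrow> \<psi> x = \<phi> x" for \<phi> \<psi>
  proof -
    have "(\<lambda>s. indicator {0..t} s * limit_rate \<psi> s) = (\<lambda>s. indicator {0..t} s * limit_rate \<phi> s)"
      using limit_rate_cong[of _ \<psi> \<phi>] eq by (auto simp: indicator_def)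
    moreover have "(\<integral>x. g t x * \<psi> x \<partial>lborel) = (\<integral>x. g t x * \<phi> x \<partial>lborel)"
      using g_support[OF t] eq by (intro Bochner_Integration.integral_cong refl) (metis mult_zero_left not_le)
    moreover have "(\<integral>x. F x * \<psi> x \<partial>lborel) = (\<integral>x. F x * \<phi> x \<partial>lborel)"
      using F(2) eq by (intro Bochner_Integration.integral_cong refl) (metis mult_zero_left not_le)
    ultimately show ?thesis using that(1) by simp
  qed
  \<comment> \<open>on positive sizes a ray with a negative end point coincides with \<open>{0<..}\<close>\<close>
  have ray: "?P (indicator {max 0 q<..})" for q using weak_form_ray[OF t, of "max 0 q"] by simp
  show ?thesis
    using borel_greaterThan_generator \<phi>
  proof (induction \<phi> rule: bounded_measurable_induct)
    case (base A)
    then obtain q where A: "A = {q<..}" by auto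
    show ?case unfolding A by (rule cong[OF ray[of q]]) (auto simp: indicator_def)
  next
    case const
    show ?case by (rule cong[OF ray[of 0]]) (auto simp: indicator_def)
  next
    case (lin f h c Cf Ch)
    have m: "f \<in> borel_measurable borel" "h \<in> borel_measurable borel" using lin by auto
    have eq: "(\<lambda>s. indicator {0..t} s * limit_rate (\<lambda>x. f x + c * h x) s) =
       (\<lambda>s. indicator {0..t} s * limit_rate f s + c * (indicator {0..t} s * limit_rate h s))"
    proof
      fix s
      show "indicator {0..t} s * limit_rate (\<lambda>x. f x + c * h x) s =
         indicator {0..t} s * limit_rate f s + c * (indicator {0..t} s * limit_rate h s)"
        using limit_rate_linear[OF _ m(1) lin(3) m(2) lin(4), of s c] by (cases "s \<in> {0..t}") simp_all
    qed
    have i: "integrable lborel (\<lambda>s. indicator {0..t} s * limit_rate f s)" "integrable lborel (\<lambda>s. indicator {0..t} s * limit_rate h s)"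
      using lin m by (auto intro!: limit_rate_time_integrable)
    have gl: "(\<integral>x. g t x * (f x + c * h x) \<partial>lborel) = (\<integral>x. g t x * f x \<partial>lborel) + c * (\<integral>x. g t x * h x \<partial>lborel)"
      by (rule integral_mult_linear[OF g_integrable[OF t] lin(1,3,2,4)])
    have Fl: "(\<integral>x. F x * (f x + c * h x) \<partial>lborel) = (\<integral>x. F x * f x \<partial>lborel) + c * (\<integral>x. F x * h x \<partial>lborel)"
      by (rule integral_mult_linear[OF F(1) lin(1,3,2,4)])
    have tl: "(\<integral>s. indicator {0..t} s * limit_rate f s + c * (indicator {0..t} s * limit_rate h s) \<partial>lborel) =
       (\<integral>s. indicator {0..t} s * limit_rate f s \<partial>lborel) + c * (\<integral>s. indicator {0..t} s * limit_rate h s \<partial>lborel)"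
      using i by simp
    show ?case unfolding eq gl Fl tl
      using lin(5,6) by (auto simp: distrib_left)
  next
    case (lim p w E)
    have m: "p k \<in> borel_measurable borel" "w \<in> borel_measurable borel" for k using lim by auto
    have l: "(\<lambda>k. indicator {0..t} s * limit_rate (p k) s) \<longlonglongrightarrow> indicator {0..t} s * limit_rate w s" for s
    proof (cases "0 \<le> s")
      case True then show ?thesis by (intro tendsto_mult_left limit_rate_tendsto[OF _ m(1) lim(3) m(2) lim(5)])
    qed simp
    have pm: "(\<lambda>s. indicator {0..t} s * limit_rate (p k) s) \<in> borel_measurable borel" for k using lim(6)[of k] by blast
    have wm: "(\<lambda>s. indicator {0..t} s * limit_rate w s) \<in> borel_measurable borel"
      by (rule borel_measurable_LIMSEQ_real[OF l pm])
    have tl: "(\<lambda>k. \<integral>s. indicator {0..t} s * limit_rate (p k) s \<partial>lborel) \<longlonglongrightarrow> (\<integral>s. indicator {0..t} s * limit_rate w s \<partial>lborel)"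
    proof (rule integral_dominated_convergence[where w="\<lambda>s. indicator {0..t} s * (2 * E * (C * B\<^sup>2))"])
      show "integrable lborel (\<lambda>s. indicator {0..t} s * (2 * E * (C * B\<^sup>2)))"
        by (rule integrable_Icc_const)
      show "AE s in lborel. norm (indicator {0..t} s * limit_rate (p k) s) \<le> indicator {0..t} s * (2 * E * (C * B\<^sup>2))" for k
      proof (rule AE_I2)
        fix s
        show "norm (indicator {0..t} s * limit_rate (p k) s) \<le> indicator {0..t} s * (2 * E * (C * B\<^sup>2))"
          using limit_rate_bound[OF _ m(1) lim(3), of s k] by (cases "s \<in> {0..t}") simp_all
      qed
      show "AE s in lborel. (\<lambda>k. indicator {0..t} s * limit_rate (p k) s) \<longlonglongrightarrow> indicator {0..t} s * limit_rate w s"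
        using l by simp
    qed (use wm pm in simp_all)
    have gl: "(\<lambda>k. \<integral>x. g t x * p k x \<partial>lborel) \<longlonglongrightarrow> (\<integral>x. g t x * w x \<partial>lborel)"
      by (rule integral_mult_bounded_convergence[OF g_integrable[OF t] lim(1,3,2)]) (intro AE_I2 tendsto_mult_left lim)
    have Fl: "(\<lambda>k. \<integral>x. F x * p k x \<partial>lborel) \<longlonglongrightarrow> (\<integral>x. F x * w x \<partial>lborel)"
      by (rule integral_mult_bounded_convergence[OF F(1) lim(1,3,2)]) (intro AE_I2 tendsto_mult_left lim)
    have eqk: "(\<integral>x. g t x * p k x \<partial>lborel) = (\<integral>x. F x * p k x \<partial>lborel) + (\<integral>s. indicator {0..t} s * limit_rate (p k) s \<partial>lborel)" for k
      using lim(6)[of k] by blast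
    have "(\<integral>x. g t x * w x \<partial>lborel) = (\<integral>x. F x * w x \<partial>lborel) + (\<integral>s. indicator {0..t} s * limit_rate w s \<partial>lborel)"
      using LIMSEQ_unique[OF gl tendsto_add[OF Fl tl, folded eqk]] .
    then show ?case using wm by blast
  qed
qed

end

section \<open>The limit is a weak solution\<close>

text \<open>
An element of \<open>Linf\<close> is measurable on the half-line only and bounded almost everywhere only. Its
extension by zero repairs the first and truncation the second; the two steps are kept apart
because the extension agrees with the given function at every positive point.
\<close>

lemma Linf_representative:
  assumes "\<phi> \<in> Linf"
  obtains \<phi>0 \<phi>' D where "\<phi>0 \<in> borel_measurable borel" "\<And>x. 0 < x \<Longrightarrow> \<phi>0 x = \<phi> x" "\<phi>' \<in> borel_measurable borel"
    "\<And>x. \<bar>\<phi>' x\<bar> \<le> D" "AE x in lborel. \<phi>0 x = \<phi>' x"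
proof -
  define \<phi>0 where "\<phi>0 = (\<lambda>x. indicator {0<..} x * \<phi> x)"
  have m: "\<phi>0 \<in> borel_measurable borel"
    using assms unfolding Linf_def set_borel_measurable_def \<phi>0_def by simp
  obtain C where C: "AE s in lborel. 0 < s \<longrightarrow> \<bar>\<phi> s\<bar> \<le> C" using assms unfolding Linf_def by blast
  define D where "D = \<bar>C\<bar>"
  show thesis
  proof (rule that[of \<phi>0 "\<lambda>x. max (-D) (min D (\<phi>0 x))" D])
    show "(\<lambda>x. max (-D) (min D (\<phi>0 x))) \<in> borel_measurable borel" using m by measurable
    show "\<bar>max (-D) (min D (\<phi>0 x))\<bar> \<le> D" for x by (auto simp: D_def)
    show "AE x in lborel. \<phi>0 x = max (-D) (min D (\<phi>0 x))"
      using C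
    proof eventually_elim
      case (elim x)
      have "\<bar>\<phi>0 x\<bar> \<le> D" using elim by (auto simp: \<phi>0_def D_def indicator_def)
      then show ?case by (simp add: abs_le_iff)
    qed
  qed (use m in \<open>auto simp: \<phi>0_def\<close>)
qed

lemma integral_half_line_Linf:
  fixes v \<phi> \<phi>0 \<phi>' :: "real \<Rightarrow> real"
  assumes v: "v \<in> borel_measurable borel" "\<And>x. x \<le> 0 \<Longrightarrow> v x = 0"
    and p: "\<phi>0 \<in> borel_measurable borel" "\<And>x. 0 < x \<Longrightarrow> \<phi>0 x = \<phi> x" "\<phi>' \<in> borel_measurable borel" "AE x in lborel. \<phi>0 x = \<phi>' x"
  shows "(LINT x:{0<..}|lborel. v x * \<phi> x) = (\<integral>x. v x * \<phi>' x \<partial>lborel)"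
proof -
  have "(LINT x:{0<..}|lborel. v x * \<phi> x) = (\<integral>x. v x * \<phi>0 x \<partial>lborel)"
    unfolding set_lebesgue_integral_def
  proof (intro Bochner_Integration.integral_cong refl)
    fix x show "indicator {0<..} x *\<^sub>R (v x * \<phi> x) = v x * \<phi>0 x"
      using v(2)[of x] p(2)[of x] by (cases "0 < x") simp_all
  qed
  also have "\<dots> = (\<integral>x. v x * \<phi>' x \<partial>lborel)"
    by (rule integral_cong_AE) (use v(1) p in \<open>auto intro!: borel_measurable_times elim: eventually_mono\<close>)
  finally show ?thesis .
qed

context rbk_limit
begin

text \<open>
By symmetry of the kernel the loss over the quadrant is the sum of the losses of both partners
over the triangle \<open>y < x\<close>; the diagonal is a null set.
\<close>

lemma limit_rate_triangle:
  assumes s: "0 \<le> s" and \<phi>: "\<phi> \<in> borel_measurable borel" "\<And>x. \<bar>\<phi> x\<bar> \<le> D"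
    and sym: "\<And>x y. 0 < x \<Longrightarrow> 0 < y \<Longrightarrow> K x y = K y x"
  shows "(LINT x:{0<..}|lborel. LINT y:{0<..<x}|lborel. (\<phi> (x - y) - \<phi> x - \<phi> y) * K x y * g s x * g s y) = limit_rate \<phi> s"
    and "set_integrable lborel {(x, y). 0 < y \<and> y < x} (\<lambda>(x, y). K x y * g s x * g s y)"
proof -
    note [measurable] = \<phi>(1)
  define H where "H = limit_collisions s"
  have Hi: "integrable plane H" unfolding H_def by (rule limit_collisions_integrable(1)[OF s])
  have H_alt: "H (x, y) = (if 0 < x \<and> 0 < y then K x y * g s x * g s y else 0)" for x y
    by (auto simp: H_def limit_collisions_def g_pair_def quadrant_kernel_def indicator_def g_support[OF s] not_less)
  have Hsym: "H (y, x) = H (x, y)" for x y using sym[of x y] by (auto simp: H_alt)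
  define T where "T = (\<lambda>z::real \<times> real. indicator {0<..} (fst z - snd z) :: real)"
  have Tm[measurable]: "T \<in> borel_measurable (borel \<Otimes>\<^sub>M borel)" unfolding T_def by measurable
  have T01: "T z = 0 \<or> T z = 1" for z by (auto simp: T_def indicator_def)
  have bnd: "integrable plane (\<lambda>z. H z * (T z * p z))"
    if "p \<in> borel_measurable (borel \<Otimes>\<^sub>M borel)" "\<And>z. \<bar>p z\<bar> \<le> E" for p E
  proof (rule integrable_bounded_mult[OF Hi, where C=E])
    show "\<bar>T z * p z\<bar> \<le> E" for z using T01[of z] that(2)[of z] by auto
  qed (use that in measurable)
  have p1: "(\<lambda>z. \<phi> (fst z - snd z)) \<in> borel_measurable (borel \<Otimes>\<^sub>M borel)"
    and p2: "(\<lambda>z. \<phi> (fst z)) \<in> borel_measurable (borel \<Otimes>\<^sub>M borel)"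
    and p3: "(\<lambda>z. \<phi> (snd z)) \<in> borel_measurable (borel \<Otimes>\<^sub>M borel)" by measurable
  have j1: "integrable plane (\<lambda>z. H z * (T z * \<phi> (fst z - snd z)))" by (rule bnd[OF p1 \<phi>(2)])
  have j2: "integrable plane (\<lambda>z. H z * (T z * \<phi> (fst z)))" by (rule bnd[OF p2 \<phi>(2)])
  have j3: "integrable plane (\<lambda>z. H z * (T z * \<phi> (snd z)))" by (rule bnd[OF p3 \<phi>(2)])
  have j4: "integrable plane (\<lambda>z. H z * \<phi> (fst z))" by (rule integrable_bounded_mult[OF Hi _ \<phi>(2)]) (use p2 in simp)
  have j3': "integrable plane (\<lambda>(x, y). H (y, x) * (T (y, x) * \<phi> x))"
    using lborel_pair.integrable_product_swap[OF j3] by simp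
  have swap: "(\<integral>(x, y). H (y, x) * (T (y, x) * \<phi> x) \<partial>plane) = (\<integral>z. H z * (T z * \<phi> (snd z)) \<partial>plane)"
    using lborel_pair.integral_product_swap[OF borel_measurable_integrable[OF j3]] by simp
  have "(\<integral>z. H z * \<phi> (fst z) \<partial>plane) = (\<integral>z. H z * (T z * \<phi> (fst z)) + (case z of (x, y) \<Rightarrow> H (y, x) * (T (y, x) * \<phi> x)) \<partial>plane)"
  proof (rule integral_cong_AE)
    show "AE z in plane. H z * \<phi> (fst z) = H z * (T z * \<phi> (fst z)) + (case z of (x, y) \<Rightarrow> H (y, x) * (T (y, x) * \<phi> x))"
      using AE_diff_neq[of 0]
    proof eventually_elim
      case (elim z)
      obtain x y where z: "z = (x, y)" by (cases z)
      have "T (x, y) + T (y, x) = 1" using elim z by (auto simp: T_def indicator_def)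
      then have "H (x, y) * \<phi> x = H (x, y) * ((T (x, y) + T (y, x)) * \<phi> x)" by simp
      then show ?case unfolding z using Hsym[of y x] by (simp add: algebra_simps)
    qed
  qed (use borel_measurable_integrable[OF j4] borel_measurable_integrable[OF j2] borel_measurable_integrable[OF j3'] in simp_all)
  also have "\<dots> = (\<integral>z. H z * (T z * \<phi> (fst z)) \<partial>plane) + (\<integral>z. H z * (T z * \<phi> (snd z)) \<partial>plane)"
    unfolding swap[symmetric] by (rule Bochner_Integration.integral_add[OF j2 j3'])
  finally have sp: "(\<integral>z. H z * \<phi> (fst z) \<partial>plane) = (\<integral>z. H z * (T z * \<phi> (fst z)) \<partial>plane) + (\<integral>z. H z * (T z * \<phi> (snd z)) \<partial>plane)" .
  have "limit_rate \<phi> s = (\<integral>z. H z * (T z * \<phi> (fst z - snd z)) - H z * \<phi> (fst z) \<partial>plane)"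
    unfolding limit_rate_def H_def limit_test_def T_def by (simp add: right_diff_distrib)
  also have "\<dots> = (\<integral>z. H z * (T z * \<phi> (fst z - snd z)) \<partial>plane) - (\<integral>z. H z * (T z * \<phi> (fst z)) \<partial>plane) - (\<integral>z. H z * (T z * \<phi> (snd z)) \<partial>plane)"
    using j1 j4 sp by simp
  also have "\<dots> = (\<integral>z. H z * (T z * \<phi> (fst z - snd z)) - H z * (T z * \<phi> (fst z)) - H z * (T z * \<phi> (snd z)) \<partial>plane)"
    using j1 j2 j3 by simp
  also have "\<dots> = (\<integral>x. (\<integral>y. H (x, y) * (T (x, y) * \<phi> (x - y)) - H (x, y) * (T (x, y) * \<phi> x) - H (x, y) * (T (x, y) * \<phi> y) \<partial>lborel) \<partial>lborel)"
    using lborel_pair.integral_fst'[OF Bochner_Integration.integrable_diff[OF Bochner_Integration.integrable_diff[OF j1 j2] j3]] by simp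
  also have "\<dots> = (LINT x:{0<..}|lborel. LINT y:{0<..<x}|lborel. (\<phi> (x - y) - \<phi> x - \<phi> y) * K x y * g s x * g s y)"
    unfolding set_lebesgue_integral_def
  proof (intro Bochner_Integration.integral_cong refl)
    fix x
    have "(\<integral>y. H (x, y) * (T (x, y) * \<phi> (x - y)) - H (x, y) * (T (x, y) * \<phi> x) - H (x, y) * (T (x, y) * \<phi> y) \<partial>lborel)
       = (\<integral>y. indicator {0<..} x * (indicator {0<..<x} y * ((\<phi> (x - y) - \<phi> x - \<phi> y) * K x y * g s x * g s y)) \<partial>lborel)"
      by (intro Bochner_Integration.integral_cong refl) (auto simp: H_alt T_def indicator_def algebra_simps)
    then show "(\<integral>y. H (x, y) * (T (x, y) * \<phi> (x - y)) - H (x, y) * (T (x, y) * \<phi> x) - H (x, y) * (T (x, y) * \<phi> y) \<partial>lborel)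
       = indicator {0<..} x *\<^sub>R (\<integral>y. indicator {0<..<x} y *\<^sub>R ((\<phi> (x - y) - \<phi> x - \<phi> y) * K x y * g s x * g s y) \<partial>lborel)"
      by simp
  qed
  finally show "(LINT x:{0<..}|lborel. LINT y:{0<..<x}|lborel. (\<phi> (x - y) - \<phi> x - \<phi> y) * K x y * g s x * g s y) = limit_rate \<phi> s" by simp
  have "integrable plane (\<lambda>z. H z * (T z * 1))" by (rule bnd[where E=1]) auto
  moreover have "(\<lambda>z. H z * (T z * 1)) = (\<lambda>z. indicator {(x, y). 0 < y \<and> y < x} z *\<^sub>R (case z of (x, y) \<Rightarrow> K x y * g s x * g s y))"
  proof
    fix z :: "real \<times> real"
    obtain x y where z: "z = (x, y)" by (cases z)
    show "H z * (T z * 1) = indicator {(x, y). 0 < y \<and> y < x} z *\<^sub>R (case z of (x, y) \<Rightarrow> K x y * g s x * g s y)"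
      unfolding z H_alt by (auto simp: T_def indicator_def)
  qed
  ultimately show "set_integrable lborel {(x, y). 0 < y \<and> y < x} (\<lambda>(x, y). K x y * g s x * g s y)"
    unfolding set_integrable_def lborel_prod by simp
qed

text \<open>
Changing \<open>\<phi>\<close> on a null set changes \<open>\<phi> (x - y)\<close>, for fixed \<open>x\<close>, on the reflected and translated null
set of values \<open>y\<close>.
\<close>

lemma triangle_integral_Linf:
  assumes s: "0 \<le> s"
    and p: "\<phi>0 \<in> borel_measurable borel" "\<And>x. 0 < x \<Longrightarrow> \<phi>0 x = \<phi> x" "\<phi>' \<in> borel_measurable borel" "AE x in lborel. \<phi>0 x = \<phi>' x"
  shows "(LINT x:{0<..}|lborel. LINT y:{0<..<x}|lborel. (\<phi> (x - y) - \<phi> x - \<phi> y) * K x y * g s x * g s y)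
    = (LINT x:{0<..}|lborel. LINT y:{0<..<x}|lborel. (\<phi>' (x - y) - \<phi>' x - \<phi>' y) * K x y * g s x * g s y)"
proof -
  note [measurable] = p(1,3) g_measurable[OF s]
  have quadrant_kernel_raw [measurable (raw)]: "(\<lambda>w. quadrant_kernel (h w)) \<in> borel_measurable N"
    if "h \<in> N \<rightarrow>\<^sub>M borel \<Otimes>\<^sub>M borel" for h and N :: "'n measure"
    by (rule measurable_compose[OF that quadrant_kernel_measurable])
  define W where "W = (\<lambda>\<psi> x. \<integral>y. (if 0 < y \<and> y < x then (\<psi> (x - y) - \<psi> x - \<psi> y) * quadrant_kernel (x, y) * g s x * g s y else 0) \<partial>lborel)"
  have Wm: "W \<psi> \<in> borel_measurable borel" if [measurable]: "\<psi> \<in> borel_measurable borel" for \<psi>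
    unfolding W_def by measurable
  have eq: "(LINT x:{0<..}|lborel. LINT y:{0<..<x}|lborel. (\<psi> (x - y) - \<psi> x - \<psi> y) * K x y * g s x * g s y) = (\<integral>x. W \<theta> x \<partial>lborel)"
    if e: "\<And>x. 0 < x \<Longrightarrow> \<theta> x = \<psi> x" for \<psi> \<theta>
    unfolding set_lebesgue_integral_def W_def
  proof (intro Bochner_Integration.integral_cong refl)
    fix x
    have "(\<integral>y. (if 0 < y \<and> y < x then (\<theta> (x - y) - \<theta> x - \<theta> y) * quadrant_kernel (x, y) * g s x * g s y else 0) \<partial>lborel)
      = (\<integral>y. indicator {0<..} x * (indicator {0<..<x} y * ((\<psi> (x - y) - \<psi> x - \<psi> y) * K x y * g s x * g s y)) \<partial>lborel)"
      by (intro Bochner_Integration.integral_cong refl) (auto simp: quadrant_kernel_def e indicator_def)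
    then show "indicator {0<..} x *\<^sub>R (\<integral>y. indicator {0<..<x} y *\<^sub>R ((\<psi> (x - y) - \<psi> x - \<psi> y) * K x y * g s x * g s y) \<partial>lborel)
      = (\<integral>y. (if 0 < y \<and> y < x then (\<theta> (x - y) - \<theta> x - \<theta> y) * quadrant_kernel (x, y) * g s x * g s y else 0) \<partial>lborel)"
      by simp
  qed
  have "(\<integral>x. W \<phi>0 x \<partial>lborel) = (\<integral>x. W \<phi>' x \<partial>lborel)"
  proof (rule integral_cong_AE)
    show "AE x in lborel. W \<phi>0 x = W \<phi>' x" using p(4)
    proof eventually_elim
      case (elim x)
      have "AE y in lborel. \<phi>0 (x + (-1) * y) = \<phi>' (x + (-1) * y)"
        by (rule AE_borel_affine[OF _ _ p(4)]) measurable
      then have "AE y in lborel. (if 0 < y \<and> y < x then (\<phi>0 (x - y) - \<phi>0 x - \<phi>0 y) * quadrant_kernel (x, y) * g s x * g s y else 0)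
        = (if 0 < y \<and> y < x then (\<phi>' (x - y) - \<phi>' x - \<phi>' y) * quadrant_kernel (x, y) * g s x * g s y else 0)"
        using p(4) by eventually_elim (use elim in simp)
      moreover have "(\<lambda>y. if 0 < y \<and> y < x then (\<psi> (x - y) - \<psi> x - \<psi> y) * quadrant_kernel (x, y) * g s x * g s y else 0) \<in> borel_measurable lborel"
        if [measurable]: "\<psi> \<in> borel_measurable borel" for \<psi> by measurable
      ultimately show ?case unfolding W_def using p(1,3) by (intro integral_cong_AE) blast+
    qed
  qed (use Wm p in simp_all)
  then show ?thesis using eq[of \<phi>0 \<phi>] eq[of \<phi>' \<phi>'] p(2) by simp
qed

text \<open>
The integrability clauses come from the weak formulation with \<open>\<phi> = 1\<close>, whose integrand is
\<open>- K x y * g s x * g s y\<close>.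
\<close>

lemma weak_solution_limit:
  assumes sym: "\<And>x y. 0 < x \<Longrightarrow> 0 < y \<Longrightarrow> K x y = K y x"
    and fin: "(\<lambda>x. indicator {0<..} x * fin x) \<in> borel_measurable borel" "AE x in lborel. indicator {0<..} x * fin x = F x"
  shows "weak_solution K fin \<infinity> (\<lambda>x t. g t x)"
proof -
  have si: "set_integrable lborel {0<..} h" if "integrable lborel h" for h :: "real \<Rightarrow> real"
    unfolding set_integrable_def by (rule integrable_mult_indicator[OF _ that]) simp
  have cont: "((\<lambda>t. LINT x:{0<..}|lborel. \<bar>g t x - g t0 x\<bar>) \<longlongrightarrow> 0) (at t0 within {t. 0 \<le> t \<and> ereal t < \<infinity>})"
    if t0: "0 \<le> t0" for t0
  proof (rule tendsto_sandwich)
    have le: "(LINT x:{0<..}|lborel. \<bar>g t x - g t0 x\<bar>) \<le> 2 * (C * B\<^sup>2) * \<bar>t - t0\<bar>" if t: "0 \<le> t" for t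
    proof -
      have "(LINT x:{0<..}|lborel. \<bar>g t x - g t0 x\<bar>) = (\<integral>x. \<bar>g t x - g t0 x\<bar> \<partial>lborel)"
        unfolding set_lebesgue_integral_def using g_support t t0
        by (intro Bochner_Integration.integral_cong refl) (auto simp: indicator_def not_less)
      also have "\<dots> \<le> 2 * (C * B\<^sup>2) * \<bar>t - t0\<bar>"
      proof (cases "t0 \<le> t")
        case True then show ?thesis using g_L1_lipschitz[OF t0 True] by simp
      next
        case False then show ?thesis using g_L1_lipschitz[OF t, of t0] by (simp add: abs_minus_commute)
      qed
      finally show ?thesis .
    qed
    show "\<forall>\<^sub>F t in at t0 within {t. 0 \<le> t \<and> ereal t < \<infinity>}. 0 \<le> (LINT x:{0<..}|lborel. \<bar>g t x - g t0 x\<bar>)"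
      unfolding set_lebesgue_integral_def by (intro always_eventually allI integral_nonneg_AE AE_I2) simp
    show "\<forall>\<^sub>F t in at t0 within {t. 0 \<le> t \<and> ereal t < \<infinity>}. (LINT x:{0<..}|lborel. \<bar>g t x - g t0 x\<bar>) \<le> 2 * (C * B\<^sup>2) * \<bar>t - t0\<bar>"
      using le by (auto simp: eventually_at_filter)
    have "((\<lambda>t. 2 * (C * B\<^sup>2) * \<bar>t - t0\<bar>) \<longlongrightarrow> 2 * (C * B\<^sup>2) * \<bar>t0 - t0\<bar>) (at t0 within {t. 0 \<le> t \<and> ereal t < \<infinity>})"
      by (intro tendsto_intros)
    then show "((\<lambda>t. 2 * (C * B\<^sup>2) * \<bar>t - t0\<bar>) \<longlongrightarrow> 0) (at t0 within {t. 0 \<le> t \<and> ereal t < \<infinity>})" by simp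
  qed simp
  have moment: "(\<lambda>x. g t x) \<in> X01 \<and> norm01 (\<lambda>x. g t x) \<le> B" if t: "0 < t" for t
  proof
    show "(\<lambda>x. g t x) \<in> X01" unfolding X01_def using si[OF g_moment(1)] t by simp
    have "norm01 (\<lambda>x. g t x) = (\<integral>x. (1 + x) * g t x \<partial>lborel)"
      unfolding norm01_def set_lebesgue_integral_def using g_support[of t] g_nonneg[of t] t
      by (intro Bochner_Integration.integral_cong refl) (auto simp: indicator_def not_less)
    then show "norm01 (\<lambda>x. g t x) \<le> B" using g_moment(2)[of t] t by simp
  qed
  have time: "set_integrable lborel {0..t} (\<lambda>s. LINT x:{0<..}|lborel. LINT y:{0<..<x}|lborel. K x y * g s x * g s y)" if t: "0 \<le> t" for t
  proof -
    have "integrable lborel (\<lambda>s. - (indicator {0..t} s * limit_rate (\<lambda>_. 1) s))"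
      using limit_rate_time_integrable[of t "\<lambda>_. 1" 1] weak_form_limit[OF t, of "\<lambda>_. 1" 1] by simp
    moreover have "(\<lambda>s. - (indicator {0..t} s * limit_rate (\<lambda>_. 1) s)) =
      (\<lambda>s. indicator {0..t} s *\<^sub>R (LINT x:{0<..}|lborel. LINT y:{0<..<x}|lborel. K x y * g s x * g s y))"
    proof
      fix s
      show "- (indicator {0..t} s * limit_rate (\<lambda>_. 1) s) = indicator {0..t} s *\<^sub>R (LINT x:{0<..}|lborel. LINT y:{0<..<x}|lborel. K x y * g s x * g s y)"
      proof (cases "s \<in> {0..t}")
        case True
        have "limit_rate (\<lambda>_. 1) s = (LINT x:{0<..}|lborel. LINT y:{0<..<x}|lborel. (1 - 1 - 1) * K x y * g s x * g s y)"
          using limit_rate_triangle(1)[of s "\<lambda>_. 1" 1] sym True by simp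
        also have "\<dots> = - (LINT x:{0<..}|lborel. LINT y:{0<..<x}|lborel. K x y * g s x * g s y)"
          by (simp add: set_lebesgue_integral_def)
        finally show ?thesis using True by simp
      qed simp
    qed
    ultimately show ?thesis unfolding set_integrable_def by simp
  qed
  have equation: "(LINT x:{0<..}|lborel. (g t x - fin x) * \<phi> x) =
      (LINT s:{0..t}|lborel. LINT x:{0<..}|lborel. LINT y:{0<..<x}|lborel. (\<phi> (x - y) - \<phi> x - \<phi> y) * K x y * g s x * g s y)"
    if t: "0 \<le> t" and "\<phi> \<in> Linf" for t \<phi>
  proof -
    obtain \<phi>0 \<phi>' D where p: "\<phi>0 \<in> borel_measurable borel" "\<And>x. 0 < x \<Longrightarrow> \<phi>0 x = \<phi> x" "\<phi>' \<in> borel_measurable borel"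
      and D: "\<And>x. \<bar>\<phi>' x\<bar> \<le> D" and ae: "AE x in lborel. \<phi>0 x = \<phi>' x"
      using Linf_representative[OF \<open>\<phi> \<in> Linf\<close>] by blast
    define v where "v = (\<lambda>x. g t x - indicator {0<..} x * fin x)"
    have gm: "g t \<in> borel_measurable borel" by (rule g_measurable[OF t])
    have Fm: "F \<in> borel_measurable borel" using F(1) by auto
    have "(LINT x:{0<..}|lborel. (g t x - fin x) * \<phi> x) = (LINT x:{0<..}|lborel. v x * \<phi> x)"
      unfolding set_lebesgue_integral_def v_def by (intro Bochner_Integration.integral_cong refl) (auto simp: indicator_def)
    also have "\<dots> = (\<integral>x. v x * \<phi>' x \<partial>lborel)"
    proof (rule integral_half_line_Linf[OF _ _ p ae])
      show "v \<in> borel_measurable borel" unfolding v_def using gm fin(1) by measurable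
      show "v x = 0" if "x \<le> 0" for x using that g_support[OF t] by (simp add: v_def)
    qed
    also have "\<dots> = (\<integral>x. g t x * \<phi>' x - F x * \<phi>' x \<partial>lborel)"
    proof (rule integral_cong_AE)
      show "(\<lambda>x. v x * \<phi>' x) \<in> borel_measurable lborel" unfolding v_def using gm fin(1) p(3) by measurable
      show "(\<lambda>x. g t x * \<phi>' x - F x * \<phi>' x) \<in> borel_measurable lborel" using gm Fm p(3) by measurable
      show "AE x in lborel. v x * \<phi>' x = g t x * \<phi>' x - F x * \<phi>' x"
        using fin(2) by eventually_elim (simp add: v_def left_diff_distrib)
    qed
    also have "\<dots> = (\<integral>x. g t x * \<phi>' x \<partial>lborel) - (\<integral>x. F x * \<phi>' x \<partial>lborel)"
      by (intro Bochner_Integration.integral_diff integrable_bounded_mult[OF _ _ D] g_integrable t F) (use p in simp_all)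
    also have "\<dots> = (\<integral>s. indicator {0..t} s * limit_rate \<phi>' s \<partial>lborel)"
      using weak_form_limit[OF t _ D] p(3) by simp
    also have "\<dots> = (LINT s:{0..t}|lborel. LINT x:{0<..}|lborel. LINT y:{0<..<x}|lborel. (\<phi> (x - y) - \<phi> x - \<phi> y) * K x y * g s x * g s y)"
      unfolding set_lebesgue_integral_def[of lborel "{0..t}"]
    proof (intro Bochner_Integration.integral_cong refl)
      fix s
      show "indicator {0..t} s * limit_rate \<phi>' s = indicator {0..t} s *\<^sub>R
        (LINT x:{0<..}|lborel. LINT y:{0<..<x}|lborel. (\<phi> (x - y) - \<phi> x - \<phi> y) * K x y * g s x * g s y)"
      proof (cases "s \<in> {0..t}")
        case True
        then have s: "0 \<le> s" by simp
        show ?thesis using triangle_integral_Linf[OF s p ae] limit_rate_triangle(1)[OF s p(3) D sym] by simp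
      qed simp
    qed
    finally show ?thesis .
  qed
  show ?thesis
    unfolding weak_solution_def
  proof (intro conjI allI impI)
    show "(\<lambda>x. g t x) \<in> L1" if "0 \<le> t \<and> ereal t < \<infinity>" for t
      unfolding L1_def using si[OF g_integrable[of t]] that by simp
    show "AE x in lborel. 0 < x \<longrightarrow> 0 \<le> g t x" if "0 \<le> t \<and> ereal t < \<infinity>" for t
      using g_nonneg[of t] that by simp
    show "\<exists>C. AE t in lborel. 0 < t \<and> ereal t < \<infinity> \<longrightarrow> (\<lambda>x. g t x) \<in> X01 \<and> norm01 (\<lambda>x. g t x) \<le> C"
      using moment by (intro exI[of _ B] AE_I2) simp
    show "AE s in lborel. s \<in> {0..t} \<longrightarrow> set_integrable lborel {(x, y). 0 < y \<and> y < x} (\<lambda>(x, y). K x y * g s x * g s y)" for t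
      using limit_rate_triangle(2)[of _ "\<lambda>_. 0" 0] sym by (intro AE_I2) simp
  qed (use cont time equation in auto)
qed

lemma U_time_continuous:
  assumes "\<phi> \<in> borel_measurable borel" "\<And>x. \<bar>\<phi> x\<bar> \<le> D"
  shows "continuous_on {0..T} (\<lambda>t. \<integral>x. U n t x * \<phi> x \<partial>lborel)" "continuous_on {0..T} (\<lambda>t. \<integral>x. g t x * \<phi> x \<partial>lborel)"
proof -
  have L: "0 \<le> 2 * D * (C * B\<^sup>2)" using assms(2)[of 0] C_nonneg by simp
  have lip: "continuous_on {0..T} h"
    if h: "\<And>s t. 0 \<le> s \<Longrightarrow> s \<le> t \<Longrightarrow> \<bar>h t - h s\<bar> \<le> 2 * D * (C * B\<^sup>2) * (t - s)" for h :: "real \<Rightarrow> real"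
  proof (rule lipschitz_on_continuous_on[OF lipschitz_onI[OF _ L]])
    fix s t assume "s \<in> {0..T}" "t \<in> {0..T}"
    then show "dist (h s) (h t) \<le> 2 * D * (C * B\<^sup>2) * dist s t"
      using h[of s t] h[of t s] by (cases "s \<le> t") (auto simp: dist_real_def abs_minus_commute)
  qed
  show "continuous_on {0..T} (\<lambda>t. \<integral>x. U n t x * \<phi> x \<partial>lborel)" by (rule lip) (rule U_lipschitz[OF _ _ assms])
  show "continuous_on {0..T} (\<lambda>t. \<integral>x. g t x * \<phi> x \<partial>lborel)" by (rule lip) (rule g_lipschitz[OF _ _ assms])
qed

lemma converges_CwL1_limit:
  assumes T: "0 < T" and h: "\<And>n x t. 0 \<le> t \<Longrightarrow> h n x t = U n t x"
  shows "converges_CwL1 T h (\<lambda>x t. g t x)"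
proof -
  have si: "set_integrable lborel {0<..} k" if "integrable lborel k" for k :: "real \<Rightarrow> real"
    unfolding set_integrable_def by (rule integrable_mult_indicator[OF _ that]) simp
  have hU: "(\<lambda>x. h n x t) = U n t" if "0 \<le> t" for n t using h[OF that] by auto
  have Um: "U n t \<in> borel_measurable borel" for n t using U_integrable[of n t] by auto
  have "weakly_continuous_L1 T (h n)" for n
    unfolding weakly_continuous_L1_def
  proof (intro conjI ballI)
    show "(\<lambda>x. h n x t) \<in> L1" if "t \<in> {0..T}" for t using that hU[of t n] si[OF U_integrable] by (simp add: L1_def)
    fix \<psi> assume "\<psi> \<in> Linf"
    then obtain \<phi>0 \<phi>' D where p: "\<phi>0 \<in> borel_measurable borel" "\<And>x. 0 < x \<Longrightarrow> \<phi>0 x = \<psi> x" "\<phi>' \<in> borel_measurable borel"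
      and D: "\<And>x. \<bar>\<phi>' x\<bar> \<le> D" and ae: "AE x in lborel. \<phi>0 x = \<phi>' x" using Linf_representative by blast
    show "continuous_on {0..T} (\<lambda>t. LINT x:{0<..}|lborel. h n x t * \<psi> x)"
      by (rule continuous_on_eq[OF U_time_continuous(1)[OF p(3) D]])
        (use integral_half_line_Linf[OF Um U_support p ae] h in simp)
  qed
  moreover have "weakly_continuous_L1 T (\<lambda>x t. g t x)"
    unfolding weakly_continuous_L1_def
  proof (intro conjI ballI)
    show "(\<lambda>x. g t x) \<in> L1" if "t \<in> {0..T}" for t using that si[OF g_integrable[of t]] by (simp add: L1_def)
    fix \<psi> assume "\<psi> \<in> Linf"
    then obtain \<phi>0 \<phi>' D where p: "\<phi>0 \<in> borel_measurable borel" "\<And>x. 0 < x \<Longrightarrow> \<phi>0 x = \<psi> x" "\<phi>' \<in> borel_measurable borel"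
      and D: "\<And>x. \<bar>\<phi>' x\<bar> \<le> D" and ae: "AE x in lborel. \<phi>0 x = \<phi>' x" using Linf_representative by blast
    show "continuous_on {0..T} (\<lambda>t. LINT x:{0<..}|lborel. g t x * \<psi> x)"
      by (rule continuous_on_eq[OF U_time_continuous(2)[OF p(3) D]])
        (use integral_half_line_Linf[OF g_measurable g_support p ae] in simp)
  qed
  moreover have "(\<lambda>n. SUP t\<in>{0..T}. \<bar>LINT x:{0<..}|lborel. (h n x t - g t x) * \<psi> x\<bar>) \<longlonglongrightarrow> 0" if "\<psi> \<in> Linf" for \<psi>
  proof -
    obtain \<phi>0 \<phi>' D where p: "\<phi>0 \<in> borel_measurable borel" "\<And>x. 0 < x \<Longrightarrow> \<phi>0 x = \<psi> x" "\<phi>' \<in> borel_measurable borel"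
      and D: "\<And>x. \<bar>\<phi>' x\<bar> \<le> D" and ae: "AE x in lborel. \<phi>0 x = \<phi>' x" using Linf_representative[OF \<open>\<psi> \<in> Linf\<close>] by blast
    have eq: "(LINT x:{0<..}|lborel. (h n x t - g t x) * \<psi> x) = (\<integral>x. U n t x * \<phi>' x \<partial>lborel) - (\<integral>x. g t x * \<phi>' x \<partial>lborel)"
      if t: "0 \<le> t" for n t
    proof -
      have m: "(\<lambda>x. U n t x - g t x) \<in> borel_measurable borel" using Um g_measurable[OF t] by measurable
      have z: "U n t x - g t x = 0" if "x \<le> 0" for x using U_support[OF that] g_support[OF t that] by simp
      have "(LINT x:{0<..}|lborel. (h n x t - g t x) * \<psi> x) = (\<integral>x. (U n t x - g t x) * \<phi>' x \<partial>lborel)"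
        using integral_half_line_Linf[OF m z p ae] h[OF t] by simp
      also have "\<dots> = (\<integral>x. U n t x * \<phi>' x - g t x * \<phi>' x \<partial>lborel)" by (simp add: left_diff_distrib)
      also have "\<dots> = (\<integral>x. U n t x * \<phi>' x \<partial>lborel) - (\<integral>x. g t x * \<phi>' x \<partial>lborel)"
        by (intro Bochner_Integration.integral_diff integrable_bounded_mult[OF _ _ D] g_integrable U_integrable t) (use p in simp_all)
      finally show ?thesis .
    qed
    show ?thesis
    proof (rule LIMSEQ_I)
      fix r :: real assume r: "0 < r"
      then have "0 < r / 2" by simp
      from weak_convergence_uniform[OF p(3) D this] obtain n0 where
        n0: "\<And>n t. n0 \<le> n \<Longrightarrow> t \<in> {0..T} \<Longrightarrow> \<bar>(\<integral>x. U n t x * \<phi>' x \<partial>lborel) - (\<integral>x. g t x * \<phi>' x \<partial>lborel)\<bar> \<le> r / 2" by blast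
      have "norm ((SUP t\<in>{0..T}. \<bar>LINT x:{0<..}|lborel. (h n x t - g t x) * \<psi> x\<bar>) - 0) < r" if n: "n0 \<le> n" for n
      proof -
        have b: "\<bar>LINT x:{0<..}|lborel. (h n x t - g t x) * \<psi> x\<bar> \<le> r / 2" if "t \<in> {0..T}" for t
          using n0[OF n that] eq[of t n] that by simp
        have up: "(SUP t\<in>{0..T}. \<bar>LINT x:{0<..}|lborel. (h n x t - g t x) * \<psi> x\<bar>) \<le> r / 2"
          by (rule cSUP_least) (use T b in auto)
        have "bdd_above ((\<lambda>t. \<bar>LINT x:{0<..}|lborel. (h n x t - g t x) * \<psi> x\<bar>) ` {0..T})" by (rule bdd_aboveI2[OF b])
        then have "\<bar>LINT x:{0<..}|lborel. (h n x 0 - g 0 x) * \<psi> x\<bar> \<le> (SUP t\<in>{0..T}. \<bar>LINT x:{0<..}|lborel. (h n x t - g t x) * \<psi> x\<bar>)"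
          by (rule cSUP_upper2[where x=0]) (use T in auto)
        then have "0 \<le> (SUP t\<in>{0..T}. \<bar>LINT x:{0<..}|lborel. (h n x t - g t x) * \<psi> x\<bar>)" by (rule order_trans[OF abs_ge_zero])
        then show ?thesis using up r by simp
      qed
      then show "\<exists>n0. \<forall>n\<ge>n0. norm ((SUP t\<in>{0..T}. \<bar>LINT x:{0<..}|lborel. (h n x t - g t x) * \<psi> x\<bar>) - 0) < r" by blast
    qed
  qed
  ultimately show ?thesis unfolding converges_CwL1_def by blast
qed

end

section \<open>The continuum limit\<close>

text \<open>
The piecewise constant functions satisfy all the uniform hypotheses with the constants \<open>C\<close> from the
growth of the kernel and \<open>B\<close> from the number and the first moment of the initial datum.
\<close>

lemma rbk_sequence_of_discretisations:
  fixes K :: "real \<Rightarrow> real \<Rightarrow> real" and F :: "real \<Rightarrow> real" and \<epsilon> :: "nat \<Rightarrow> real"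
  assumes K: "kernel_hyps K"
    and F: "F \<in> borel_measurable borel" "\<And>x. 0 \<le> F x" "\<And>x. x \<le> 0 \<Longrightarrow> F x = 0" "integrable lborel (\<lambda>x. (1 + x) * F x)"
    and \<epsilon>: "\<And>n. 0 < \<epsilon> n" "\<And>n. \<epsilon> n < 1" "\<epsilon> \<longlonglongrightarrow> 0"
    and a: "\<And>n. coefficient_of K (\<epsilon> n) (a n)"
    and f0: "\<And>n i. 1 \<le> i \<Longrightarrow> f0 n i = discrete_init F (\<epsilon> n) i"
    and sol: "\<And>n. discrete_solution (a n) (f0 n) (f n)"
    and mass: "\<And>n t. 0 \<le> t \<Longrightarrow> (\<Sum>i. real (Suc i) * f n (Suc i) t) \<le> (\<Sum>i. real (Suc i) * f0 n (Suc i))"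
  obtains C B where "rbk_sequence (\<lambda>n. cell_kernel (\<epsilon> n) (a n)) (\<lambda>n. node (\<epsilon> n)) (\<lambda>n. \<epsilon> n / 2) C B
    (\<lambda>n. cell_solution (\<epsilon> n) (f n)) K F"
proof -
  have FwF: "F x \<le> (1 + x) * F x" for x using F(2)[of x] F(3)[of x] by (cases "x \<le> 0") (auto simp: distrib_right)
  have Fi: "integrable lborel F" by (rule integrable_between[OF F(4) _ F(2) FwF]) (use F(1) in simp)
  have xFi: "integrable lborel (\<lambda>x. x * F x)"
    using Bochner_Integration.integrable_diff[OF F(4) Fi] by (simp add: distrib_right)
  obtain C where C: "\<And>\<epsilon> a x y. 0 < \<epsilon> \<Longrightarrow> \<epsilon> < 1 \<Longrightarrow> coefficient_of K \<epsilon> a \<Longrightarrow> 0 < x \<Longrightarrow> 0 < y \<Longrightarrow> cell_kernel \<epsilon> a x y \<le> C * (1 + x) * (1 + y)"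
    using cell_kernel_linear_growth[OF K] by blast
  define B where "B = 2 * ((\<integral>x. F x \<partial>lborel) + 2 * (\<integral>x. x * F x \<partial>lborel))"
  have disc: "discretised_rbk K (\<epsilon> n) (a n) (f0 n) (f n)" for n
    by (rule discretised_rbk.intro) (use K \<epsilon> a sol in auto)
  have avg: "by_cell (\<epsilon> n) (f0 n) = cell_average (\<epsilon> n) F" for n
    unfolding cell_average_def by_cell_def using f0 by (auto simp: fun_eq_iff)
  have U0: "cell_solution (\<epsilon> n) (f n) 0 = cell_average (\<epsilon> n) F" for n
    using discretised_rbk.u_initial[OF disc] avg by simp
  have moment: "(\<integral>x. (1 + x) * cell_solution (\<epsilon> n) (f n) t x \<partial>lborel) \<le> B" for n t
    unfolding B_def
  proof (rule discretised_rbk.first_moment_le[OF disc mass])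
    show "(\<integral>x. by_cell (\<epsilon> n) (f0 n) x \<partial>lborel) \<le> (\<integral>x. F x \<partial>lborel)"
      unfolding avg by (rule cell_average_integral_le(2)[OF \<epsilon>(1) Fi F(2)])
    have "F x = 0" if "x < 0" for x using F(3) that by simp
    from discrete_init_moment(2)[OF \<epsilon>(1)[of n] xFi Fi F(2) this]
    show "(\<epsilon> n)\<^sup>2 * (\<Sum>i. real (Suc i) * f0 n (Suc i)) \<le> 2 * (\<integral>x. x * F x \<partial>lborel)" by (simp add: f0)
  qed
  have "rbk_sequence (\<lambda>n. cell_kernel (\<epsilon> n) (a n)) (\<lambda>n. node (\<epsilon> n)) (\<lambda>n. \<epsilon> n / 2) C B (\<lambda>n. cell_solution (\<epsilon> n) (f n)) K F"
  proof (rule rbk_sequence.intro)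
    show "shifted_rbk (cell_kernel (\<epsilon> n) (a n)) (node (\<epsilon> n)) (\<epsilon> n / 2) C B (cell_solution (\<epsilon> n) (f n))" for n
      by (rule discretised_rbk.shifted_rbk_instance[OF disc]) (use C \<epsilon> a moment in auto)
    show "(\<lambda>n. \<epsilon> n / 2) \<longlonglongrightarrow> 0" using tendsto_divide[OF \<epsilon>(3) tendsto_const, of 2] by simp
    show "\<epsilon> n / 2 \<le> 1" for n using \<epsilon>(2)[of n] by simp
    show "\<bar>node (\<epsilon> n) y - y\<bar> \<le> \<epsilon> n / 2" if "\<epsilon> n / 2 \<le> y" for n y
      unfolding node_def by (rule cell_node_close[OF \<epsilon>(1) that])
    show "\<exists>A\<ge>0. \<exists>R\<ge>0. \<forall>n. (\<integral>x. max 0 (cell_solution (\<epsilon> n) (f n) 0 x - A * indicator {0..R} x) \<partial>lborel) \<le> \<eta>" if "0 < \<eta>" for \<eta>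
    proof -
      have "F x = 0" if "x < 0" for x using F(3) that by simp
      from cell_average_uniformly_integrable[OF Fi F(2) this \<open>0 < \<eta>\<close>] show ?thesis unfolding U0 using \<epsilon> by blast
    qed
    show "\<exists>R\<ge>1. \<forall>n x y. 0 < x \<longrightarrow> 0 < y \<longrightarrow> R \<le> x \<or> R \<le> y \<longrightarrow> cell_kernel (\<epsilon> n) (a n) x y \<le> \<eta> * (1 + x) * (1 + y)" if "0 < \<eta>" for \<eta>
      using cell_kernel_sublinear[OF K that] \<epsilon> a by meson
    show "(\<lambda>n. cell_kernel (\<epsilon> n) (a n) x y) \<longlonglongrightarrow> K x y" if "0 < x" "0 < y" for x y
      by (rule cell_kernel_tendsto[OF K \<epsilon>(3) \<epsilon>(1) a that])
    show "(\<lambda>n. \<integral>x. cell_solution (\<epsilon> n) (f n) 0 x * indicator {q<..} x \<partial>lborel) \<longlonglongrightarrow> (\<integral>x. F x * indicator {q<..} x \<partial>lborel)" for q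
      unfolding U0 by (rule cell_average_weak_limit[OF Fi F(3) \<epsilon>(3) \<epsilon>(1)])
  qed (use Fi F(3) in auto)
  then show thesis by (rule that)
qed

theorem theorem3p1:
  fixes K :: "real \<Rightarrow> real \<Rightarrow> real"
    and fin :: "real \<Rightarrow> real"
    and a :: "real \<Rightarrow> nat \<Rightarrow> nat \<Rightarrow> real"
    and f :: "real \<Rightarrow> nat \<Rightarrow> real \<Rightarrow> real"
  assumes kernel: "kernel_hyps K"
    and init: "fin \<in> X01_pos"
    and coeff:
      "(\<forall>\<epsilon>\<in>{0<..<1}. \<forall>i\<ge>1. \<forall>j\<ge>1. a \<epsilon> i j = averaged_coeff K \<epsilon> i j) \<or>
       (\<forall>\<epsilon>\<in>{0<..<1}. \<forall>i\<ge>1. \<forall>j\<ge>1. a \<epsilon> i j = pointwise_coeff K \<epsilon> i j)"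
    and sol: "\<forall>\<epsilon>\<in>{0<..<1}. discrete_solution (a \<epsilon>) (discrete_init fin \<epsilon>) (f \<epsilon>)"
    and mass: "\<forall>\<epsilon>\<in>{0<..<1}. \<forall>t\<ge>0.
      (\<Sum>i. real (Suc i) * f \<epsilon> (Suc i) t) \<le> (\<Sum>i. real (Suc i) * discrete_init fin \<epsilon> (Suc i))"
  shows "\<exists>(\<epsilon> :: nat \<Rightarrow> real) (g :: real \<Rightarrow> real \<Rightarrow> real).
    (\<forall>n. \<epsilon> n \<in> {0<..<1}) \<and> \<epsilon> \<longlonglongrightarrow> 0 \<and>
    weak_solution K fin \<infinity> g \<and>
    (\<forall>T>0. converges_CwL1 T (\<lambda>n. step_function (\<epsilon> n) (f (\<epsilon> n))) g)"
proof -
  define fin0 where "fin0 = (\<lambda>x. indicator {0<..} x * fin x)"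
  \<comment> \<open>a version of the initial datum that is Borel and non-negative everywhere\<close>
  define F where "F = (\<lambda>x. max 0 (fin0 x))"
  have wi: "integrable lborel (\<lambda>x. (1 + x) * fin0 x)"
    using init unfolding X01_pos_def X01_def set_integrable_def fin0_def by (simp add: mult_ac)
  have fin0m: "fin0 \<in> borel_measurable borel"
  proof -
    have m: "(\<lambda>x. (1 + x) * fin0 x) \<in> borel_measurable borel" using wi by auto
    have "fin0 = (\<lambda>x. if 0 < x then ((1 + x) * fin0 x) / (1 + x) else 0)" by (auto simp: fin0_def)
    also have "\<dots> \<in> borel_measurable borel" using m by measurable
    finally show ?thesis .
  qed
  have ae: "AE x in lborel. fin0 x = F x"
  proof -
    have "AE x in lborel. 0 < x \<longrightarrow> 0 \<le> fin x" using init by (simp add: X01_pos_def)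
    then show ?thesis by eventually_elim (auto simp: F_def fin0_def indicator_def)
  qed
  have Fm: "F \<in> borel_measurable borel" unfolding F_def using fin0m by measurable
  have Fi: "integrable lborel (\<lambda>x. (1 + x) * F x)"
    by (rule integrable_cong_AE_imp[OF wi]) (use Fm ae in \<open>auto elim: eventually_mono\<close>)
  \<comment> \<open>any sequence in the open unit interval that tends to zero would do; the shift by \<open>2\<close> avoids \<open>1\<close>\<close>
  define e where "e = (\<lambda>n::nat. 1 / real (n + 2))"
  have e: "0 < e n" "e n < 1" for n by (auto simp: e_def)
  have e_lim: "e \<longlonglongrightarrow> 0" unfolding e_def by (rule LIMSEQ_ignore_initial_segment[OF lim_const_over_n, of 1 2])
  have en: "e n \<in> {0<..<1}" for n using e[of n] by simp
  have ini: "discrete_init fin (e n) i = discrete_init F (e n) i" if i: "1 \<le> i" for n i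
  proof -
    have pos: "0 < x" if "x \<in> cell (e n) i" for x
    proof -
      have "(real i - 1/2) * e n \<le> x" using that by (simp add: cell_def)
      moreover have "0 < (real i - 1/2) * e n" using i e(1)[of n] by simp
      ultimately show ?thesis by simp
    qed
    have "(LINT x:cell (e n) i|lborel. fin x) = (\<integral>x. indicator (cell (e n) i) x * fin0 x \<partial>lborel)"
      unfolding set_lebesgue_integral_def using pos
      by (intro Bochner_Integration.integral_cong refl) (auto simp: fin0_def indicator_def)
    also have "\<dots> = (\<integral>x. indicator (cell (e n) i) x * F x \<partial>lborel)"
      by (rule integral_cong_AE) (use fin0m Fm ae in \<open>auto intro!: borel_measurable_times elim: eventually_mono\<close>)
    finally show ?thesis by (simp add: discrete_init_def set_lebesgue_integral_def)
  qed
  have co: "coefficient_of K (e n) (a (e n))" for n using coeff en[of n] unfolding coefficient_of_def by blast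
  obtain C B where "rbk_sequence (\<lambda>n. cell_kernel (e n) (a (e n))) (\<lambda>n. node (e n)) (\<lambda>n. e n / 2) C B
    (\<lambda>n. cell_solution (e n) (f (e n))) K F"
  proof (rule rbk_sequence_of_discretisations[OF kernel Fm _ _ Fi e e_lim co ini])
    show "0 \<le> F x" "x \<le> 0 \<Longrightarrow> F x = 0" for x by (auto simp: F_def fin0_def)
    show "discrete_solution (a (e n)) (discrete_init fin (e n)) (f (e n))" for n using sol en by blast
    show "(\<Sum>i. real (Suc i) * f (e n) (Suc i) t) \<le> (\<Sum>i. real (Suc i) * discrete_init fin (e n) (Suc i))" if "0 \<le> t" for n t
      using mass en[of n] that by blast
  qed
  then interpret rbk_sequence "\<lambda>n. cell_kernel (e n) (a (e n))" "\<lambda>n. node (e n)" "\<lambda>n. e n / 2" C B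
    "\<lambda>n. cell_solution (e n) (f (e n))" K F .
  obtain \<sigma> g where \<sigma>: "strict_mono (\<sigma> :: nat \<Rightarrow> nat)" and g:
    "\<And>t. 0 \<le> t \<Longrightarrow> integrable lborel (g t)" "\<And>t x. 0 \<le> t \<Longrightarrow> 0 \<le> g t x" "\<And>t x. 0 \<le> t \<Longrightarrow> x \<le> 0 \<Longrightarrow> g t x = 0"
    "\<And>t \<phi> D. 0 \<le> t \<Longrightarrow> \<phi> \<in> borel_measurable borel \<Longrightarrow> (\<And>x. \<bar>\<phi> x\<bar> \<le> D) \<Longrightarrow>
       (\<lambda>n. \<integral>x. cell_solution (e (\<sigma> n)) (f (e (\<sigma> n))) t x * \<phi> x \<partial>lborel) \<longlonglongrightarrow> (\<integral>x. g t x * \<phi> x \<partial>lborel)"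
  proof (rule weakly_convergent_subsequence, goal_cases)
    case (1 \<sigma> g)
    show ?case by (rule 1(1)) (fact 1)+
  qed
  interpret L: rbk_limit "\<lambda>n. cell_kernel (e (\<sigma> n)) (a (e (\<sigma> n)))" "\<lambda>n. node (e (\<sigma> n))" "\<lambda>n. e (\<sigma> n) / 2" C B
    "\<lambda>n. cell_solution (e (\<sigma> n)) (f (e (\<sigma> n)))" K F g
    by (rule rbk_limit.intro[OF subsequence[OF \<sigma>]], rule rbk_limit_axioms.intro) (fact g)+
  have "weak_solution K fin \<infinity> (\<lambda>x t. g t x)"
    by (rule L.weak_solution_limit) (use kernel_hyps_regular(2)[OF kernel] fin0m ae in \<open>auto simp: fin0_def\<close>)
  moreover have "converges_CwL1 T (\<lambda>n. step_function (e (\<sigma> n)) (f (e (\<sigma> n)))) (\<lambda>x t. g t x)" if "0 < T" for T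
    by (rule L.converges_CwL1_limit[OF that]) (simp add: step_function_by_cell e(1) cell_solution_def)
  moreover have "(\<lambda>n. e (\<sigma> n)) \<longlonglongrightarrow> 0" using LIMSEQ_subseq_LIMSEQ[OF e_lim \<sigma>] by (simp add: o_def)
  ultimately show ?thesis using en by (intro exI[of _ "\<lambda>n. e (\<sigma> n)"] exI[of _ "\<lambda>x t. g t x"]) blast
qed

end
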